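(* Let $M$ be the rank one Heisenberg (one free boson) vertex operator algebra. Then its genus two partition function in the $\epsilon$-formalism is $$Z_{M}^{(2)}(\tau_1,\tau_2,\epsilon)=Z_{M}^{(1)}(\tau_1)\,Z_{M}^{(1)}(\tau_2)\,\bigl(\det(I-A_1A_2)\bigr)^{-1/2},$$ where $A_1,A_2$ are the infinite matrices with entries $A_a(k,l)=\frac{\epsilon^{(k+l)/2}}{\sqrt{kl}}C(k,l,\tau_a)$ for $k,l\ge 1$, and $Z_M^{(1)}(\tau)=q^{1/24}/\eta(\tau)$ with $q=e^{2\pi i\tau}$.
   Context: Notation. $\tau,\tau_1,\tau_2\in\mathbb{H}_1$ (upper half-plane), $q=e^{2\pi i\tau}$, $\eta(\tau)=q^{1/24}\prod_{n\ge1}(1-q^n)$. $E_k(\tau)=0$ for $k$ odd; for $k\geq 2$ even $E_k(\tau)=-\frac{B_k}{k!}+\frac{2}{(k-1)!}\sum_{n\ge1}\sigma_{k-1}(n)q^n$. $C(k,l,\tau)=(-1)^{k+1}\frac{(k+l-1)!}{(k-1)!(l-1)!}E_{k+l}(\tau)$ for $k,l\ge1$. The determinant is defined by $\log\det(I-A_1A_2)=-\sum_{n\ge1}\frac1n \mathrm{tr}((A_1A_2)^n)$ (a power series in $\epsilon$), and $(\det(I-A_1A_2))^{-1/2}=\exp(-\frac12\log\det(I-A_1A_2))$. VOA definitions. For a vertex operator algebra $(V,Y,\mathbf 1,\omega)$ of central charge $c$ with $Y(v,z)=\sum_n v(n)z^{-n-1}$, the zero mode is $o(v)=v(wt(v)-1)$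 for homogeneous $v$ (extended linearly), and the genus one partition and 1-point functions are $Z_V^{(1)}(\tau)=Tr_V(q^{L(0)})$, $Z_V^{(1)}(v,\tau)=Tr_V(o(v)q^{L(0)})$ (no factor $q^{-c/24}$). The square bracket VOA $(V,Y[\,,],\mathbf 1,\tilde\omega)$ has $Y[v,z]=Y(e^{zL(0)}v,e^z-1)$ and $\tilde\omega=\omega-\frac{c}{24}\mathbf 1$; write $Y[\tilde\omega,z]=\sum_n L[n]z^{-n-2}$ and $V_{[n]}=\{v: L[0]v=nv\}$. The Li-Zamolodchikov (LiZ) metric of a VOA is the unique bilinear form with $\langle\mathbf 1,\mathbf 1\rangle=1$ and $\langle Y(a,z)b,c\rangle=\langle b,Y(e^{zL(1)}(-z^{-2})^{L(0)}a,z^{-1})c\rangle$; $\langle\,,\rangle_{\mathrm{sq}}$ is the LiZ metric of the square bracket VOA. The genus two partition function in the $\epsilon$-formalism is $$Z_V^{(2)}(\tau_1,\tau_2,\epsilon)=\sum_{n\ge0}\epsilon^n\sum_{u\in V_{[n]}}Z_V^{(1)}(u,\tau_1)Z_V^{(1)}(\bar u,\tau_2),$$ where the inner sum is over any basis $\{u\}$ of $V_{[n]}$ and $\{\bar u\}$ is the dual basis with respect to $\langle\,,\rangle_{\mathrm{sq}}$; a priori it is a formal power series in $\epsilon$. The rank one Heisenberg VOA $M$ is generated by a weight one state $a$ with $[a(m),a(n)]=m\delta_{m,-n}$, with Fock basis $a(-1)^{e_1}\cdots a(-p)^{e_p}\mathbf 1$ and conformal vector $\frac12a(-1)^2\mathbf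 1$ of central charge 1. *)

theory Defs
  imports
    "HOL-Analysis.Analysis"
    "HOL-Computational_Algebra.Computational_Algebra"
    "HOL-Library.Groups_Big_Fun"
begin

section \<open>Vertex operator algebras\<close>

text \<open>
  The underlying space is the whole type \<open>'v\<close>, with complex scalar multiplication \<open>smult V\<close>.
  \<open>mode V v n\<close> is \<open>v(n)\<close> in \<open>Y(v,z) = \<Sum>\<^sub>n v(n) z\<^sup>-\<^sup>n\<^sup>-\<^sup>1\<close>.
  Sums that are finite for algebraic reasons, although their index ranges over an infinite type,
  are written with the library's \<open>Sum_any\<close> (the sum over the support of the summand).
\<close>

record 'v vertex_alg =
  smult :: "complex \<Rightarrow> 'v \<Rightarrow> 'v"
  mode :: "'v \<Rightarrow> int \<Rightarrow> 'v \<Rightarrow> 'v"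
  vac :: 'v
  conf :: 'v
  central_charge :: complex

text \<open>\<open>Y(\<omega>,z) = \<Sum>\<^sub>n L(n) z\<^sup>-\<^sup>n\<^sup>-\<^sup>2\<close>.\<close>

definition vir :: "('v::ab_group_add) vertex_alg \<Rightarrow> int \<Rightarrow> 'v \<Rightarrow> 'v" where
  "vir V n = mode V (conf V) (n + 1)"

definition weight_space :: "('v::ab_group_add) vertex_alg \<Rightarrow> int \<Rightarrow> 'v set" where
  "weight_space V n = {v. vir V 0 v = smult V (of_int n) v}"

definition is_basis_of :: "('v::ab_group_add) vertex_alg \<Rightarrow> 'v set \<Rightarrow> 'v set \<Rightarrow> bool" where
  "is_basis_of V B S \<longleftrightarrow>
     B \<subseteq> S \<and> \<not> module.dependent (smult V) B \<and> S \<subseteq> module.span (smult V) B"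

text \<open>
  The axiom \<open>jacobi\<close> is the Jacobi identity in modes (Borcherds identity).
\<close>

locale voa =
  vector_space "smult V" for V :: "('v::ab_group_add) vertex_alg" +
  assumes mode_linear_left: "Vector_Spaces.linear (smult V) (smult V) (\<lambda>v. mode V v n w)"
    and mode_linear_right: "Vector_Spaces.linear (smult V) (smult V) (mode V v n)"
    and truncation: "\<exists>N. \<forall>n\<ge>N. mode V u n v = 0"
    and vacuum: "mode V (vac V) n v = (if n = -1 then v else 0)"
    and creation: "mode V v (-1) (vac V) = v"
    and creation_nonneg: "n \<ge> 0 \<Longrightarrow> mode V v n (vac V) = 0"
    and jacobi:
      "Sum_any (\<lambda>j::nat. smult V (of_int p gchoose j)
          (mode V (mode V u (r + int j) v) (p + s - int j) w))
       = Sum_any (\<lambda>j::nat. smult V ((-1) ^ j * (of_int r gchoose j))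
          (mode V u (p + r - int j) (mode V v (s + int j) w)
           - smult V ((-1) powi r) (mode V v (s + r - int j) (mode V u (p + int j) w))))"
    and virasoro:
      "vir V m (vir V n v) - vir V n (vir V m v)
       = smult V (of_int (m - n)) (vir V (m + n) v)
         + (if m + n = 0
            then smult V (of_int (m ^ 3 - m) / 12 * central_charge V) v else 0)"
    and translation: "mode V (vir V (-1) v) n w = smult V (- of_int n) (mode V v (n - 1) w)"
    and grading: "module.span (smult V) (\<Union>n. weight_space V n) = UNIV"
    and weight_finite_dim:
      "\<exists>B. finite B \<and> weight_space V n \<subseteq> module.span (smult V) B"
    and weight_bounded_below: "\<exists>N. \<forall>n<N. weight_space V n = {0}"

text \<open>The component of \<open>v\<close> in \<open>weight_space V n\<close> with respect to the grading.\<close>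

definition component :: "('v::ab_group_add) vertex_alg \<Rightarrow> 'v \<Rightarrow> int \<Rightarrow> 'v" where
  "component V v = (THE f. finite {n. f n \<noteq> 0} \<and> (\<forall>n. f n \<in> weight_space V n) \<and> Sum_any f = v)"


section \<open>Zero modes and genus one functions\<close>

definition zero_mode :: "('v::ab_group_add) vertex_alg \<Rightarrow> 'v \<Rightarrow> 'v \<Rightarrow> 'v" where
  "zero_mode V v w = Sum_any (\<lambda>k. mode V (component V v k) (k - 1) w)"

definition trace_on ::
  "('v::ab_group_add) vertex_alg \<Rightarrow> 'v set \<Rightarrow> ('v \<Rightarrow> 'v) \<Rightarrow> complex" where
  "trace_on V S f =
     (let B = (SOME B. is_basis_of V B S)
      in \<Sum>b\<in>B. module.representation (smult V) B (f b) b)"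

definition nome :: "complex \<Rightarrow> complex" where
  "nome \<tau> = exp (2 * of_real pi * \<i> * \<tau>)"

text \<open>\<open>Tr\<^sub>V(f q\<^sup>L\<^sup>(\<^sup>0\<^sup>))\<close>, for \<open>f\<close> preserving the weight spaces.\<close>

definition graded_trace ::
  "('v::ab_group_add) vertex_alg \<Rightarrow> ('v \<Rightarrow> 'v) \<Rightarrow> complex \<Rightarrow> complex" where
  "graded_trace V f \<tau> = (\<Sum>\<^sub>\<infinity>n\<in>UNIV. trace_on V (weight_space V n) f * nome \<tau> powi n)"

definition genus1_partition :: "('v::ab_group_add) vertex_alg \<Rightarrow> complex \<Rightarrow> complex" where
  "genus1_partition V \<tau> = graded_trace V (\<lambda>w. w) \<tau>"

definition genus1_point :: "('v::ab_group_add) vertex_alg \<Rightarrow> 'v \<Rightarrow> complex \<Rightarrow> complex" where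
  "genus1_point V v \<tau> = graded_trace V (zero_mode V v) \<tau>"


section \<open>The square bracket vertex operator algebra\<close>

text \<open>
  For \<open>v\<close> of weight \<open>k\<close>, \<open>Y[v,z] = \<Sum>\<^sub>m e\<^sup>k\<^sup>z (e\<^sup>z - 1)\<^sup>-\<^sup>m\<^sup>-\<^sup>1 v(m)\<close>, and \<open>v[n]\<close> is the
  coefficient of \<open>z\<^sup>-\<^sup>n\<^sup>-\<^sup>1\<close>. The scalar coefficient below vanishes for \<open>m < n\<close>.
\<close>

definition sq_coeff :: "int \<Rightarrow> int \<Rightarrow> int \<Rightarrow> complex" where
  "sq_coeff k m n =
     fls_nth (fps_to_fls (fps_exp (of_int k)) * (fps_to_fls (fps_exp 1 - 1)) powi (- m - 1))
       (- n - 1)"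

definition sq_mode :: "('v::ab_group_add) vertex_alg \<Rightarrow> 'v \<Rightarrow> int \<Rightarrow> 'v \<Rightarrow> 'v" where
  "sq_mode V v n w =
     Sum_any (\<lambda>k. Sum_any (\<lambda>m. smult V (sq_coeff k m n) (mode V (component V v k) m w)))"

definition square_bracket :: "('v::ab_group_add) vertex_alg \<Rightarrow> 'v vertex_alg" where
  "square_bracket V =
     V\<lparr>mode := sq_mode V, conf := conf V - smult V (central_charge V / 24) (vac V)\<rparr>"


section \<open>The Li--Zamolodchikov metric\<close>

text \<open>
  Invariance is stated for homogeneous \<open>a\<close>, of weight \<open>k\<close>, and for the coefficients of
  \<open>z\<^sup>-\<^sup>n\<^sup>-\<^sup>1\<close>: since \<open>e\<^sup>z\<^sup>L\<^sup>(\<^sup>1\<^sup>)(-z\<^sup>-\<^sup>2)\<^sup>L\<^sup>(\<^sup>0\<^sup>)a = (-1)\<^sup>k \<Sum>\<^sub>j z\<^sup>j\<^sup>-\<^sup>2\<^sup>k L(1)\<^sup>j a / j!\<close>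
  and \<open>Y(b,z\<^sup>-\<^sup>1) = \<Sum>\<^sub>m b(m) z\<^sup>m\<^sup>+\<^sup>1\<close>, only \<open>m = 2k - n - j - 2\<close> contributes.
\<close>

definition is_liz_metric ::
  "('v::ab_group_add) vertex_alg \<Rightarrow> ('v \<Rightarrow> 'v \<Rightarrow> complex) \<Rightarrow> bool" where
  "is_liz_metric V \<beta> \<longleftrightarrow>
     (\<forall>x. Vector_Spaces.linear (smult V) (*) (\<lambda>y. \<beta> x y)) \<and>
     (\<forall>y. Vector_Spaces.linear (smult V) (*) (\<lambda>x. \<beta> x y)) \<and>
     \<beta> (vac V) (vac V) = 1 \<and>
     (\<forall>k. \<forall>a\<in>weight_space V k. \<forall>n b c.
        \<beta> (mode V a n b) c =
        (-1) powi k *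
        Sum_any (\<lambda>j::nat.
          \<beta> b (mode V ((vir V 1 ^^ j) a) (2 * k - n - int j - 2) c) / fact j))"

definition liz_metric :: "('v::ab_group_add) vertex_alg \<Rightarrow> 'v \<Rightarrow> 'v \<Rightarrow> complex" where
  "liz_metric V = (THE \<beta>. is_liz_metric V \<beta>)"


section \<open>The genus two partition function\<close>

text \<open>The element dual to \<open>u \<in> B\<close>, for a basis \<open>B\<close> of the subspace \<open>S\<close>.\<close>

definition dual_elem ::
  "('v \<Rightarrow> 'v \<Rightarrow> complex) \<Rightarrow> 'v set \<Rightarrow> 'v set \<Rightarrow> 'v \<Rightarrow> 'v" where
  "dual_elem \<beta> S B u = (THE w. w \<in> S \<and> (\<forall>u'\<in>B. \<beta> u' w = (if u' = u then 1 else 0)))"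

text \<open>
  A formal power series in \<open>\<epsilon>\<close>. The argument \<open>B\<close> is the family of bases used for the
  sums over the square bracket weight spaces.
\<close>

definition genus2_partition ::
  "('v::ab_group_add) vertex_alg \<Rightarrow> (nat \<Rightarrow> 'v set) \<Rightarrow> complex \<Rightarrow> complex \<Rightarrow> complex fps" where
  "genus2_partition V B \<tau>\<^sub>1 \<tau>\<^sub>2 =
     Abs_fps (\<lambda>n. \<Sum>u\<in>B n.
       genus1_point V u \<tau>\<^sub>1 *
       genus1_point V
         (dual_elem (liz_metric (square_bracket V))
            (weight_space (square_bracket V) (int n)) (B n) u) \<tau>\<^sub>2)"


section \<open>The rank one Heisenberg vertex operator algebra\<close>

text \<open>
  The Fock vector \<open>a(-n\<^sub>1) \<cdots> a(-n\<^sub>k) \<one>\<close>. For sorted lists of positive numbers, with \<open>i\<close> occurring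
  \<open>e\<^sub>i\<close> times, these are exactly the vectors \<open>a(-1)\<^sup>e\<^sup>1 \<cdots> a(-p)\<^sup>e\<^sup>p \<one>\<close>, each listed once.
\<close>

definition fock_vector :: "('v::ab_group_add) vertex_alg \<Rightarrow> 'v \<Rightarrow> nat list \<Rightarrow> 'v" where
  "fock_vector V a ns = foldr (\<lambda>n. mode V a (- int n)) ns (vac V)"

definition fock_index :: "nat list set" where
  "fock_index = {ns. sorted ns \<and> (\<forall>n\<in>set ns. n \<ge> 1)}"

locale heisenberg_voa = voa M for M :: "('v::ab_group_add) vertex_alg" +
  fixes a :: 'v
  assumes weight_one: "a \<in> weight_space M 1"
    and heisenberg:
      "mode M a m (mode M a n v) - mode M a n (mode M a m v)
       = (if m = - n then smult M (of_int m) v else 0)"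
    and fock_inj: "inj_on (fock_vector M a) fock_index"
    and fock_basis: "is_basis_of M (fock_vector M a ` fock_index) UNIV"
    and conformal_vector: "conf M = smult M (1/2) (mode M a (-1) (mode M a (-1) (vac M)))"
    and central_charge_one: "central_charge M = 1"


section \<open>Modular forms\<close>

text \<open>\<open>x / (e\<^sup>x - 1) = \<Sum>\<^sub>k B\<^sub>k x\<^sup>k / k!\<close>\<close>

definition bernoulli_number :: "nat \<Rightarrow> complex" where
  "bernoulli_number k = fact k * fps_nth (fps_X / (fps_exp 1 - 1)) k"

definition divisor_sum :: "nat \<Rightarrow> nat \<Rightarrow> nat" where
  "divisor_sum k n = (\<Sum>d | d dvd n. d ^ k)"

definition eisenstein_E :: "nat \<Rightarrow> complex \<Rightarrow> complex" where
  "eisenstein_E k \<tau> =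
     (if odd k then 0
      else - bernoulli_number k / fact k
           + 2 / fact (k - 1) *
             suminf (\<lambda>n. of_nat (divisor_sum (k - 1) (Suc n)) * nome \<tau> ^ Suc n))"

text \<open>\<open>q\<^sup>1\<^sup>/\<^sup>2\<^sup>4\<close>, understood as \<open>e\<^sup>2\<^sup>\<pi>\<^sup>i\<^sup>\<tau>\<^sup>/\<^sup>2\<^sup>4\<close>\<close>

definition nome_root24 :: "complex \<Rightarrow> complex" where
  "nome_root24 \<tau> = exp (2 * of_real pi * \<i> * \<tau> / 24)"

definition dedekind_eta :: "complex \<Rightarrow> complex" where
  "dedekind_eta \<tau> = nome_root24 \<tau> * prodinf (\<lambda>n. 1 - nome \<tau> ^ Suc n)"

definition C_coeff :: "nat \<Rightarrow> nat \<Rightarrow> complex \<Rightarrow> complex" where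
  "C_coeff k l \<tau> =
     (-1) ^ (k + 1) * (fact (k + l - 1) / (fact (k - 1) * fact (l - 1))) * eisenstein_E (k + l) \<tau>"


section \<open>Infinite matrices and the determinant\<close>

text \<open>
  Matrices are indexed by \<open>k, l \<ge> 1\<close> (values at index \<open>0\<close> are never used), and their entries
  are formal power series in \<open>s = \<epsilon>\<^sup>1\<^sup>/\<^sup>2\<close>. Infinite sums are limits in the \<open>s\<close>-adic topology
  of \<^typ>\<open>complex fps\<close>.
\<close>

definition A_matrix :: "complex \<Rightarrow> nat \<Rightarrow> nat \<Rightarrow> complex fps" where
  "A_matrix \<tau> k l =
     fps_X ^ (k + l) * fps_const (C_coeff k l \<tau> / of_real (sqrt (real k * real l)))"

definition inf_mat_mult ::
  "(nat \<Rightarrow> nat \<Rightarrow> complex fps) \<Rightarrow> (nat \<Rightarrow> nat \<Rightarrow> complex fps) \<Rightarrow> nat \<Rightarrow> nat \<Rightarrow> complex fps" where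
  "inf_mat_mult A B k l = suminf (\<lambda>m. A k (Suc m) * B (Suc m) l)"

fun inf_mat_power ::
  "(nat \<Rightarrow> nat \<Rightarrow> complex fps) \<Rightarrow> nat \<Rightarrow> nat \<Rightarrow> nat \<Rightarrow> complex fps" where
  "inf_mat_power A 0 = (\<lambda>k l. if k = l then 1 else 0)"
| "inf_mat_power A (Suc n) = inf_mat_mult A (inf_mat_power A n)"

definition inf_mat_trace :: "(nat \<Rightarrow> nat \<Rightarrow> complex fps) \<Rightarrow> complex fps" where
  "inf_mat_trace A = suminf (\<lambda>k. A (Suc k) (Suc k))"

text \<open>\<open>log det(I - A)\<close> and \<open>det(I - A)\<^sup>-\<^sup>1\<^sup>/\<^sup>2\<close>, for \<open>A\<close> with entries divisible by \<open>s\<close>\<close>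

definition log_det_one_minus :: "(nat \<Rightarrow> nat \<Rightarrow> complex fps) \<Rightarrow> complex fps" where
  "log_det_one_minus A =
     - suminf (\<lambda>n. fps_const (1 / of_nat (Suc n)) * inf_mat_trace (inf_mat_power A (Suc n)))"

definition det_one_minus_inv_sqrt :: "(nat \<Rightarrow> nat \<Rightarrow> complex fps) \<Rightarrow> complex fps" where
  "det_one_minus_inv_sqrt A =
     fps_compose (fps_exp 1) (fps_const (- 1 / 2) * log_det_one_minus A)"

end

theory Submission
  imports Defs
begin

text \<open>
  The square bracket modes \<open>a[n]\<close> satisfy the Heisenberg relations again, so the space is also the Fock
  space of the \<open>a[n]\<close>, and the Li-Zamolodchikov metric is the form for which \<open>-a[-n]\<close> is
  adjoint to \<open>a[n]\<close>. Zhu recursion, from the commutator formula and the cyclicity of the trace, expresses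
  \<open>Z(a[-k]v, \<tau>)\<close> as \<open>\<Sum>\<^sub>j C(k,j,\<tau>)/j Z(a[j]v, \<tau>)\<close>.

  Let \<open>\<gamma>\<^sub>n\<close> represent \<open>Z(_, \<tau>\<^sub>2)\<close> on the weight \<open>n\<close> space, so that
  \<open>Z\<^sup>(\<^sup>2\<^sup>) = \<Sum>\<^sub>n \<epsilon>\<^sup>n Z(\<gamma>\<^sub>n, \<tau>\<^sub>1)\<close>. Recursion at \<open>\<tau>\<^sub>2\<close> and adjunction turn \<open>a[k]\<gamma>\<^sub>n\<close> into a
  combination of the \<open>a[-l]\<gamma>\<^sub>m\<close>. Together with recursion at \<open>\<tau>\<^sub>1\<close>, the matrix \<open>U\<close> of suitably normalised
  values \<open>Z(a[-k]a[l]\<gamma>\<^sub>n, \<tau>\<^sub>1)\<close> satisfies \<open>U = (Z\<^sup>(\<^sup>2\<^sup>) + U) A\<^sub>1A\<^sub>2\<close>, hence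
  \<open>U = Z\<^sup>(\<^sup>2\<^sup>) \<Sum>\<^sub>n (A\<^sub>1A\<^sub>2)\<^sup>n\<close> over \<open>n \<ge> 1\<close>. Since \<open>L[0] = \<Sum>\<^sub>k a[-k]a[k]\<close>, the logarithmic
  \<open>\<epsilon>\<close>-derivative of \<open>Z\<^sup>(\<^sup>2\<^sup>)\<close> is the weighted trace of \<open>U/Z\<^sup>(\<^sup>2\<^sup>)\<close>, which is that of
  \<open>det(I - A\<^sub>1A\<^sub>2)\<^bsup>-1/2\<^esup>\<close> because \<open>A(k,l)\<close> is a multiple of \<open>\<epsilon>\<^bsup>(k+l)/2\<^esup>\<close>.
\<close>

section \<open>Residues and the square bracket coefficients\<close>

text \<open>With z = ln(1 + w), a square bracket mode of a state of weight k is the residue in w of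
  (1 + w)^(k-1) ln(1 + w)^n Y(v,w). Passing between the two kinds of modes is therefore a change of
  coordinate, and the coefficient identities follow from (1 + w) d/dw = d/dz.

  Two obstacles shape the proof. \<open>liz_metric\<close> is given by a definite description, so a
  form must be found that is invariant under every state, although the explicit Fock form is built
  to be invariant under a alone; uniqueness, by contrast, needs a alone. And
  \<open>genus1_point\<close> is an infinite sum of traces, so recursion is proved for formal
  q-series and evaluated only after convergence in the unit disc is known; for the vacuum this comes
  from N d(N) = sum sigma_1(i) d(N-i) for the dimensions d(N), which also yields the eta product.

  The variable s with s^2 = epsilon is forced by the exponents (k+l)/2, and the factor 1/sqrt(kl)
  makes both matrices symmetric. No determinant is expanded: both sides solve the same first-order
  equation in s d/ds and agree at s = 0.\<close>

lemma fls_deriv_power: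
  fixes f :: "'a::field fls"
  shows "fls_deriv (f ^ n) = of_nat n * f ^ (n - 1) * fls_deriv f"
proof (induction n)
  case (Suc n)
  then show ?case by (cases n) (simp_all add: algebra_simps)
qed auto

lemma fls_deriv_powi:
  fixes f :: "'a::field fls"
  assumes "f \<noteq> 0"
  shows "fls_deriv (f powi n) = of_int n * f powi (n - 1) * fls_deriv f"
proof (cases "n \<ge> 0")
  case True
  then obtain k where k: "n = int k" by (metis nat_0_le)
  show ?thesis
  proof (cases k)
    case (Suc j)
    have "int k - 1 = int j" using Suc by simp
    then show ?thesis using Suc by (simp only: k fls_deriv_power power_int_of_nat of_int_of_nat_eq) simp
  qed (simp add: k)
next
  case False
  define k where "k = nat (- n)"
  have n: "n = - int k" and "k > 0" using False by (auto simp: k_def)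
  have "f powi n * f ^ k = 1" using assms by (simp add: n power_int_minus)
  then have "fls_deriv (f powi n * f ^ k) = 0" by simp
  then have "fls_deriv (f powi n) * f ^ k = - (f powi n * (of_nat k * f ^ (k - 1) * fls_deriv f))"
    by (simp add: fls_deriv_power algebra_simps eq_neg_iff_add_eq_0)
  then have "fls_deriv (f powi n) = - (of_nat k * f powi n * f ^ (k - 1) * fls_deriv f) / f ^ k"
    using assms by (simp add: field_simps)
  also have "f ^ (k - 1) = f ^ k / f" using \<open>k > 0\<close> assms by (simp add: power_diff)
  finally show ?thesis using assms by (simp add: n power_int_diff field_simps)
qed

lemma fls_nth_times_X_powi:
  fixes f :: "'a::field fls"
  shows "fls_nth (f * fls_X powi i) n = fls_nth f (n - i)"
  by (simp add: fls_X_power_int fls_X_intpow_times_conv_shift)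

lemma fls_eq_fps_times_powi:
  fixes F :: "'a::field fls"
  obtains \<phi> :: "'a fps" and i where "F = fps_to_fls \<phi> * fls_X powi i"
proof
  show "F = fps_to_fls (fls_base_factor_to_fps F) * fls_X powi fls_subdegree F"
    by (rule fls_eqI)
      (metis fls_conv_base_factor_to_fps_shift_subdegree fls_nth_times_X_powi fls_shift_nth diff_minus_eq_add minus_minus diff_conv_add_uminus)
qed

lemma fls_deriv_compose_fps:
  fixes F :: "'a::field fls"
  assumes "H \<noteq> 0" "fps_nth H 0 = 0"
  shows "fls_deriv (fls_compose_fps F H) = fls_compose_fps (fls_deriv F) H * fps_to_fls (fps_deriv H)"
proof -
  obtain \<phi> i where F: "F = fps_to_fls \<phi> * fls_X powi i" by (rule fls_eq_fps_times_powi)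
  have X: "(fls_X :: 'a fls) \<noteq> 0" by simp
  have H: "fps_to_fls H \<noteq> 0" using assms by simp
  show ?thesis
    unfolding F using assms H
    by (simp del: fls_X_power_int add: fls_compose_fps_mult fls_compose_fps_powi fls_compose_fps_add fls_deriv_powi
        fls_deriv_fps_to_fls fps_compose_deriv fls_times_fps_to_fls algebra_simps)
qed

lemma fls_deriv_integral:
  fixes F :: "'a::field_char_0 fls"
  shows "fls_deriv (fls_integral F) = F - fls_const (fls_residue F) * inverse fls_X"
proof (rule fls_eqI)
  fix n
  have "fls_nth (fls_const (fls_residue F) * inverse fls_X) n = (if n = -1 then fls_residue F else 0)"
    by (simp add: fls_inverse_X)
  then show "fls_nth (fls_deriv (fls_integral F)) n = fls_nth (F - fls_const (fls_residue F) * inverse fls_X) n"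
    by (cases "n = -1") (auto simp add: field_simps add_eq_0_iff simp flip: of_int_add)
qed

text \<open>Split F into a derivative and its X^(-1) term. A derivative stays one after substitution
  and has residue zero; the other term becomes the logarithmic derivative of H, whose residue is the
  order of H, namely 1.\<close>

lemma fls_residue_compose_fps:
  fixes F :: "'a::field_char_0 fls"
  assumes "fps_nth H 0 = 0" "fps_nth H 1 \<noteq> 0"
  shows "fls_residue (fls_compose_fps F H * fps_to_fls (fps_deriv H)) = fls_residue F"
proof -
  have H: "H \<noteq> 0" "fps_to_fls H \<noteq> 0" using assms by auto
  have sd: "subdegree H = 1" using assms by (intro subdegreeI) auto
  define c where "c = fls_residue F"
  have F: "F = fls_deriv (fls_integral F) + fls_const c * inverse fls_X"
    by (simp add: fls_deriv_integral c_def)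
  have "fls_compose_fps F H * fps_to_fls (fps_deriv H)
     = fls_deriv (fls_compose_fps (fls_integral F) H)
       + fls_const c * (fls_deriv (fps_to_fls H) * inverse (fps_to_fls H))"
    by (subst F) (use assms H in \<open>simp add: fls_compose_fps_add fls_compose_fps_mult
        fls_compose_fps_inverse fls_deriv_compose_fps fls_deriv_fps_to_fls algebra_simps\<close>)
  moreover have "fls_residue (fls_deriv (fps_to_fls H) * inverse (fps_to_fls H)) = 1"
    by (subst fls_residue_deriv_times_inverse_eq_subdegree) (simp add: sd fls_subdegree_fls_to_fps)
  ultimately show ?thesis
    unfolding c_def by (simp only: fls_residue_add fls_residue_deriv fls_residue_fls_const_times) simp
qed

definition ln_fls :: "complex fls" where "ln_fls = fps_to_fls (fps_ln 1)"
definition X_plus_1 :: "complex fls" where "X_plus_1 = 1 + fls_X"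

text \<open>Substituting \<open>w = e\<^sup>z - 1\<close> in the residue that defines \<^const>\<open>sq_coeff\<close> turns it into a coefficient of \<open>(1 + w)\<^bsup>k-1\<^esup> ln(1 + w)\<^sup>n\<close>.\<close>

definition sq_series :: "int \<Rightarrow> int \<Rightarrow> complex fls" where
  "sq_series k n = X_plus_1 powi (k - 1) * ln_fls powi n"

lemma fps_ln_ne_0: "fps_ln (1::complex) \<noteq> 0"
proof
  assume "fps_ln (1::complex) = 0"
  then have "fps_nth (fps_ln (1::complex)) 1 = 0" by simp
  then show False by (simp add: fps_ln_nth)
qed

lemma ln_fls_ne_0 [simp]: "ln_fls \<noteq> 0" using fps_ln_ne_0 by (simp add: ln_fls_def)
lemma X_plus_1_ne_0 [simp]: "X_plus_1 \<noteq> 0"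
proof
  assume "X_plus_1 = 0"
  then have "fls_nth X_plus_1 0 = 0" by simp
  then show False by (simp add: X_plus_1_def)
qed

lemma subdegree_fps_ln: "subdegree (fps_ln (1::complex)) = 1"
  by (intro subdegreeI) (auto simp: fps_ln_nth)

lemma fps_ln_compose_exp: "fps_compose (fps_ln (1::complex)) (fps_exp 1 - 1) = fps_X"
  by (subst fps_ln_fps_exp_inv) (simp_all add: fps_inv)

lemma fps_exp_powi: "fps_to_fls (fps_exp (1::complex)) powi k = fps_to_fls (fps_exp (of_int k))"
proof (cases "k \<ge> 0")
  case True
  then obtain j where "k = int j" by (metis nat_0_le)
  then show ?thesis by (simp add: fps_exp_power_mult flip: fps_to_fls_power)
next
  case False
  define j where "j = nat (-k)"
  have k: "k = - int j" using False by (simp add: j_def)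
  have "fps_to_fls (fps_exp (- of_nat j)) * fps_to_fls (fps_exp (of_nat j :: complex)) = 1"
    by (simp flip: fls_times_fps_to_fls fps_exp_add_mult)
  then have "inverse (fps_to_fls (fps_exp (of_nat j :: complex))) = fps_to_fls (fps_exp (- of_nat j))"
    by (metis inverse_unique mult.commute)
  then show ?thesis by (simp add: k power_int_minus fps_exp_power_mult flip: fps_to_fls_power)
qed

text \<open>Substituting w = e^z - 1 gives 1 + w = e^z and ln(1 + w) = z, while dw = e^z dz supplies
  one factor e^z; hence the exponent k - 1 in \<open>sq_series\<close>.\<close>

lemma sq_coeff_eq: "sq_coeff k m n = fls_nth (sq_series k n) m"
proof -
  define H where "H = fps_exp (1::complex) - 1"
  have H: "fps_nth H 0 = 0" "fps_nth H 1 \<noteq> 0" "H \<noteq> 0"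
    by (auto simp: H_def dest: arg_cong[of _ _ "\<lambda>f. fps_nth f 1"])
  have 1: "fls_compose_fps X_plus_1 H = fps_to_fls (fps_exp 1)"
    using H by (simp add: fls_compose_fps_add X_plus_1_def) (simp add: H_def)
  have 2: "fls_compose_fps ln_fls H = fls_X"
    using H by (simp add: fps_ln_compose_exp H_def ln_fls_def)
  have "fls_residue (fls_X powi (-m-1) * sq_series k n)
      = fls_residue (fls_compose_fps (fls_X powi (-m-1) * sq_series k n) H * fps_to_fls (fps_deriv H))"
    by (rule fls_residue_compose_fps[OF H(1,2), symmetric])
  also have "fls_compose_fps (fls_X powi (-m-1) * sq_series k n) H * fps_to_fls (fps_deriv H)
     = fps_to_fls H powi (-m-1) * (fps_to_fls (fps_exp 1) powi (k - 1) * fls_X powi n) * fps_to_fls (fps_exp 1)"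
    using H by (simp del: fls_X_power_int add: sq_series_def fls_compose_fps_mult fls_compose_fps_powi 1 2 ) (simp add: H_def)
  also have "\<dots> = (fps_to_fls (fps_exp (of_int k)) * fps_to_fls H powi (-m-1)) * fls_X powi n"
    by (simp add: power_int_diff mult_ac flip: fps_exp_powi)
  also have "fls_residue \<dots> = fls_nth (fps_to_fls (fps_exp (of_int k)) * fps_to_fls H powi (-m-1)) (-n-1)"
    unfolding fls_residue_def fls_nth_times_X_powi by (rule arg_cong[of _ _ "fls_nth _"]) simp
  finally have *: "fls_residue (fls_X powi (-m-1) * sq_series k n) = sq_coeff k m n"
    by (simp add: sq_coeff_def H_def)
  have "fls_residue (fls_X powi (-m-1) * sq_series k n) = fls_residue (sq_series k n * fls_X powi (-m-1))"
    by (simp add: mult.commute)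
  also have "\<dots> = fls_nth (sq_series k n) m"
    unfolding fls_residue_def fls_nth_times_X_powi by (rule arg_cong[of _ _ "fls_nth _"]) simp
  finally show ?thesis using * by simp
qed

lemma sq_series_nth_0: "m < n \<Longrightarrow> fls_nth (sq_series k n) m = 0"
proof -
  have "fls_subdegree (sq_series k n) = n"
  proof -
    have *: "fls_subdegree X_plus_1 = 0" by (intro fls_subdegree_eqI) (auto simp: X_plus_1_def)
    have 2: "fls_subdegree ln_fls = 1" by (simp add: ln_fls_def fls_subdegree_fls_to_fps subdegree_fps_ln)
    have "fls_subdegree (X_plus_1 powi j) = 0" for j
      by (simp add: power_int_def fls_subdegree_pow * )
    moreover have "fls_subdegree (ln_fls powi j) = j" for j
      by (simp add: power_int_def fls_subdegree_pow 2)
    ultimately show ?thesis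
      unfolding sq_series_def by (subst fls_subdegree_mult) (auto simp: * 2)
  qed
  then show "m < n \<Longrightarrow> ?thesis" by simp
qed

lemma sq_series_mult: "sq_series 1 m * sq_series k n = sq_series k (m + n)"
  by (simp add: sq_series_def power_int_add)

lemma sq_series_1: "sq_series 1 n = ln_fls powi n"
  by (simp add: sq_series_def)

text \<open>The leading coefficient 1 makes the passage from the modes a(n) to a[n] unitriangular,
  so that it can be inverted in \<open>sq_cyclic\<close>.\<close>

lemma sq_series_nth_eq: "fls_nth (sq_series 1 n) n = 1"
proof -
  define u :: "complex fps" where "u = Abs_fps (\<lambda>n. (-1) ^ n / of_nat (Suc n))"
  have "fps_ln (1::complex) = u * fps_X"
    by (rule fps_ext) (simp add: u_def fps_mult_fps_X_commute[symmetric] fps_X_mult_nth fps_ln_nth)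
  then have "ln_fls powi n = fps_to_fls u powi n * fls_X powi n"
    by (simp add: ln_fls_def fls_times_fps_to_fls power_int_mult_distrib del: fls_X_power_int)
  then have "fls_nth (sq_series 1 n) n = fls_nth (fps_to_fls u powi n) 0"
    unfolding sq_series_1 by (simp only: fls_nth_times_X_powi) simp
  also have "\<dots> = 1"
  proof (cases "n \<ge> 0")
    case True
    then show ?thesis by (simp add: power_int_def fps_nth_power_0 u_def flip: fps_to_fls_power)
  next
    case False
    have "fps_nth u 0 \<noteq> 0" by (simp add: u_def)
    then have "inverse (fps_to_fls u) = fps_to_fls (inverse u)" by (simp add: fls_inverse_fps_to_fls)
    then show ?thesis using False by (simp add: power_int_def fps_nth_power_0 u_def flip: fps_to_fls_power)
  qed
  finally show ?thesis .
qed

section \<open>Powers of the logarithm under (1 + w) d/dw\<close>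

lemma deriv_ln_fls: "X_plus_1 * fls_deriv ln_fls = 1"
proof -
  have "(1 + fps_X) * fps_deriv (fps_ln (1::complex)) = 1"
    by (simp add: fps_ln_deriv inverse_mult_eq_1')
  then have "fps_to_fls ((1 + fps_X) * fps_deriv (fps_ln (1::complex))) = 1" by simp
  then show ?thesis by (simp add: fls_times_fps_to_fls fls_deriv_fps_to_fls X_plus_1_def ln_fls_def)
qed

text \<open>In the coordinate z = ln(1 + w) the operator (1 + w) d/dw is d/dz.\<close>

lemma euler_ln_fls_powi: "X_plus_1 * fls_deriv (ln_fls powi n) = of_int n * ln_fls powi (n - 1)"
  using deriv_ln_fls by (simp add: fls_deriv_powi mult.left_commute)

lemma fls_nth_euler: "fls_nth (X_plus_1 * fls_deriv f) i = of_int (i + 1) * fls_nth f (i + 1) + of_int i * fls_nth f i"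
  by (simp add: X_plus_1_def distrib_right fls_X_times_conv_shift)

text \<open>Up to the factor j!/i! these are the signed Stirling numbers of the first kind. They
  express a[j], for j >= 0, through the modes a(i).\<close>

definition ln_pow :: "nat \<Rightarrow> nat \<Rightarrow> complex" where
  "ln_pow i j = fps_nth (fps_ln 1 ^ j) i"

lemma ln_pow_eq: "fls_nth (ln_fls powi int j) (int i) = ln_pow i j"
  by (simp add: ln_pow_def ln_fls_def flip: fps_to_fls_power)

lemma ln_pow_0: "i < j \<Longrightarrow> ln_pow i j = 0"
  unfolding ln_pow_def by (rule fps_pow_nth_below_subdegree) (simp add: subdegree_fps_ln)

lemma ln_pow_0_right: "ln_pow i 0 = (if i = 0 then 1 else 0)"
  by (simp add: ln_pow_def)

text \<open>Coefficient of w^i in (1 + w) d/dw ln(1 + w)^j = j ln(1 + w)^(j-1).\<close>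

lemma ln_pow_rec: "of_nat (Suc i) * ln_pow (Suc i) j + of_nat i * ln_pow i j = of_nat j * ln_pow i (j - 1)"
proof (cases j)
  case 0
  then show ?thesis by (simp add: ln_pow_0_right)
next
  case (Suc j')
  have j: "int j - 1 = int j'" "int i + 1 = int (Suc i)" using Suc by auto
  have "fls_nth (X_plus_1 * fls_deriv (ln_fls powi int j)) (int i) = fls_nth (of_int (int j) * ln_fls powi (int j - 1)) (int i)"
    by (simp only: euler_ln_fls_powi)
  then have "of_int (int i + 1) * fls_nth (ln_fls powi int j) (int (Suc i)) + of_int (int i) * fls_nth (ln_fls powi int j) (int i)
     = of_nat j * fls_nth (ln_fls powi int j') (int i)"
    unfolding fls_nth_euler j by (simp add: fls_of_nat del: of_nat_Suc power_int_of_nat)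
  then show ?thesis by (simp only: ln_pow_eq j of_int_of_nat_eq) (simp add: Suc)
qed

text \<open>Coefficient of w^i in exp(a ln(1 + w)) = (1 + w)^a. The recursion for
  \<open>ln_pow\<close> becomes (a - i)(a gchoose i) = (i + 1)(a gchoose (i + 1)).\<close>

lemma sum_ln_pow_gchoose: "(\<Sum>j\<le>i. a ^ j / fact j * ln_pow i j) = a gchoose i"
proof (induction i)
  case 0
  then show ?case by (simp add: ln_pow_0_right)
next
  case (Suc i)
  have "of_nat (Suc i) * (\<Sum>j\<le>Suc i. a ^ j / fact j * ln_pow (Suc i) j)
      = (\<Sum>j\<le>Suc i. a ^ j / fact j * (of_nat j * ln_pow i (j - 1) - of_nat i * ln_pow i j))"
  proof -
    have "of_nat (Suc i) * ln_pow (Suc i) j = of_nat j * ln_pow i (j - 1) - of_nat i * ln_pow i j" for j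
      using ln_pow_rec[of i j] by (simp add: algebra_simps)
    then show ?thesis unfolding sum_distrib_left mult.left_commute[of "of_nat (Suc i)"] by simp
  qed
  also have "\<dots> = (\<Sum>j\<le>Suc i. a ^ j / fact j * (of_nat j * ln_pow i (j - 1))) - of_nat i * (\<Sum>j\<le>Suc i. a ^ j / fact j * ln_pow i j)"
    unfolding sum_distrib_left sum_subtractf[symmetric] by (intro sum.cong) (auto simp: algebra_simps)
  also have "(\<Sum>j\<le>Suc i. a ^ j / fact j * (of_nat j * ln_pow i (j - 1))) = (\<Sum>j\<le>i. a * (a ^ j / fact j * ln_pow i j))"
    by (subst sum.atMost_Suc_shift) (simp add: divide_simps del: sum.atMost_Suc of_nat_Suc)
  also have "(\<Sum>j\<le>Suc i. a ^ j / fact j * ln_pow i j) = (\<Sum>j\<le>i. a ^ j / fact j * ln_pow i j)"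
    by (simp add: ln_pow_0)
  also have "(\<Sum>j\<le>i. a * (a ^ j / fact j * ln_pow i j)) - of_nat i * (\<Sum>j\<le>i. a ^ j / fact j * ln_pow i j)
     = (a - of_nat i) * (a gchoose i)"
    unfolding sum_distrib_left[symmetric] Suc by (simp add: left_diff_distrib)
  also have "\<dots> = of_nat (Suc i) * (a gchoose Suc i)"
    by (metis gbinomial_absorb_comp gbinomial_absorption)
  finally have "of_nat (Suc i) * (\<Sum>j\<le>Suc i. a ^ j / fact j * ln_pow (Suc i) j) = of_nat (Suc i) * (a gchoose Suc i)" .
  then show ?case by (simp del: of_nat_Suc)
qed

definition div_deriv :: "nat \<Rightarrow> complex fls \<Rightarrow> complex fls" where
  "div_deriv i f = fls_const (1 / fact i) * (fls_deriv ^^ i) f"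

lemma fls_nth_deriv_iter:
  "fls_nth ((fls_deriv ^^ i) f) n = pochhammer (of_int n + 1) i * fls_nth f (n + int i)" for f :: "complex fls"
proof (induction i arbitrary: n)
  case (Suc i)
  then show ?case by (simp add: pochhammer_rec algebra_simps)
qed auto

text \<open>These binomials are the ones in the commutator formula, which is why divided derivatives
  enter.\<close>

lemma fls_nth_div_deriv:
  "fls_nth (div_deriv i f) n = (of_int (n + int i) gchoose i) * fls_nth f (n + int i)"
  by (simp add: div_deriv_def fls_nth_deriv_iter gbinomial_pochhammer')

lemma div_deriv_0 [simp]: "div_deriv 0 f = f"
  by (simp add: div_deriv_def)

lemma div_deriv_Suc: "of_nat (Suc i) * div_deriv (Suc i) f = fls_deriv (div_deriv i f)"
proof -
  have "fls_deriv (fls_const c * g) = fls_const c * fls_deriv g" for c and g :: "complex fls"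
    by (simp add: fls_deriv_mult)
  moreover have "of_nat (Suc i) * fls_const (1 / fact (Suc i)) = (fls_const (1 / fact i) :: complex fls)"
    by (simp add: fls_of_nat fls_const_mult_const del: of_nat_Suc)
  ultimately show ?thesis unfolding div_deriv_def mult.assoc[symmetric] by simp
qed

text \<open>With D = d/dz one has (1 + w)^i (d/dw)^i / i! = (D gchoose i), which by
  \<open>sum_ln_pow_gchoose\<close> is the sum of \<open>ln_pow i j\<close> D^j / j!. Applied to
  z^m, each D^j / j! gives (m gchoose j) z^(m-j).\<close>

lemma div_deriv_ln_fls_powi:
  "X_plus_1 ^ i * div_deriv i (ln_fls powi m)
     = (\<Sum>j\<le>i. fls_const ((of_int m gchoose j) * ln_pow i j) * ln_fls powi (m - int j))"
proof (induction i)
  case 0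
  then show ?case by (simp add: ln_pow_0_right)
next
  case (Suc i)
  define g where "g i = X_plus_1 ^ i * div_deriv i (ln_fls powi m)" for i
  define G where "G i = (\<Sum>j\<le>i. fls_const ((of_int m gchoose j) * ln_pow i j) * ln_fls powi (m - int j))" for i
  \<comment> \<open>This is (D gchoose (i + 1)) = (D - i)(D gchoose i) / (i + 1); the sum G on the
    right-hand side obeys the same recursion.\<close>
  have "X_plus_1 * fls_deriv (g i) = of_nat i * g i + of_nat (Suc i) * g (Suc i)"
  proof (cases i)
    case 0
    then show ?thesis using div_deriv_Suc[of 0 "ln_fls powi m"] by (simp add: g_def)
  next
    case (Suc i')
    moreover have "fls_deriv X_plus_1 = 1" by (simp add: X_plus_1_def)
    ultimately show ?thesis unfolding g_def fls_deriv_mult fls_deriv_power div_deriv_Suc[symmetric]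
      by (simp add: algebra_simps)
  qed
  moreover have "X_plus_1 * fls_deriv (G i) = of_nat i * G i + of_nat (Suc i) * G (Suc i)"
  proof -
    have "X_plus_1 * fls_deriv (G i) = (\<Sum>j\<le>i. fls_const ((of_int m gchoose j) * ln_pow i j) * (of_int (m - int j) * ln_fls powi (m - int j - 1)))"
      unfolding G_def fls_deriv_sum sum_distrib_left
      by (intro sum.cong refl) (simp add: euler_ln_fls_powi mult.left_commute[of X_plus_1])
    also have "\<dots> = (\<Sum>j\<le>i. fls_const ((of_int m gchoose Suc j) * (of_nat (Suc j) * ln_pow i j)) * ln_fls powi (m - int (Suc j)))"
    proof (intro sum.cong refl)
      fix j
      have "(of_int m gchoose j) * of_int (m - int j) = (of_int m gchoose Suc j) * (of_nat (Suc j) :: complex)"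
        by (metis gbinomial_absorb_comp gbinomial_absorption mult.commute of_int_diff of_int_of_nat_eq)
      then have "(of_int m gchoose j) * ln_pow i j * of_int (m - int j) = (of_int m gchoose Suc j) * (of_nat (Suc j) * ln_pow i j)"
        by (metis mult.assoc mult.commute)
      then show "fls_const ((of_int m gchoose j) * ln_pow i j) * (of_int (m - int j) * ln_fls powi (m - int j - 1))
        = fls_const ((of_int m gchoose Suc j) * (of_nat (Suc j) * ln_pow i j)) * ln_fls powi (m - int (Suc j))"
        by (simp only: fls_of_int fls_const_mult_const mult.assoc[symmetric]) (simp add: algebra_simps)
    qed
    also have "\<dots> = (\<Sum>j\<le>Suc i. fls_const ((of_int m gchoose j) * (of_nat j * ln_pow i (j - 1))) * ln_fls powi (m - int j))"
      by (subst sum.atMost_Suc_shift) simp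
    also have "\<dots> = (\<Sum>j\<le>Suc i. of_nat i * (fls_const ((of_int m gchoose j) * ln_pow i j) * ln_fls powi (m - int j)) +
        of_nat (Suc i) * (fls_const ((of_int m gchoose j) * ln_pow (Suc i) j) * ln_fls powi (m - int j)))"
      by (intro sum.cong refl, unfold ln_pow_rec[symmetric] mult.assoc[symmetric] fls_of_nat fls_const_mult_const
           distrib_right[symmetric] fls_plus_const) (simp add: algebra_simps)
    also have "\<dots> = of_nat i * G i + of_nat (Suc i) * G (Suc i)"
      unfolding sum.distrib sum_distrib_left[symmetric] by (simp add: G_def ln_pow_0)
    finally show ?thesis .
  qed
  ultimately have "of_nat (Suc i) * g (Suc i) = of_nat (Suc i) * G (Suc i)"
    using Suc unfolding g_def[symmetric] G_def[symmetric] by (simp del: of_nat_Suc mult_cancel_left)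
  moreover have "of_nat (Suc i) \<noteq> (0 :: complex fls)"
    unfolding fls_of_nat by (simp del: of_nat_Suc)
  ultimately show ?case unfolding g_def[symmetric] G_def[symmetric] by (simp del: of_nat_Suc)
qed

text \<open>The factor (1 + w)^i lowers the weight label from k to k - i, which is the weight of
  u(i)v for u of weight one.\<close>

lemma div_deriv_sq_series_mult:
  "div_deriv i (sq_series 1 m) * sq_series k n
     = (\<Sum>j\<le>i. fls_const ((of_int m gchoose j) * ln_pow i j) * sq_series (k - int i) (m + n - int j))"
proof -
  have "sq_series k n = X_plus_1 ^ i * sq_series (k - int i) n"
    unfolding sq_series_def using X_plus_1_ne_0
    by (simp add: power_int_diff power_int_add field_simps)
  then have "div_deriv i (sq_series 1 m) * sq_series k n
     = (X_plus_1 ^ i * div_deriv i (ln_fls powi m)) * sq_series (k - int i) n"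
    by (simp add: sq_series_1 mult_ac)
  also have "\<dots> = (\<Sum>j\<le>i. fls_const ((of_int m gchoose j) * ln_pow i j) * (sq_series 1 (m - int j) * sq_series (k - int i) n))"
    unfolding div_deriv_ln_fls_powi sum_distrib_right sq_series_1 by (simp add: mult_ac)
  finally show ?thesis by (simp add: sq_series_mult algebra_simps)
qed

lemma X_plus_1_powi_nth: "fls_nth (X_plus_1 powi n) (int i) = of_int n gchoose i"
  by (simp add: X_plus_1_def one_plus_fls_X_powi_eq)

text \<open>The left side is the residue of (1 + w)^(n-1) ln(1 + w)^(-k), that is, of e^(nz) z^(-k)
  in the coordinate z.\<close>

lemma sq_series_residue:
  assumes "k > 0"
  shows "(\<Sum>h<k. (of_int (n - 1) gchoose h) * fls_nth (ln_fls powi (- int k)) (- 1 - int h))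
    = of_int n ^ (k - 1) / fact (k - 1)"
proof -
  have 1: "fls_subdegree (ln_fls powi j) = j" for j
    by (simp add: power_int_def fls_subdegree_pow ln_fls_def fls_subdegree_fls_to_fps subdegree_fps_ln)
  have 2: "fls_subdegree (X_plus_1 powi j) = 0" for j
  proof -
    have "fls_subdegree X_plus_1 = 0" by (intro fls_subdegree_eqI) (auto simp: X_plus_1_def)
    then show ?thesis by (simp add: power_int_def fls_subdegree_pow)
  qed
  \<comment> \<open>At mode index -1 the power of e^z - 1 in \<open>sq_coeff\<close> is trivial, and
    one coefficient of e^(nz) remains.\<close>
  have "fls_nth (sq_series n (- int k)) (-1) = sq_coeff n (-1) (- int k)" by (simp add: sq_coeff_eq)
  also have "\<dots> = of_int n ^ (k - 1) / fact (k - 1)"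
    using assms by (simp add: sq_coeff_def nat_diff_distrib)
  finally have *: "fls_nth (sq_series n (- int k)) (-1) = of_int n ^ (k - 1) / fact (k - 1)" .
  have "fls_nth (sq_series n (- int k)) (-1) =
     (\<Sum>i=0..int k - 1. fls_nth (X_plus_1 powi (n - 1)) i * fls_nth (ln_fls powi (- int k)) (- 1 - i))"
    unfolding sq_series_def by (subst fls_times_nth(2)) (simp only: 1 2, simp)
  also have "{0..int k - 1} = int ` {..<k}"
    unfolding lessThan_atLeast0 image_int_atLeastLessThan by auto
  also have "(\<Sum>i\<in>int ` {..<k}. fls_nth (X_plus_1 powi (n - 1)) i * fls_nth (ln_fls powi (- int k)) (- 1 - i)) =
     (\<Sum>h<k. (of_int (n - 1) gchoose h) * fls_nth (ln_fls powi (- int k)) (- 1 - int h))"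
    by (subst sum.reindex) (simp_all add: X_plus_1_powi_nth)
  finally show ?thesis using * by simp
qed

section \<open>Bernoulli numbers and negative powers of the logarithm\<close>

text \<open>Taylor coefficient of \<open>z\<^sup>j\<close> in the regular part of \<open>-(-d/dz)\<^bsup>k-1\<^esup> (e\<^sup>z - 1)\<^sup>-\<^sup>1 / (k - 1)!\<close>, with \<open>z = ln(1 + w)\<close>; it becomes the constant term of \<open>C(k,j,\<tau>)/j\<close>.\<close>

definition bern_coeff :: "nat \<Rightarrow> nat \<Rightarrow> complex" where
  "bern_coeff k j = (-1) ^ k * (fact (k + j - 1) / (fact (k - 1) * fact j)) * (bernoulli_number (k + j) / fact (k + j))"

text \<open>If R_k is the series in z with coefficients \<open>bern_coeff k j\<close>, this is
  dR_k/dz = - k R_(k+1), the same rule as for z^(-k).\<close>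

lemma bern_coeff_Suc:
  "k > 0 \<Longrightarrow> - of_nat k * bern_coeff (Suc k) j = of_nat (Suc j) * bern_coeff k (Suc j)"
proof -
  assume k: "k > 0"
  then have "fact k = (of_nat k * fact (k - 1) :: complex)" by (simp add: fact_reduce)
  then show ?thesis using k by (simp add: bern_coeff_def divide_simps del: of_nat_Suc)
qed

lemma bern_series:
  "fps_X / (fps_exp 1 - 1 :: complex fps) * (fps_exp 1 - 1) = fps_X"
  "fps_nth (fps_X / (fps_exp 1 - 1 :: complex fps)) 0 = 1"
proof -
  have nz: "fps_nth (fps_exp 1 - 1 :: complex fps) 1 \<noteq> 0" by simp
  then have sd: "subdegree (fps_exp 1 - 1 :: complex fps) = 1" by (intro subdegreeI) auto
  have nz': "fps_exp 1 - 1 \<noteq> (0 :: complex fps)" using nz by (metis fps_zero_nth)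
  show 1: "fps_X / (fps_exp 1 - 1 :: complex fps) * (fps_exp 1 - 1) = fps_X"
    by (rule fps_times_divide_eq) (simp_all only: sd nz' subdegree_fps_X order.refl not_False_eq_True)
  then have "fps_nth (fps_X / (fps_exp 1 - 1 :: complex fps) * (fps_exp 1 - 1)) 1 = 1" by simp
  then show "fps_nth (fps_X / (fps_exp 1 - 1 :: complex fps)) 0 = 1"
    by (subst (asm) fps_mult_nth_1) simp
qed

text \<open>b(z) = z/(e^z - 1) satisfies b(-z) = b(z) + z, so b(-z) and b(z) agree in every degree
  but the first.\<close>

lemma bernoulli_odd:
  assumes "odd k" "k \<noteq> 1"
  shows "bernoulli_number k = 0"
proof -
  define b where "b = fps_X / (fps_exp 1 - 1 :: complex fps)"
  define E where "E = (fps_exp 1 :: complex fps)"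
  have b: "b * (E - 1) = fps_X" unfolding b_def E_def by (rule bern_series)
  define b' where "b' = fps_compose b (fps_const (-1) * fps_X)"
  have E': "fps_compose E (fps_const (-1) * fps_X) = fps_exp (-1)"
    by (rule fps_ext) (simp only: fps_nth_compose_linear, simp add: E_def)
  have "fps_compose (b * (E - 1)) (fps_const (-1) * fps_X) = - fps_X"
    unfolding b by (simp add: fps_X_fps_compose_startby0)
  then have "b' * (fps_exp (-1) - 1) = - fps_X"
    by (simp add: fps_compose_mult_distrib fps_compose_sub_distrib b'_def E')
  then have "b' * (fps_exp (-1) - 1) * E = - fps_X * E" by simp
  moreover have "fps_exp (-1) * E = (1 :: complex fps)" unfolding E_def by (simp flip: fps_exp_add_mult)
  then have "b' * (fps_exp (-1) - 1) * E = b' * (1 - E)"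
    by (metis left_diff_distrib mult.assoc mult.left_neutral)
  ultimately have "b' * (1 - E) = - fps_X * E" by simp
  then have "b' * (E - 1) = (b + fps_X) * (E - 1)" using b by (simp add: algebra_simps)
  moreover have "E - 1 \<noteq> 0"
  proof
    assume "E - 1 = 0"
    then have "fps_nth (E - 1) 1 = 0" by simp
    then show False by (simp add: E_def)
  qed
  ultimately have "b' = b + fps_X" by simp
  then have "fps_nth b' k = fps_nth b k" using assms by simp
  moreover have "fps_nth b' k = (-1) ^ k * fps_nth b k"
    unfolding b'_def by (simp only: fps_nth_compose_linear)
  ultimately show ?thesis using assms by (simp add: bernoulli_number_def b_def)
qed

text \<open>1/z = 1/w + R_1(z), where R_k is the series in z with coefficients
  \<open>bern_coeff k j\<close>. Repeated d/dz = (1 + w) d/dw keeps negative powers of w polar, so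
  the part of z^(-k) regular in w is R_k(z).\<close>

lemma ln_fls_neg_powi_nth:
  assumes "k > 0"
  shows "fls_nth (ln_fls powi (- int k)) (int i) = (\<Sum>j\<le>i. bern_coeff k j * ln_pow i j)"
  using assms
proof (induction k arbitrary: i)
  case (Suc k)
  show ?case
  proof (cases "k = 0")
    case True
    define b where "b = fps_X / (fps_exp 1 - 1 :: complex fps)"
    have "fps_compose (b * (fps_exp 1 - 1)) (fps_ln 1) = fps_ln 1"
      unfolding b_def bern_series(1) by (simp add: fps_X_fps_compose_startby0)
    moreover have "fps_compose (fps_exp 1 - 1) (fps_ln (1::complex)) = fps_X"
      by (subst fps_ln_fps_exp_inv) (simp_all add: fps_inv_right)
    ultimately have 1: "fps_compose b (fps_ln 1) * fps_X = fps_ln 1"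
      by (simp add: fps_compose_mult_distrib)
    define b' where "b' = fps_shift 1 b"
    have b: "b = 1 + fps_X * b'"
      by (rule fps_ext) (auto simp: b'_def fps_X_mult_nth b_def bern_series(2))
    have 2: "fps_compose b (fps_ln 1) = 1 + fps_ln 1 * fps_compose b' (fps_ln 1)"
      unfolding b by (simp add: fps_compose_add_distrib fps_compose_mult_distrib fps_X_fps_compose_startby0)
    have "fps_to_fls ((1 + fps_ln 1 * fps_compose b' (fps_ln 1)) * fps_X) = ln_fls"
      using 1 unfolding 2 ln_fls_def by simp
    then have "(1 + ln_fls * fps_to_fls (fps_compose b' (fps_ln 1))) * fls_X = ln_fls"
      by (simp add: fls_times_fps_to_fls ln_fls_def)
    then have "inverse ln_fls = inverse fls_X - fps_to_fls (fps_compose b' (fps_ln 1))"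
    proof -
      define C where "C = fps_to_fls (fps_compose b' (fps_ln 1))"
      assume "(1 + ln_fls * fps_to_fls (fps_compose b' (fps_ln 1))) * fls_X = ln_fls"
      then have 3: "(1 + ln_fls * C) * fls_X = ln_fls" by (simp add: C_def)
      have "inverse fls_X = inverse fls_X * (inverse ln_fls * ln_fls)" by simp
      also have "\<dots> = (inverse fls_X * fls_X) * (inverse ln_fls * (1 + ln_fls * C))"
        by (subst 3[symmetric]) (simp only: mult_ac)
      also have "\<dots> = inverse ln_fls * (1 + ln_fls * C)" by (subst left_inverse) auto
      also have "\<dots> = inverse ln_fls + (inverse ln_fls * ln_fls) * C" by (simp add: distrib_left del: fls_inverse_X)
      finally have "inverse fls_X = inverse ln_fls + fps_to_fls (fps_compose b' (fps_ln 1))"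
        by (simp add: C_def)
      then show ?thesis by (simp add: algebra_simps del: fls_inverse_X)
    qed
    moreover have "ln_fls powi (- int (Suc k)) = inverse ln_fls"
      using True by (simp add: power_int_minus)
    ultimately have "fls_nth (ln_fls powi (- int (Suc k))) (int i) = - fps_nth (fps_compose b' (fps_ln 1)) i"
      by (simp add: fls_inverse_X)
    also have "\<dots> = (\<Sum>j\<le>i. bern_coeff (Suc k) j * ln_pow i j)"
      unfolding fps_compose_nth sum_negf[symmetric] using True
      by (intro sum.cong) (auto simp: bern_coeff_def b'_def b_def bernoulli_number_def ln_pow_def simp del: of_nat_Suc)
    finally show ?thesis .
  next
    case False
    have *: "fls_nth (X_plus_1 * fls_deriv (ln_fls powi (- int k))) (int i) = fls_nth (of_int (- int k) * ln_fls powi (- int k - 1)) (int i)"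
      by (simp only: euler_ln_fls_powi)
    have *: "of_nat (Suc i) * fls_nth (ln_fls powi (- int k)) (int (Suc i)) + of_nat i * fls_nth (ln_fls powi (- int k)) (int i)
       = - of_nat k * fls_nth (ln_fls powi (- int (Suc k))) (int i)"
    proof -
      have e: "- int k - 1 = - int (Suc k)" "int i + 1 = int (Suc i)" by auto
      show ?thesis using * unfolding fls_nth_euler e of_int_minus of_int_of_nat_eq fls_of_nat by simp
    qed
    have "- of_nat k * fls_nth (ln_fls powi (- int (Suc k))) (int i)
      = of_nat (Suc i) * (\<Sum>j\<le>Suc i. bern_coeff k j * ln_pow (Suc i) j) + of_nat i * (\<Sum>j\<le>Suc i. bern_coeff k j * ln_pow i j)"
      unfolding *[symmetric] Suc.IH[OF False[unfolded neq0_conv]] by (simp add: ln_pow_0)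
    also have "\<dots> = (\<Sum>j\<le>Suc i. bern_coeff k j * (of_nat j * ln_pow i (j - 1)))"
      unfolding ln_pow_rec[symmetric] sum_distrib_left sum.distrib[symmetric]
      by (intro sum.cong) (auto simp: algebra_simps)
    also have "\<dots> = (\<Sum>j\<le>i. bern_coeff k (Suc j) * (of_nat (Suc j) * ln_pow i j))"
      by (subst sum.atMost_Suc_shift) simp
    also have "\<dots> = - of_nat k * (\<Sum>j\<le>i. bern_coeff (Suc k) j * ln_pow i j)"
      unfolding sum_distrib_left mult.assoc[symmetric]
      using False bern_coeff_Suc[of k] by (intro sum.cong) (auto simp: mult_ac)
    finally show ?thesis using False by simp
  qed
qed simp

section \<open>Gradings and traces\<close>

lemmas lin_add = module_hom.add[OF linear_iff_module_hom[THEN iffD1]]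
lemmas lin_scale = module_hom.scale[OF linear_iff_module_hom[THEN iffD1]]
lemmas lin_zero = module_hom.zero[OF linear_iff_module_hom[THEN iffD1]]
lemmas lin_diff = module_hom.diff[OF linear_iff_module_hom[THEN iffD1]]
lemmas lin_sum = module_hom.sum[OF linear_iff_module_hom[THEN iffD1]]

lemma (in vector_space) linI:
  assumes "\<And>x y. f (x + y) = f x + f y" "\<And>c x. f (scale c x) = scale c (f x)"
  shows "Vector_Spaces.linear scale scale f"
  using assms by (simp add: linear_iff_module_hom module_hom_iff module_axioms)

lemma (in vector_space) lin_formI:
  assumes "\<And>x y. f (x + y) = f x + f y" "\<And>c x. f (scale c x) = c * f x"
  shows "Vector_Spaces.linear scale (*) f"
proof -
  have "module ((*) :: 'a \<Rightarrow> 'a \<Rightarrow> 'a)" by unfold_locales (auto simp: algebra_simps)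
  then show ?thesis using assms by (simp add: linear_iff_module_hom module_hom_iff module_axioms)
qed

text \<open>Kept apart from \<open>voa\<close> because it serves both L(0) and the square bracket
  operator L[0].\<close>

locale graded_op = vector_space scale
  for scale :: "complex \<Rightarrow> 'v::ab_group_add \<Rightarrow> 'v" +
  fixes D :: "'v \<Rightarrow> 'v"
  assumes D_linear: "Vector_Spaces.linear scale scale D"
    and D_span: "span (\<Union>n. {v. D v = scale (of_int n) v}) = UNIV"
begin

definition eig :: "int \<Rightarrow> 'v set" where "eig n = {v. D v = scale (of_int n) v}"

lemma subspace_eig: "subspace (eig n)"
  unfolding eig_def
  by (rule subspaceI) (auto simp: lin_add[OF D_linear] lin_zero[OF D_linear] lin_scale[OF D_linear]
      scale_right_distrib scale_left_commute)

text \<open>Applying D - m to the vanishing sum removes the component of index m and rescales the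
  others by the non-zero factors k - m.\<close>

lemma eig_independent:
  assumes "finite I" "\<And>n. n \<in> I \<Longrightarrow> x n \<in> eig n" "sum x I = 0" "n \<in> I"
  shows "x n = 0"
  using assms
proof (induction I arbitrary: x n rule: finite_induct)
  case (insert m I)
  have *: "x k = 0" if "k \<in> I" for k
  proof -
    define y where "y k = scale (of_int k - of_int m) (x k)" for k
    have "y j \<in> eig j" if "j \<in> I" for j
      unfolding y_def by (rule subspace_scale[OF subspace_eig]) (use insert.prems that in auto)
    moreover have "sum y I = 0"
    proof -
      have "D (sum x (insert m I)) = (\<Sum>j\<in>insert m I. scale (of_int j) (x j))"
        unfolding lin_sum[OF D_linear] by (rule sum.cong) (use insert.prems in \<open>auto simp: eig_def\<close>)
      then have "(\<Sum>j\<in>insert m I. scale (of_int j) (x j)) - scale (of_int m) (sum x (insert m I)) = 0"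
        by (simp add: insert.prems lin_zero[OF D_linear])
      then have "(\<Sum>j\<in>insert m I. y j) = 0"
        unfolding scale_sum_right sum_subtractf[symmetric] y_def by (simp add: scale_left_diff_distrib)
      then show ?thesis using insert.hyps by (simp add: y_def)
    qed
    ultimately have "y k = 0" using insert.IH[of y k] that by auto
    moreover have "k \<noteq> m" using that insert.hyps by auto
    ultimately show ?thesis by (simp add: y_def)
  qed
  then have "sum x I = 0" by simp
  then have "x m = 0" using insert.prems(2) insert.hyps by simp
  then show ?case using * insert.prems by auto
qed auto

definition decomp :: "'v \<Rightarrow> (int \<Rightarrow> 'v) \<Rightarrow> bool" where
  "decomp v f \<longleftrightarrow> finite {n. f n \<noteq> 0} \<and> (\<forall>n. f n \<in> eig n) \<and> Sum_any f = v"

lemma decomp_add: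
  assumes "decomp v f" "decomp w g"
  shows "decomp (v + w) (\<lambda>n. f n + g n)"
proof -
  have "finite {n. f n + g n \<noteq> 0}"
    by (rule finite_subset[of _ "{n. f n \<noteq> 0} \<union> {n. g n \<noteq> 0}"]) (use assms in \<open>auto simp: decomp_def\<close>)
  then show ?thesis using assms subspace_eig unfolding decomp_def
    by (auto simp: Sum_any.distrib subspace_add)
qed

lemma decomp_scale:
  assumes "decomp v f"
  shows "decomp (scale c v) (\<lambda>n. scale c (f n))"
proof -
  have f: "finite {n. f n \<noteq> 0}" using assms by (simp add: decomp_def)
  have "finite {n. scale c (f n) \<noteq> 0}"
    by (rule finite_subset[OF _ f]) auto
  moreover have "Sum_any (\<lambda>n. scale c (f n)) = scale c (Sum_any f)"
    by (subst (1 2) Sum_any.expand_superset[OF f]) (auto simp: scale_sum_right)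
  ultimately show ?thesis using assms subspace_eig unfolding decomp_def
    by (auto simp: subspace_scale)
qed

lemma decomp_single: "v \<in> eig k \<Longrightarrow> decomp v (\<lambda>n. if n = k then v else 0)"
  unfolding decomp_def by (auto simp: subspace_0[OF subspace_eig])

lemma decomp_exists: "\<exists>f. decomp v f"
proof -
  have "v \<in> span (\<Union>n. eig n)" using D_span by (simp add: eig_def)
  then show ?thesis
  proof (induction rule: span_induct_alt)
    case base
    show ?case using decomp_single[OF subspace_0[OF subspace_eig], of 0] by auto
  next
    case (step c x y)
    then obtain n f where "x \<in> eig n" "decomp y f" by auto
    from decomp_add[OF decomp_scale[OF decomp_single[OF this(1)]] this(2)] show ?case by blast
  qed
qed

lemma decomp_unique:
  assumes "decomp v f" "decomp v g"
  shows "f = g"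
proof -
  define h where "h n = f n - g n" for n
  define I where "I = {n. f n \<noteq> 0} \<union> {n. g n \<noteq> 0}"
  have f: "finite I" using assms by (auto simp: decomp_def I_def)
  have "Sum_any f = sum f I" "Sum_any g = sum g I"
    by (rule Sum_any.expand_superset[OF f]; auto simp: I_def)+
  then have "sum f I = v" "sum g I = v"
    using assms by (auto simp: decomp_def)
  then have s: "sum h I = 0" unfolding h_def sum_subtractf by simp
  have "h n \<in> eig n" for n unfolding h_def
    using assms by (intro subspace_diff[OF subspace_eig]) (auto simp: decomp_def)
  then have "h n = 0" if "n \<in> I" for n
    using eig_independent[OF f _ s that] by blast
  then have "f n = g n" if "n \<in> I" for n using that by (simp add: h_def)
  then show ?thesis by (intro ext) (metis (mono_tags, lifting) I_def Un_iff mem_Collect_eq)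
qed

definition hcomp :: "'v \<Rightarrow> int \<Rightarrow> 'v" where
  "hcomp v = (THE f. decomp v f)"

lemma hcomp_decomp: "decomp v (hcomp v)"
  unfolding hcomp_def using decomp_exists decomp_unique by (metis theI)

lemma hcomp_eqI: "decomp v f \<Longrightarrow> hcomp v = f"
  using hcomp_decomp decomp_unique by blast

lemma hcomp_add: "hcomp (v + w) n = hcomp v n + hcomp w n"
  by (rule fun_cong[OF hcomp_eqI]) (intro decomp_add hcomp_decomp)

lemma hcomp_scale: "hcomp (scale c v) n = scale c (hcomp v n)"
  by (rule fun_cong[OF hcomp_eqI]) (intro decomp_scale hcomp_decomp)

lemma hcomp_eig: "v \<in> eig k \<Longrightarrow> hcomp v n = (if n = k then v else 0)"
  by (rule fun_cong[OF hcomp_eqI]) (rule decomp_single)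

lemma hcomp_in: "hcomp v n \<in> eig n" using hcomp_decomp[of v] by (auto simp: decomp_def)
lemma hcomp_finite: "finite {n. hcomp v n \<noteq> 0}" using hcomp_decomp[of v] by (auto simp: decomp_def)
lemma hcomp_sum: "Sum_any (hcomp v) = v" using hcomp_decomp[of v] by (auto simp: decomp_def)

lemma eig_induct [consumes 0, case_names add eig]:
  assumes "\<And>x y. P x \<Longrightarrow> P y \<Longrightarrow> P (x + y)" "\<And>k v. v \<in> eig k \<Longrightarrow> P v"
  shows "P v"
proof -
  have fin: "finite {n. hcomp v n \<noteq> 0}" by (rule hcomp_finite)
  have "P (sum (hcomp v) I)" if "finite I" for I
    using that
  proof (induction I rule: finite_induct)
    case empty
    show ?case using assms(2)[OF subspace_0[OF subspace_eig, of 0]] by simp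
  next
    case (insert m I)
    then show ?case using assms(1)[OF assms(2)[OF hcomp_in[of v m]] insert.IH] by simp
  qed
  from this[OF fin] have "P (Sum_any (hcomp v))" unfolding Sum_any.expand_set .
  then show ?thesis unfolding hcomp_sum .
qed

text \<open>For operations prescribed on homogeneous states and extended linearly, such as
  \<open>zero_mode\<close> and \<open>sq_mode\<close>.\<close>

lemma linear_hcomp_ext:
  assumes "\<And>k. Vector_Spaces.linear scale scale (T k)"
  shows "Vector_Spaces.linear scale scale (\<lambda>v. Sum_any (\<lambda>k. T k (hcomp v k)))"
proof (rule linI)
  have fin: "finite {k. T k (hcomp v k) \<noteq> 0}" for v
    by (rule finite_subset[OF _ hcomp_finite[of v]]) (auto simp: lin_zero[OF assms])
  show "Sum_any (\<lambda>k. T k (hcomp (x + y) k)) = Sum_any (\<lambda>k. T k (hcomp x k)) + Sum_any (\<lambda>k. T k (hcomp y k))" for x y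
    unfolding hcomp_add lin_add[OF assms] by (rule Sum_any.distrib[OF fin fin])
  show "Sum_any (\<lambda>k. T k (hcomp (scale c x) k)) = scale c (Sum_any (\<lambda>k. T k (hcomp x k)))" for c x
    unfolding hcomp_scale lin_scale[OF assms]
    by (subst (1 2) Sum_any.expand_superset[OF fin[of x]]) (auto simp: scale_sum_right)
qed

lemma hcomp_ext_eig:
  assumes "\<And>k. Vector_Spaces.linear scale scale (T k)" "v \<in> eig k"
  shows "Sum_any (\<lambda>k. T k (hcomp v k)) = T k v"
proof -
  have "(\<lambda>j. T j (hcomp v j)) = (\<lambda>j. if j = k then T k v else 0)"
    by (auto simp: fun_eq_iff hcomp_eig[OF assms(2)] lin_zero[OF assms(1)])
  then show ?thesis by (subst \<open>_ = _\<close>) (rule Sum_any.delta)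
qed

lemma linear_fun_hcomp_ext:
  assumes "\<And>k u. Vector_Spaces.linear scale scale (\<lambda>w. T k u w)" "\<And>k w. Vector_Spaces.linear scale scale (\<lambda>u. T k u w)"
  shows "Vector_Spaces.linear scale scale (\<lambda>w. Sum_any (\<lambda>k. T k (hcomp v k) w))"
proof -
  have fin: "{k. T k (hcomp v k) w \<noteq> 0} \<subseteq> {k. hcomp v k \<noteq> 0}" for w
    by (auto simp: lin_zero[OF assms(2)])
  have eq: "Sum_any (\<lambda>k. T k (hcomp v k) w) = (\<Sum>k | hcomp v k \<noteq> 0. T k (hcomp v k) w)" for w
    by (rule Sum_any.expand_superset[OF hcomp_finite fin])
  show ?thesis unfolding eq
    by (intro linI) (simp_all add: lin_add[OF assms(1)] lin_scale[OF assms(1)] sum.distrib scale_sum_right)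
qed

end

section \<open>Traces in finite bases\<close>

definition tr_basis :: "('a::field \<Rightarrow> 'b::ab_group_add \<Rightarrow> 'b) \<Rightarrow> 'b set \<Rightarrow> ('b \<Rightarrow> 'b) \<Rightarrow> 'a" where
  "tr_basis s B f = (\<Sum>b\<in>B. module.representation s B (f b) b)"

text \<open>Both sides are the same double sum of products of matrix entries of f and g.\<close>

lemma (in vector_space) tr_basis_comm:
  assumes "finite B" "finite C" "independent B" "independent C"
    and f: "Vector_Spaces.linear scale scale f" "\<And>x. x \<in> B \<Longrightarrow> f x \<in> span C"
    and g: "Vector_Spaces.linear scale scale g" "\<And>x. x \<in> C \<Longrightarrow> g x \<in> span B"
  shows "tr_basis scale B (\<lambda>x. g (f x)) = tr_basis scale C (\<lambda>x. f (g x))"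
proof -
  have *: "representation B (g (f b)) b = (\<Sum>c\<in>C. representation C (f b) c * representation B (g c) b)"
    if "finite B" "finite C" "independent B" "independent C"
     "Vector_Spaces.linear scale scale g" "\<And>x. x \<in> C \<Longrightarrow> g x \<in> span B" "f b \<in> span C" for B C f g b
  proof -
    have "g (f b) = g (\<Sum>c\<in>C. scale (representation C (f b) c) c)"
      using that by (subst sum_representation_eq) auto
    also have "\<dots> = (\<Sum>c\<in>C. scale (representation C (f b) c) (g c))"
      by (simp add: lin_sum[OF that(5)] lin_scale[OF that(5)])
    finally have "representation B (g (f b)) b = representation B (\<Sum>c\<in>C. scale (representation C (f b) c) (g c)) b"
      by simp
    also have "\<dots> = (\<Sum>c\<in>C. representation B (scale (representation C (f b) c) (g c)) b)"
      using that by (subst representation_sum) (auto intro: span_scale)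
    also have "\<dots> = (\<Sum>c\<in>C. representation C (f b) c * representation B (g c) b)"
      using that by (intro sum.cong refl) (simp add: representation_scale)
    finally show ?thesis .
  qed
  have "tr_basis scale B (\<lambda>x. g (f x)) = (\<Sum>b\<in>B. \<Sum>c\<in>C. representation C (f b) c * representation B (g c) b)"
    unfolding tr_basis_def using assms by (intro sum.cong refl *) auto
  also have "\<dots> = (\<Sum>c\<in>C. \<Sum>b\<in>B. representation B (g c) b * representation C (f b) c)"
    by (subst sum.swap) (simp add: mult.commute)
  also have "\<dots> = tr_basis scale C (\<lambda>x. f (g x))"
    unfolding tr_basis_def using assms by (intro sum.cong refl *[symmetric]) auto
  finally show ?thesis .
qed

context voa
begin

lemma mode_add_left: "mode V (u + v) n w = mode V u n w + mode V v n w"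
  by (rule lin_add[OF mode_linear_left])
lemma mode_scale_left: "mode V (smult V c v) n w = smult V c (mode V v n w)"
  by (rule lin_scale[OF mode_linear_left])
lemma mode_zero_left [simp]: "mode V 0 n w = 0"
  by (rule lin_zero[OF mode_linear_left])
lemma mode_add_right: "mode V v n (w + x) = mode V v n w + mode V v n x"
  by (rule lin_add[OF mode_linear_right])
lemma mode_scale_right: "mode V v n (smult V c w) = smult V c (mode V v n w)"
  by (rule lin_scale[OF mode_linear_right])
lemma mode_zero_right [simp]: "mode V v n 0 = 0"
  by (rule lin_zero[OF mode_linear_right])
lemma mode_sum_right: "mode V v n (sum f A) = (\<Sum>x\<in>A. mode V v n (f x))"
  by (rule lin_sum[OF mode_linear_right])

lemma truncation': obtains N where "\<And>n. n \<ge> N \<Longrightarrow> mode V u n v = 0"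
  using truncation by blast

text \<open>The Jacobi identity with r = 0: its right-hand side keeps only j = 0.\<close>

lemma commutator_any:
  "mode V u p (mode V v s w) - mode V v s (mode V u p w)
     = Sum_any (\<lambda>j. smult V (of_int p gchoose j) (mode V (mode V u (int j) v) (p + s - int j) w))"
proof -
  have 1: "((0::complex) gchoose j) = (if j = 0 then 1 else 0)" for j by (cases j) auto
  have "Sum_any (\<lambda>j. smult V ((-1) ^ j * (of_int 0 gchoose j))
          (mode V u (p + 0 - int j) (mode V v (s + int j) w)
           - smult V ((-1) powi 0) (mode V v (s + 0 - int j) (mode V u (p + int j) w))))
    = Sum_any (\<lambda>j::nat. if j = 0 then mode V u p (mode V v s w) - mode V v s (mode V u p w) else 0)"
    by (rule Sum_any.cong) (simp add: 1)
  then show ?thesis using jacobi[where r = 0 and p = p and s = s and u = u and v = v and w = w] by simp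
qed

lemma commutator:
  assumes "\<And>j. j \<ge> J \<Longrightarrow> mode V u (int j) v = 0"
  shows "mode V u p (mode V v s w) - mode V v s (mode V u p w)
     = (\<Sum>j<J. smult V (of_int p gchoose j) (mode V (mode V u (int j) v) (p + s - int j) w))"
  unfolding commutator_any
proof (rule Sum_any.expand_superset)
  have "mode V (mode V u (int j) v) (p + s - int j) w = 0" if "\<not> j < J" for j
    using assms that by simp
  then show "{j. smult V (of_int p gchoose j) (mode V (mode V u (int j) v) (p + s - int j) w) \<noteq> 0} \<subseteq> {..<J}"
    by auto
qed simp

text \<open>The Jacobi identity with p = 0: its left-hand side keeps only j = 0, leaving the modes
  of u(r)v.\<close>

lemma iterate_any:
  "mode V (mode V u r v) s w
     = Sum_any (\<lambda>j. smult V ((-1) ^ j * (of_int r gchoose j))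
          (mode V u (r - int j) (mode V v (s + int j) w)
           - smult V ((-1) powi r) (mode V v (s + r - int j) (mode V u (int j) w))))"
proof -
  have 1: "((0::complex) gchoose j) = (if j = 0 then 1 else 0)" for j by (cases j) auto
  have "Sum_any (\<lambda>j::nat. smult V (of_int 0 gchoose j)
          (mode V (mode V u (r + int j) v) (0 + s - int j) w))
    = Sum_any (\<lambda>j::nat. if j = 0 then mode V (mode V u r v) s w else 0)"
    by (rule Sum_any.cong) (simp add: 1)
  then show ?thesis using jacobi[where r = r and p = 0 and s = s and u = u and v = v and w = w] by simp
qed

lemma subspace_weight_space: "subspace (weight_space V n)"
  unfolding weight_space_def vir_def
  by (rule subspaceI) (auto simp: mode_add_right mode_scale_right scale_right_distrib scale_left_commute)

text \<open>Commutator with the mode of index 1 of the conformal vector, which is L(0): only j = 0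
  and j = 1 contribute, and the term with L(-1)u is evaluated by \<open>translation\<close>.\<close>

lemma weight_mode:
  assumes "u \<in> weight_space V d" "w \<in> weight_space V N"
  shows "mode V u n w \<in> weight_space V (N + d - n - 1)"
proof -
  obtain J0 where J0: "\<And>n. n \<ge> J0 \<Longrightarrow> mode V (conf V) n u = 0" using truncation'[of "conf V" u] by blast
  \<comment> \<open>Two successors guarantee that j = 0 and j = 1 lie below J.\<close>
  define J where "J = Suc (Suc (nat J0))"
  have g: "((1::complex) gchoose j) = (if j \<le> 1 then 1 else 0)" for j
  proof -
    have "((1::complex) gchoose j) = of_nat (1 choose j)" using binomial_gbinomial[of 1 j, where 'a=complex] by simp
    then show ?thesis by (cases "j \<le> 1") (auto simp: le_Suc_eq)
  qed
  have "vir V 0 (mode V u n w) - mode V u n (vir V 0 w)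
     = (\<Sum>j<J. smult V (of_int 1 gchoose j) (mode V (mode V (conf V) (int j) u) (1 + n - int j) w))"
    unfolding vir_def by (simp only: add_0_left, rule commutator) (auto simp: J_def intro!: J0)
  also have "\<dots> = (\<Sum>j\<in>{0,1}. smult V (of_int 1 gchoose j) (mode V (mode V (conf V) (int j) u) (1 + n - int j) w))"
    by (rule sum.mono_neutral_right) (auto simp: J_def g)
  also have "\<dots> = mode V (vir V (-1) u) (n + 1) w + mode V (vir V 0 u) n w"
    by (simp add: vir_def add.commute)
  also have "vir V 0 u = smult V (of_int d) u" using assms by (simp add: weight_space_def)
  also have "mode V (vir V (-1) u) (n + 1) w = smult V (- of_int (n + 1)) (mode V u n w)"
    by (subst translation) simp
  finally have "vir V 0 (mode V u n w) = mode V u n (smult V (of_int N) w) + (smult V (- of_int (n + 1)) (mode V u n w) + smult V (of_int d) (mode V u n w))"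
    using assms by (simp add: weight_space_def mode_scale_left algebra_simps)
  then show ?thesis
    by (simp add: weight_space_def mode_scale_right scale_left_distrib scale_left_diff_distrib)
qed

sublocale gr: graded_op "smult V" "vir V 0"
  rewrites "graded_op.eig (smult V) (vir V 0) = weight_space V"
    and "graded_op.hcomp (smult V) (vir V 0) = component V"
proof -
  show gr: "graded_op (smult V) (vir V 0)"
    using grading mode_linear_right vector_space_axioms
    by (intro graded_op.intro graded_op_axioms.intro) (auto simp: weight_space_def vir_def)
  interpret graded_op "smult V" "vir V 0" by (rule gr)
  show e: "eig = weight_space V" by (simp add: fun_eq_iff eig_def weight_space_def)
  show "hcomp = component V" by (simp add: fun_eq_iff hcomp_def component_def decomp_def e)
qed

lemma zero_mode_linear: "Vector_Spaces.linear (smult V) (smult V) (\<lambda>v. zero_mode V v w)"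
  unfolding zero_mode_def by (rule gr.linear_hcomp_ext[where T = "\<lambda>k v. mode V v (k - 1) w"]) (rule mode_linear_left)

lemma zero_mode_weight:
  assumes "v \<in> weight_space V k"
  shows "zero_mode V v = mode V v (k - 1)"
  unfolding zero_mode_def fun_eq_iff
  using gr.hcomp_ext_eig[where T = "\<lambda>k v. mode V v (k - 1) w" for w, OF mode_linear_left assms] by simp

lemma is_basis_of_exists: "subspace S \<Longrightarrow> \<exists>B. is_basis_of V B S"
  using maximal_independent_subset[of S] unfolding is_basis_of_def by metis

lemma is_basis_of_span: "is_basis_of V B S \<Longrightarrow> subspace S \<Longrightarrow> span B = S"
  unfolding is_basis_of_def by (metis span_subspace)

lemma is_basis_of_finite:
  assumes "is_basis_of V B S" "finite F" "S \<subseteq> span F"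
  shows "finite B"
  using independent_span_bound[of F B] assms unfolding is_basis_of_def by auto

text \<open>\<open>trace_on\<close> chooses its basis from S alone, so a single basis serves all
  operators; additivity of the trace rests on this.\<close>

lemma trace_on_basis: "subspace S \<Longrightarrow> \<exists>B. is_basis_of V B S \<and> (\<forall>f. trace_on V S f = tr_basis (smult V) B f)"
  using someI_ex[OF is_basis_of_exists[of S]] by (auto simp: trace_on_def tr_basis_def Let_def)

abbreviation finite_dim :: "'v set \<Rightarrow> bool" where
  "finite_dim S \<equiv> \<exists>F. finite F \<and> S \<subseteq> span F"

lemma trace_on_comm:
  assumes "subspace S" "subspace T" "finite_dim S" "finite_dim T"
    and "Vector_Spaces.linear (smult V) (smult V) f" "\<And>x. x \<in> S \<Longrightarrow> f x \<in> T"
    and "Vector_Spaces.linear (smult V) (smult V) g" "\<And>x. x \<in> T \<Longrightarrow> g x \<in> S"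
  shows "trace_on V S (\<lambda>x. g (f x)) = trace_on V T (\<lambda>x. f (g x))"
proof -
  obtain B where B: "is_basis_of V B S" "\<And>f. trace_on V S f = tr_basis (smult V) B f" using trace_on_basis[OF assms(1)] by blast
  obtain C where C: "is_basis_of V C T" "\<And>f. trace_on V T f = tr_basis (smult V) C f" using trace_on_basis[OF assms(2)] by blast
  have sp: "span B = S" "span C = T" using B C assms is_basis_of_span by auto
  have "finite B" "finite C" using is_basis_of_finite B C assms by blast+
  then show ?thesis unfolding B(2) C(2)
    using B(1) C(1) assms(5-8) sp by (intro tr_basis_comm) (auto simp: is_basis_of_def intro: span_base)
qed

lemma trace_on_add:
  assumes "subspace S" "\<And>x. x \<in> S \<Longrightarrow> f x \<in> S" "\<And>x. x \<in> S \<Longrightarrow> g x \<in> S"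
  shows "trace_on V S (\<lambda>x. f x + g x) = trace_on V S f + trace_on V S g"
proof -
  obtain B where B: "is_basis_of V B S" "\<And>f. trace_on V S f = tr_basis (smult V) B f" using trace_on_basis[OF assms(1)] by blast
  then have sp: "span B = S" "independent B" "B \<subseteq> S" using assms is_basis_of_span by (auto simp: is_basis_of_def)
  show ?thesis unfolding B(2) tr_basis_def sum.distrib[symmetric] using sp assms
    by (intro sum.cong refl) (subst representation_add, auto)
qed

lemma trace_on_scale:
  assumes "subspace S" "\<And>x. x \<in> S \<Longrightarrow> f x \<in> S"
  shows "trace_on V S (\<lambda>x. smult V c (f x)) = c * trace_on V S f"
proof -
  obtain B where B: "is_basis_of V B S" "\<And>f. trace_on V S f = tr_basis (smult V) B f" using trace_on_basis[OF assms(1)] by blast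
  then have sp: "span B = S" "independent B" "B \<subseteq> S" using assms is_basis_of_span by (auto simp: is_basis_of_def)
  show ?thesis unfolding B(2) tr_basis_def sum_distrib_left using sp assms
    by (intro sum.cong refl) (subst representation_scale, auto)
qed

lemma trace_on_0: "subspace S \<Longrightarrow> trace_on V S (\<lambda>x. 0) = 0"
  using trace_on_scale[of S "\<lambda>x. 0" 0] by (simp add: subspace_0)

lemma trace_on_cong:
  assumes "subspace S" "\<And>x. x \<in> S \<Longrightarrow> f x = g x"
  shows "trace_on V S f = trace_on V S g"
proof -
  obtain B where B: "is_basis_of V B S" "\<And>f. trace_on V S f = tr_basis (smult V) B f" using trace_on_basis[OF assms(1)] by blast
  then show ?thesis using assms unfolding B(2) tr_basis_def
    by (intro sum.cong refl) (auto simp: is_basis_of_def subset_iff)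
qed

lemma trace_on_sum:
  assumes "subspace S" "\<And>x i. i \<in> I \<Longrightarrow> x \<in> S \<Longrightarrow> f i x \<in> S"
  shows "trace_on V S (\<lambda>x. \<Sum>i\<in>I. f i x) = (\<Sum>i\<in>I. trace_on V S (f i))"
proof (cases "finite I")
  case True
  then show ?thesis using assms(2)
  proof (induction I rule: finite_induct)
    case (insert i I)
    then show ?case
      by (simp add: trace_on_add[OF assms(1)] subspace_sum[OF assms(1)])
  qed (simp add: trace_on_0 assms)
qed (simp add: trace_on_0 assms)

lemma trace_on_trivial: "trace_on V {0} f = 0"
proof -
  obtain B where B: "is_basis_of V B {0}" "\<And>f. trace_on V {0} f = tr_basis (smult V) B f"
    using trace_on_basis[of "{0}"] by auto
  then have "B = {}" unfolding is_basis_of_def using dependent_zero by (metis subset_singletonD insertI1)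
  then show ?thesis by (simp add: B tr_basis_def)
qed

lemma trace_on_id:
  assumes "subspace S"
  shows "\<exists>B. is_basis_of V B S \<and> trace_on V S (\<lambda>x. x) = of_nat (card B)"
proof -
  obtain B where B: "is_basis_of V B S" "\<And>f. trace_on V S f = tr_basis (smult V) B f" using trace_on_basis[OF assms(1)] by blast
  have "tr_basis (smult V) B (\<lambda>x. x) = (\<Sum>b\<in>B. 1)" unfolding tr_basis_def
    using B(1) by (intro sum.cong refl) (simp add: is_basis_of_def representation_basis)
  then show ?thesis using B by auto
qed

end

section \<open>Square bracket modes of a weight one state\<close>

text \<open>The residue at \<open>z = 0\<close> of \<open>f(z) Y(v,z) w\<close>.\<close>

definition smeared :: "('v::ab_group_add) vertex_alg \<Rightarrow> 'v \<Rightarrow> complex fls \<Rightarrow> 'v \<Rightarrow> 'v" where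
  "smeared V v f w = Sum_any (\<lambda>N. smult V (fls_nth f N) (mode V v N w))"

lemma fls_vanish_below: "\<exists>N. \<forall>n<N. fls_nth f n = 0"
  by (metis fls_eq0_below_subdegree)

lemma fls_times_vanish:
  fixes f g :: "'a::field fls"
  assumes "\<And>n. n < x \<Longrightarrow> fls_nth f n = 0" "\<And>n. n < y \<Longrightarrow> fls_nth g n = 0" "n < x + y"
  shows "fls_nth (f * g) n = 0"
proof (cases "f = 0 \<or> g = 0")
  case False
  then have "x \<le> fls_subdegree f" "y \<le> fls_subdegree g"
    using assms(1,2) by (auto intro!: fls_subdegree_geI)
  then show ?thesis using assms(3) by (intro fls_times_nth_eq0) auto
qed auto

context voa
begin

lemma smeared_support:
  assumes "\<And>n. n \<ge> T \<Longrightarrow> mode V v n w = 0" "\<And>n. n < lo \<Longrightarrow> fls_nth f n = 0"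
  shows "{n. smult V (fls_nth f n) (mode V v n w) \<noteq> 0} \<subseteq> {lo..<T}"
proof
  fix n assume "n \<in> {n. smult V (fls_nth f n) (mode V v n w) \<noteq> 0}"
  then have "fls_nth f n \<noteq> 0" "mode V v n w \<noteq> 0" by auto
  then have "\<not> n < lo" "\<not> n \<ge> T" using assms by blast+
  then show "n \<in> {lo..<T}" by auto
qed

lemma smeared_eq:
  assumes "\<And>n. n \<ge> T \<Longrightarrow> mode V v n w = 0" "\<And>n. n < lo \<Longrightarrow> fls_nth f n = 0"
  shows "smeared V v f w = (\<Sum>n\<in>{lo..<T}. smult V (fls_nth f n) (mode V v n w))"
  unfolding smeared_def by (rule Sum_any.expand_superset[OF _ smeared_support[OF assms]]) simp_all

text \<open>Truncation makes the coefficients from T onwards irrelevant; this permits replacing a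
  series by a finite part of it.\<close>

lemma smeared_cong:
  assumes "\<And>n. n \<ge> T \<Longrightarrow> mode V v n w = 0" "\<And>n. n < T \<Longrightarrow> fls_nth f n = fls_nth g n"
  shows "smeared V v f w = smeared V v g w"
  unfolding smeared_def
proof (rule Sum_any.cong)
  show "smult V (fls_nth f n) (mode V v n w) = smult V (fls_nth g n) (mode V v n w)" for n
    using assms by (cases "n \<ge> T") auto
qed

lemma smeared_finite: "finite {n. smult V (fls_nth f n) (mode V v n w) \<noteq> 0}"
proof -
  obtain T where T: "\<And>n. n \<ge> T \<Longrightarrow> mode V v n w = 0" using truncation' by blast
  obtain lo where lo: "\<And>n. n < lo \<Longrightarrow> fls_nth f n = 0" using fls_vanish_below by blast
  have "{n. smult V (fls_nth f n) (mode V v n w) \<noteq> 0} \<subseteq> {lo..<T}"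
    by (rule smeared_support[OF T lo])
  then show ?thesis by (rule finite_subset[OF _ finite_atLeastLessThan_int])
qed

lemma smeared_add: "smeared V v (f + g) w = smeared V v f w + smeared V v g w"
  unfolding smeared_def by (simp add: scale_left_distrib Sum_any.distrib[OF smeared_finite smeared_finite])

lemma Sum_any_scale:
  assumes "finite {n. f n \<noteq> 0}"
  shows "Sum_any (\<lambda>n. smult V c (f n)) = smult V c (Sum_any f)"
  by (subst (1 2) Sum_any.expand_superset[OF assms]) (auto simp: scale_sum_right)

lemma smeared_scale: "smeared V v (fls_const c * f) w = smult V c (smeared V v f w)"
  unfolding smeared_def Sum_any_scale[OF smeared_finite, symmetric] by simp

lemma smeared_0 [simp]: "smeared V v 0 w = 0" by (simp add: smeared_def)

lemma smeared_sum: "smeared V v (sum f A) w = (\<Sum>x\<in>A. smeared V v (f x) w)"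
  by (induction A rule: infinite_finite_induct) (auto simp: smeared_add)

lemma smeared_linear_left: "Vector_Spaces.linear (smult V) (smult V) (\<lambda>v. smeared V v f w)"
proof (rule linI)
  show "smeared V (x + y) f w = smeared V x f w + smeared V y f w" for x y
    unfolding smeared_def by (simp add: mode_add_left scale_right_distrib Sum_any.distrib[OF smeared_finite smeared_finite])
  show "smeared V (smult V c x) f w = smult V c (smeared V x f w)" for c x
    unfolding smeared_def Sum_any_scale[OF smeared_finite, symmetric]
    by (rule Sum_any.cong) (metis mode_scale_left scale_left_commute)
qed

lemma smeared_linear_right: "Vector_Spaces.linear (smult V) (smult V) (smeared V v f)"
proof (rule linI)
  show "smeared V v f (x + y) = smeared V v f x + smeared V v f y" for x y
    unfolding smeared_def by (simp add: mode_add_right scale_right_distrib Sum_any.distrib[OF smeared_finite smeared_finite])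
  show "smeared V v f (smult V c x) = smult V c (smeared V v f x)" for c x
    unfolding smeared_def Sum_any_scale[OF smeared_finite, symmetric]
    by (rule Sum_any.cong) (metis mode_scale_right scale_left_commute)
qed

lemma sq_mode_eq_hcomp: "sq_mode V v n w = Sum_any (\<lambda>k. smeared V (component V v k) (sq_series k n) w)"
  by (simp add: sq_mode_def smeared_def sq_coeff_eq)

lemma sq_mode_weight:
  assumes "v \<in> weight_space V k"
  shows "sq_mode V v n w = smeared V v (sq_series k n) w"
  unfolding sq_mode_eq_hcomp
  using gr.hcomp_ext_eig[where T = "\<lambda>k v. smeared V v (sq_series k n) w", OF smeared_linear_left assms] by simp

lemma sq_mode_linear_left: "Vector_Spaces.linear (smult V) (smult V) (\<lambda>v. sq_mode V v n w)"
  unfolding sq_mode_eq_hcomp by (rule gr.linear_hcomp_ext[where T = "\<lambda>k v. smeared V v (sq_series k n) w"]) (rule smeared_linear_left)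

lemma sq_mode_linear_right: "Vector_Spaces.linear (smult V) (smult V) (sq_mode V v n)"
  unfolding sq_mode_eq_hcomp
  by (rule gr.linear_fun_hcomp_ext[where T = "\<lambda>k v w. smeared V v (sq_series k n) w"]) (rule smeared_linear_right smeared_linear_left)+

lemma truncation_finite:
  assumes "finite A"
  obtains T where "\<And>n x. n \<ge> T \<Longrightarrow> x \<in> A \<Longrightarrow> mode V (f x) n (g x) = 0"
proof -
  have "\<exists>T. \<forall>n\<ge>T. \<forall>x\<in>A. mode V (f x) n (g x) = 0"
    using assms
  proof (induction A rule: finite_induct)
    case (insert a A)
    obtain T1 where "\<forall>n\<ge>T1. \<forall>x\<in>A. mode V (f x) n (g x) = 0" using insert by blast
    moreover obtain T2 where "\<And>n. n \<ge> T2 \<Longrightarrow> mode V (f a) n (g a) = 0" using truncation'[of "f a" "g a"] by blast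
    ultimately show ?case by (intro exI[of _ "max T1 T2"]) auto
  qed auto
  then show ?thesis using that by blast
qed

text \<open>The commutator formula turns v(q) into (u(i)v)(p + q - i); this shift of the index is
  multiplication of S by X^(p-i).\<close>

lemma mode_smeared_commutator:
  assumes J: "\<And>i. i \<ge> J \<Longrightarrow> mode V u (int i) v = 0"
  shows "mode V u p (smeared V v S w) - smeared V v S (mode V u p w)
    = (\<Sum>i<J. smult V (of_int p gchoose i) (smeared V (mode V u (int i) v) (S * fls_X powi (p - int i)) w))"
proof -
  obtain T1 where T1: "\<And>n. n \<ge> T1 \<Longrightarrow> mode V v n w = 0" using truncation' by blast
  obtain T2 where T2: "\<And>n. n \<ge> T2 \<Longrightarrow> mode V v n (mode V u p w) = 0" using truncation' by blast
  obtain T3 where T3: "\<And>n i. n \<ge> T3 \<Longrightarrow> i \<in> {..<J} \<Longrightarrow> mode V (mode V u (int i) v) n w = 0"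
    using truncation_finite[of "{..<J}" "\<lambda>i. mode V u (int i) v" "\<lambda>_. w"] by blast
  obtain lo where lo: "\<And>n. n < lo \<Longrightarrow> fls_nth S n = 0" using fls_vanish_below by blast
  \<comment> \<open>Beyond T all sums involved have ended, including those shifted by p - i for i <
    J.\<close>
  define T where "T = max (max T1 T2) (T3 + int J - p)"
  have e1: "smeared V v S w = (\<Sum>q\<in>{lo..<T}. smult V (fls_nth S q) (mode V v q w))"
    by (rule smeared_eq[OF _ lo]) (simp_all add: T1 T_def)
  have e2: "smeared V v S (mode V u p w) = (\<Sum>q\<in>{lo..<T}. smult V (fls_nth S q) (mode V v q (mode V u p w)))"
    by (rule smeared_eq[OF _ lo]) (simp_all add: T2 T_def)
  have "mode V u p (smeared V v S w) - smeared V v S (mode V u p w)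
     = (\<Sum>q\<in>{lo..<T}. smult V (fls_nth S q) (mode V u p (mode V v q w) - mode V v q (mode V u p w)))"
    unfolding e1 e2 mode_sum_right mode_scale_right scale_right_diff_distrib sum_subtractf ..
  also have "\<dots> = (\<Sum>q\<in>{lo..<T}. \<Sum>i<J. smult V (of_int p gchoose i) (smult V (fls_nth S q) (mode V (mode V u (int i) v) (p + q - int i) w)))"
  proof (intro sum.cong refl)
    fix q
    have "mode V u p (mode V v q w) - mode V v q (mode V u p w)
      = (\<Sum>i<J. smult V (of_int p gchoose i) (mode V (mode V u (int i) v) (p + q - int i) w))"
      by (rule commutator) (rule J)
    then show "smult V (fls_nth S q) (mode V u p (mode V v q w) - mode V v q (mode V u p w))
      = (\<Sum>i<J. smult V (of_int p gchoose i) (smult V (fls_nth S q) (mode V (mode V u (int i) v) (p + q - int i) w)))"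
      by (simp only: scale_sum_right scale_left_commute)
  qed
  also have "\<dots> = (\<Sum>i<J. smult V (of_int p gchoose i) (\<Sum>q\<in>{lo..<T}. smult V (fls_nth S q) (mode V (mode V u (int i) v) (p + q - int i) w)))"
    by (subst sum.swap) (simp add: scale_sum_right)
  also have "\<dots> = (\<Sum>i<J. smult V (of_int p gchoose i) (smeared V (mode V u (int i) v) (S * fls_X powi (p - int i)) w))"
  proof (intro sum.cong refl arg_cong[where f = "smult V _"])
    fix i assume i: "i \<in> {..<J}"
    have "smeared V (mode V u (int i) v) (S * fls_X powi (p - int i)) w
      = (\<Sum>n\<in>{lo + (p - int i)..<T + (p - int i)}. smult V (fls_nth (S * fls_X powi (p - int i)) n) (mode V (mode V u (int i) v) n w))"
    proof (rule smeared_eq)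
      fix n assume "n \<ge> T + (p - int i)"
      then have "n \<ge> T3" using i by (auto simp: T_def)
      then show "mode V (mode V u (int i) v) n w = 0" using T3 i by blast
    next
      fix n assume "n < lo + (p - int i)"
      then show "fls_nth (S * fls_X powi (p - int i)) n = 0"
        unfolding fls_nth_times_X_powi by (intro lo) auto
    qed
    also have "\<dots> = (\<Sum>q\<in>{lo..<T}. smult V (fls_nth S q) (mode V (mode V u (int i) v) (p + q - int i) w))"
      by (rule sum.reindex_bij_witness[of _ "\<lambda>q. q + (p - int i)" "\<lambda>n. n - (p - int i)"])
        (auto simp: fls_nth_times_X_powi algebra_simps simp del: fls_X_power_int)
    finally show "(\<Sum>q\<in>{lo..<T}. smult V (fls_nth S q) (mode V (mode V u (int i) v) (p + q - int i) w))
      = smeared V (mode V u (int i) v) (S * fls_X powi (p - int i)) w" ..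
  qed
  finally show ?thesis .
qed

lemma sq_mode_nat:
  assumes "u \<in> weight_space V 1" and J: "\<And>i. i \<ge> J \<Longrightarrow> mode V u (int i) v = 0"
  shows "sq_mode V u (int j) v = (\<Sum>i<J. smult V (ln_pow i j) (mode V u (int i) v))"
proof -
  have "sq_mode V u (int j) v = (\<Sum>n\<in>{0..<int J}. smult V (fls_nth (sq_series 1 (int j)) n) (mode V u n v))"
    unfolding sq_mode_weight[OF assms(1)]
  proof (rule smeared_eq)
    fix n assume "n \<ge> int J"
    then show "mode V u n v = 0" using J[of "nat n"] by auto
  qed (auto intro: sq_series_nth_0)
  also have "{0..<int J} = int ` {..<J}"
    using image_int_atLeastLessThan[of 0 J] by (simp add: lessThan_atLeast0)
  also have "(\<Sum>n\<in>int ` {..<J}. smult V (fls_nth (sq_series 1 (int j)) n) (mode V u n v))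
    = (\<Sum>i<J. smult V (ln_pow i j) (mode V u (int i) v))"
    by (subst sum.reindex) (simp_all add: sq_series_1 ln_pow_eq del: power_int_of_nat)
  finally show ?thesis .
qed

text \<open>As u has weight one, u[m] is u smeared with ln(1 + w)^m, and commuting it past v smeared
  with S yields u(i)v smeared with S times the i-th divided derivative.
  \<open>div_deriv_sq_series_mult\<close> regroups these into the modes (u[j]v)[m + n - j].\<close>

lemma sq_commutator_homogeneous:
  assumes u: "u \<in> weight_space V 1" and v: "v \<in> weight_space V k"
    and J: "\<And>i. i \<ge> J \<Longrightarrow> mode V u (int i) v = 0"
  shows "sq_mode V u m (sq_mode V v n w) - sq_mode V v n (sq_mode V u m w)
    = (\<Sum>j<J. smult V (of_int m gchoose j) (sq_mode V (sq_mode V u (int j) v) (m + n - int j) w))"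
proof -
  define S where "S = sq_series k n"
  define c where "c = fls_nth (sq_series 1 m)"
  define vi where "vi i = mode V u (int i) v" for i
  have vi: "vi i \<in> weight_space V (k - int i)" for i
    using weight_mode[OF u v, of "int i"] by (simp add: vi_def algebra_simps)
  obtain P1 where P1: "\<And>p. p \<ge> P1 \<Longrightarrow> mode V u p w = 0" using truncation' by blast
  obtain P2 where P2: "\<And>p. p \<ge> P2 \<Longrightarrow> mode V u p (smeared V v S w) = 0" using truncation' by blast
  obtain K where K: "\<And>N i. N \<ge> K \<Longrightarrow> i \<in> {..<J} \<Longrightarrow> mode V (vi i) N w = 0"
    using truncation_finite[of "{..<J}" vi "\<lambda>_. w"] by blast
  define P where "P = max (max P1 P2) (K + int J - n)"
  have sm: "sq_mode V v n x = smeared V v S x" for x unfolding S_def by (rule sq_mode_weight[OF v])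
  have su: "sq_mode V u m x = (\<Sum>p\<in>{m..<P}. smult V (c p) (mode V u p x))" if "\<And>p. p \<ge> P \<Longrightarrow> mode V u p x = 0" for x
    unfolding sq_mode_weight[OF u] c_def using that by (rule smeared_eq) (auto intro: sq_series_nth_0)
  have e1: "sq_mode V u m w = (\<Sum>p\<in>{m..<P}. smult V (c p) (mode V u p w))"
    by (rule su) (simp add: P1 P_def)
  have e2: "sq_mode V u m (smeared V v S w) = (\<Sum>p\<in>{m..<P}. smult V (c p) (mode V u p (smeared V v S w)))"
    by (rule su) (simp add: P2 P_def)
  have "sq_mode V u m (sq_mode V v n w) - sq_mode V v n (sq_mode V u m w)
     = (\<Sum>p\<in>{m..<P}. smult V (c p) (mode V u p (smeared V v S w) - smeared V v S (mode V u p w)))"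
    unfolding sm e1 e2 lin_sum[OF smeared_linear_right] lin_scale[OF smeared_linear_right] scale_right_diff_distrib sum_subtractf ..
  also have "\<dots> = (\<Sum>p\<in>{m..<P}. \<Sum>i<J. smeared V (vi i) (S * (fls_const (c p * (of_int p gchoose i)) * fls_X powi (p - int i))) w)"
  proof (intro sum.cong refl)
    fix p
    have "mode V u p (smeared V v S w) - smeared V v S (mode V u p w)
      = (\<Sum>i<J. smult V (of_int p gchoose i) (smeared V (vi i) (S * fls_X powi (p - int i)) w))"
      unfolding vi_def by (rule mode_smeared_commutator) (rule J)
    then show "smult V (c p) (mode V u p (smeared V v S w) - smeared V v S (mode V u p w))
      = (\<Sum>i<J. smeared V (vi i) (S * (fls_const (c p * (of_int p gchoose i)) * fls_X powi (p - int i))) w)"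
      by (simp only: scale_sum_right scale_scale mult.left_commute[of S] smeared_scale)
  qed
  also have "\<dots> = (\<Sum>i<J. smeared V (vi i) (S * (\<Sum>p\<in>{m..<P}. fls_const (c p * (of_int p gchoose i)) * fls_X powi (p - int i))) w)"
    by (subst sum.swap) (simp only: sum_distrib_left smeared_sum)
  also have "\<dots> = (\<Sum>i<J. smeared V (vi i) (div_deriv i (sq_series 1 m) * sq_series k n) w)"
  proof (intro sum.cong refl smeared_cong[where T = K])
    fix i assume i: "i \<in> {..<J}"
    show "mode V (vi i) N w = 0" if "N \<ge> K" for N using K i that by blast
    fix N assume N: "N < K"
    \<comment> \<open>G is the divided derivative of ln(1 + w)^m cut off at P. The difference starts
      in degree P - J or later, and P is so large that it does not reach the modes below K.\<close>
    define G where "G = (\<Sum>p\<in>{m..<P}. fls_const (c p * (of_int p gchoose i)) * fls_X powi (p - int i))"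
    have G: "fls_nth G x = (if x + int i \<in> {m..<P} then c (x + int i) * (of_int (x + int i) gchoose i) else 0)" for x
    proof -
      have "fls_nth G x = (\<Sum>p\<in>{m..<P}. if p = x + int i then c p * (of_int p gchoose i) else 0)"
        unfolding G_def fls_nth_sum fls_nth_times_X_powi by (intro sum.cong refl) auto
      then show ?thesis by (simp add: sum.delta')
    qed
    have "fls_nth (S * (div_deriv i (sq_series 1 m) - G)) N = 0"
    proof (rule fls_times_vanish[of n _ "P - int J"])
      show "fls_nth S x = 0" if "x < n" for x unfolding S_def using that by (rule sq_series_nth_0)
      show "fls_nth (div_deriv i (sq_series 1 m) - G) x = 0" if "x < P - int J" for x
        using that i by (auto simp: G fls_nth_div_deriv c_def sq_series_nth_0)
      show "N < n + (P - int J)" using N by (auto simp: P_def)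
    qed
    then show "fls_nth (S * G) N = fls_nth (div_deriv i (sq_series 1 m) * sq_series k n) N"
      by (simp add: S_def right_diff_distrib mult.commute)
  qed
  also have "\<dots> = (\<Sum>i<J. \<Sum>j\<le>i. smult V ((of_int m gchoose j) * ln_pow i j) (sq_mode V (vi i) (m + n - int j) w))"
    unfolding div_deriv_sq_series_mult smeared_sum smeared_scale sq_mode_weight[OF vi] ..
  also have "\<dots> = (\<Sum>i<J. \<Sum>j<J. smult V ((of_int m gchoose j) * ln_pow i j) (sq_mode V (vi i) (m + n - int j) w))"
    by (intro sum.cong refl sum.mono_neutral_left) (auto simp: ln_pow_0)
  also have "\<dots> = (\<Sum>j<J. smult V (of_int m gchoose j) (\<Sum>i<J. smult V (ln_pow i j) (sq_mode V (vi i) (m + n - int j) w)))"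
    by (subst sum.swap) (simp add: scale_sum_right)
  also have "\<dots> = (\<Sum>j<J. smult V (of_int m gchoose j) (sq_mode V (sq_mode V u (int j) v) (m + n - int j) w))"
  proof (intro sum.cong refl arg_cong[where f = "smult V _"])
    fix j
    have "sq_mode V u (int j) v = (\<Sum>i<J. smult V (ln_pow i j) (vi i))"
      unfolding vi_def by (rule sq_mode_nat[OF u]) (rule J)
    then show "(\<Sum>i<J. smult V (ln_pow i j) (sq_mode V (vi i) (m + n - int j) w)) = sq_mode V (sq_mode V u (int j) v) (m + n - int j) w"
      by (simp only: lin_sum[OF sq_mode_linear_left] lin_scale[OF sq_mode_linear_left])
  qed
  finally show ?thesis .
qed

text \<open>A state homogeneous for L[0] may mix the weights of L(0), so the formula is needed for
  arbitrary v, with one bound J for all its components.\<close>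

lemma sq_commutator:
  assumes u: "u \<in> weight_space V 1"
  shows "\<exists>J. (\<forall>j\<ge>J. sq_mode V u (int j) v = 0) \<and> (\<forall>m n w. sq_mode V u m (sq_mode V v n w) - sq_mode V v n (sq_mode V u m w)
    = (\<Sum>j<J. smult V (of_int m gchoose j) (sq_mode V (sq_mode V u (int j) v) (m + n - int j) w)))"
proof -
  define I where "I = {k. component V v k \<noteq> 0}"
  have I: "finite I" unfolding I_def by (rule gr.hcomp_finite)
  have v: "v = (\<Sum>k\<in>I. component V v k)"
    unfolding I_def by (subst gr.hcomp_sum[symmetric], rule Sum_any.expand_set)
  obtain T where T: "\<And>n k. n \<ge> T \<Longrightarrow> k \<in> I \<Longrightarrow> mode V u n (component V v k) = 0"
    using truncation_finite[OF I, of "\<lambda>_. u" "component V v"] by blast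
  define J where "J = nat T"
  have J: "mode V u (int i) (component V v k) = 0" if "i \<ge> J" "k \<in> I" for i k
    using that T by (simp add: J_def)
  note l = lin_sum[OF sq_mode_linear_left] lin_sum[OF sq_mode_linear_right]
  have "sq_mode V u (int j) v = 0" if "j \<ge> J" for j
  proof -
    have "sq_mode V u (int j) (component V v k) = 0" if "k \<in> I" for k
      by (subst sq_mode_nat[OF u, where J = J]) (use J that ln_pow_0 \<open>j \<ge> J\<close> in auto)
    then show ?thesis by (subst v) (simp add: l)
  qed
  moreover have "sq_mode V u m (sq_mode V v n w) - sq_mode V v n (sq_mode V u m w)
    = (\<Sum>j<J. smult V (of_int m gchoose j) (sq_mode V (sq_mode V u (int j) v) (m + n - int j) w))" for m n w
  proof -
    have "sq_mode V u m (sq_mode V v n w) - sq_mode V v n (sq_mode V u m w)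
      = (\<Sum>k\<in>I. sq_mode V u m (sq_mode V (component V v k) n w) - sq_mode V (component V v k) n (sq_mode V u m w))"
      by (subst (1 2) v) (simp add: l sum_subtractf)
    also have "\<dots> = (\<Sum>k\<in>I. \<Sum>j<J. smult V (of_int m gchoose j) (sq_mode V (sq_mode V u (int j) (component V v k)) (m + n - int j) w))"
      by (intro sum.cong refl sq_commutator_homogeneous[OF u gr.hcomp_in]) (use J in auto)
    also have "\<dots> = (\<Sum>j<J. smult V (of_int m gchoose j) (sq_mode V (sq_mode V u (int j) v) (m + n - int j) w))"
      by (subst (2) v, subst sum.swap) (simp add: l scale_sum_right)
    finally show ?thesis .
  qed
  ultimately show ?thesis by blast
qed

end

section \<open>Fock modules and their invariant form\<close>

text \<open>The usual \<open>z\<^sub>\<lambda>\<close> of a partition: up to sign, the norm of its Fock state.\<close>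

definition z_mset :: "nat multiset \<Rightarrow> complex" where
  "z_mset M = prod_mset (image_mset of_nat M) * (\<Prod>n\<in>set_mset M. fact (count M n))"

lemma z_mset_empty [simp]: "z_mset {#} = 1"
  by (simp add: z_mset_def)

lemma z_mset_add: "z_mset (add_mset n M) = of_nat n * of_nat (count M n + 1) * z_mset M"
proof -
  have "(\<Prod>k\<in>set_mset (add_mset n M). fact (count (add_mset n M) k))
     = of_nat (count M n + 1) * (\<Prod>k\<in>set_mset M. fact (count M k) :: complex)"
  proof (cases "n \<in># M")
    case True
    then have "(\<Prod>k\<in>set_mset M. fact (count (add_mset n M) k) :: complex)
      = fact (count (add_mset n M) n) * (\<Prod>k\<in>set_mset M - {n}. fact (count (add_mset n M) k))"
      by (subst prod.remove[of _ n]) auto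
    also have "(\<Prod>k\<in>set_mset M - {n}. fact (count (add_mset n M) k) :: complex) = (\<Prod>k\<in>set_mset M - {n}. fact (count M k))"
      by (intro prod.cong) auto
    finally show ?thesis
      using True prod.remove[of "set_mset M" n "\<lambda>k. fact (count M k) :: complex"]
      by (simp add: insert_absorb algebra_simps)
  next
    case False
    then have "(\<Prod>k\<in>set_mset M. fact (count (add_mset n M) k) :: complex) = (\<Prod>k\<in>set_mset M. fact (count M k))"
      by (intro prod.cong) auto
    then show ?thesis using False by (simp add: not_in_iff)
  qed
  then show ?thesis by (simp add: z_mset_def)
qed

lemma z_mset_nonzero: "0 \<notin># M \<Longrightarrow> z_mset M \<noteq> 0"
  by (induction M) (auto simp: z_mset_add simp del: of_nat_add of_nat_Suc)

text \<open>Integer-valued, to match the eigenvalue index of D.\<close>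

definition msum :: "nat multiset \<Rightarrow> int" where "msum M = int (sum_mset M)"

lemma msum_empty [simp]: "msum {#} = 0" and msum_add [simp]: "msum (add_mset n M) = int n + msum M"
  by (simp_all add: msum_def)

lemma msum_nonneg: "msum M \<ge> 0"
  unfolding msum_def by (rule of_nat_0_le_iff)

definition partitions :: "int \<Rightarrow> nat multiset set" where
  "partitions k = {M. 0 \<notin># M \<and> msum M = k}"

lemma finite_partitions: "finite (partitions k)"
proof -
  have "finite {M :: nat multiset. 0 \<notin># M \<and> sum_mset M = n}" for n
  proof (induction n rule: less_induct)
    case (less n)
    define A where "A = (\<Union>m\<in>{1..n}. add_mset m ` {M :: nat multiset. 0 \<notin># M \<and> sum_mset M = n - m})"
    have "M \<in> insert {#} A" if "0 \<notin># M" "sum_mset M = n" for M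
    proof (cases M)
      case (add m M')
      then have "m \<in> {1..n}" "M' \<in> {M :: nat multiset. 0 \<notin># M \<and> sum_mset M = n - m}"
        using that by (auto simp: Suc_le_eq)
      then show ?thesis unfolding A_def add by blast
    qed simp
    then have "{M :: nat multiset. 0 \<notin># M \<and> sum_mset M = n} \<subseteq> insert {#} A" by blast
    moreover have "finite A" unfolding A_def using less by (intro finite_UN_I finite_imageI) auto
    ultimately show ?case by (meson finite_insert finite_subset)
  qed
  then show ?thesis
    by (rule finite_subset[rotated, of "{M. 0 \<notin># M \<and> sum_mset M = nat k}"]) (unfold partitions_def msum_def, auto simp del: of_nat_sum_mset)
qed

text \<open>Instantiated with the modes \<open>a(n)\<close> and again with \<open>a[n]\<close>, which satisfy the same relations.\<close>

locale heis_module = vector_space scale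
  for scale :: "complex \<Rightarrow> 'v::ab_group_add \<Rightarrow> 'v" +
  fixes A :: "int \<Rightarrow> 'v \<Rightarrow> 'v" and D :: "'v \<Rightarrow> 'v" and vac :: 'v
  assumes A_linear: "Vector_Spaces.linear scale scale (A m)"
    and ccr: "A m (A n v) - A n (A m v) = (if m = - n then scale (of_int m) v else 0)"
    and A_vac: "m \<ge> 0 \<Longrightarrow> A m vac = 0"
    and D_lin: "Vector_Spaces.linear scale scale D"
    and D_A: "D (A m v) = A m (D v) - scale (of_int m) (A m v)"
    and D_vac: "D vac = 0"
    and vac_ne: "vac \<noteq> 0"
    and cyclic: "subspace S \<Longrightarrow> vac \<in> S \<Longrightarrow> (\<And>m v. m > 0 \<Longrightarrow> v \<in> S \<Longrightarrow> A (- m) v \<in> S) \<Longrightarrow> v \<in> S"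
begin

lemmas A_add = lin_add[OF A_linear] and A_scale = lin_scale[OF A_linear]
  and A_zero [simp] = lin_zero[OF A_linear] and A_sum = lin_sum[OF A_linear]

definition E :: "int \<Rightarrow> 'v set" where "E n = {v. D v = scale (of_int n) v}"

lemma vac_E: "vac \<in> E 0" by (simp add: E_def D_vac)

lemma A_E: "v \<in> E n \<Longrightarrow> A m v \<in> E (n - m)"
  by (simp add: E_def D_A A_scale scale_left_diff_distrib)

lemma A_E_minus: "v \<in> E n \<Longrightarrow> A (- m) v \<in> E (n + m)"
  using A_E[of v n "- m"] by simp

sublocale gr: graded_op scale D
  rewrites "graded_op.eig scale D = E"
proof -
  show gr: "graded_op scale D"
  proof (intro graded_op.intro graded_op_axioms.intro)
    show "vector_space scale" by (rule vector_space_axioms)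
    show "Vector_Spaces.linear scale scale D" by (rule D_lin)
    have "v \<in> span (\<Union>n. E n)" for v
    proof (rule cyclic)
      show "vac \<in> span (\<Union>n. E n)" using vac_E by (auto intro: span_base)
      fix m :: int and v assume "v \<in> span (\<Union>n. E n)"
      then show "A (- m) v \<in> span (\<Union>n. E n)"
      proof (induction rule: span_induct_alt)
        case (step c x y)
        then obtain n where "x \<in> E n" by blast
        from A_E_minus[OF this] have "A (- m) x \<in> span (\<Union>n. E n)" by (auto intro: span_base)
        then show ?case using step by (auto simp: A_add A_scale intro: span_add span_scale)
      qed (auto intro: span_zero)
    qed auto
    then show "span (\<Union>n. {v. D v = scale (of_int n) v}) = UNIV" by (auto simp: E_def)
  qed
  show "graded_op.eig scale D = E"
    by (rule ext) (simp add: graded_op.eig_def[OF gr] E_def)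
qed

text \<open>A 0 commutes with every mode, as its central term carries the factor m = 0, and it kills
  the vacuum.\<close>

lemma A_0 [simp]: "A 0 v = 0"
proof -
  have "v \<in> {v. A 0 v = 0}"
  proof (rule cyclic)
    show "subspace {v. A 0 v = 0}" by (rule subspaceI) (auto simp: A_add A_scale)
    fix m :: int and v assume "m > 0" "v \<in> {v. A 0 v = 0}"
    then show "A (- m) v \<in> {v. A 0 v = 0}" using ccr[of 0 "- m" v] by auto
  qed (simp add: A_vac)
  then show ?thesis by simp
qed

lemma hcomp_A: "gr.hcomp (A m v) k = A m (gr.hcomp v (k + m))"
proof -
  have "gr.decomp (A m v) (\<lambda>k. A m (gr.hcomp v (k + m)))"
    unfolding gr.decomp_def
  proof (intro conjI allI)
    define F where "F = {n. gr.hcomp v n \<noteq> 0}"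
    have F: "finite F" using gr.hcomp_finite by (simp add: F_def)
    have sub: "{n. A m (gr.hcomp v (n + m)) \<noteq> 0} \<subseteq> (\<lambda>n. n - m) ` F"
      by (auto simp: image_iff F_def) (metis A_zero add_diff_cancel_right')
    show "finite {n. A m (gr.hcomp v (n + m)) \<noteq> 0}" using F by (rule finite_subset[OF sub finite_imageI])
    show "A m (gr.hcomp v (k + m)) \<in> E k" for k using A_E[OF gr.hcomp_in[of v "k + m"], of m] by simp
    have "Sum_any (\<lambda>k. A m (gr.hcomp v (k + m))) = (\<Sum>k\<in>(\<lambda>n. n - m) ` F. A m (gr.hcomp v (k + m)))"
      by (rule Sum_any.expand_superset[OF finite_imageI[OF F] sub])
    also have "\<dots> = A m (\<Sum>k\<in>F. gr.hcomp v k)"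
      by (subst sum.reindex) (auto simp: A_sum inj_on_def)
    also have "(\<Sum>k\<in>F. gr.hcomp v k) = v"
      using gr.hcomp_sum[of v] unfolding F_def Sum_any.expand_set .
    finally show "Sum_any (\<lambda>k. A m (gr.hcomp v (k + m))) = A m v" .
  qed
  from gr.hcomp_eqI[OF this] show ?thesis by (rule fun_cong)
qed

lemma A_commute: "m \<noteq> - n \<Longrightarrow> A m (A n v) = A n (A m v)"
  using ccr[of m n v] by simp

lemma A_commute_nat: "A (int m) (A (int n) v) = A (int n) (A (int m) v)"
  using A_commute[of "int m" "int n" v] by (cases "m = 0 \<and> n = 0") auto

lemma A_commute_neg: "A (- int m) (A (- int n) v) = A (- int n) (A (- int m) v)"
  using A_commute[of "- int m" "- int n" v] by (cases "m = 0 \<and> n = 0") auto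

text \<open>Creation operators commute among themselves, so a Fock monomial depends only on a
  multiset of indices; the same holds for annihilation operators.\<close>

sublocale cre: comp_fun_commute "\<lambda>n. A (- int n)"
  by unfold_locales (auto simp: fun_eq_iff A_commute_neg)
sublocale ann: comp_fun_commute "\<lambda>n. A (int n)"
  by unfold_locales (auto simp: fun_eq_iff A_commute_nat)

definition cre :: "nat multiset \<Rightarrow> 'v" where "cre M = fold_mset (\<lambda>n. A (- int n)) vac M"
definition ann :: "nat multiset \<Rightarrow> 'v \<Rightarrow> 'v" where "ann M v = fold_mset (\<lambda>n. A (int n)) v M"

lemma cre_empty [simp]: "cre {#} = vac" by (simp add: cre_def)
lemma ann_empty [simp]: "ann {#} v = v" by (simp add: ann_def)
lemma cre_add: "cre (add_mset n M) = A (- int n) (cre M)" by (simp add: cre_def cre.fold_mset_add_mset)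
lemma ann_add: "ann (add_mset n M) v = A (int n) (ann M v)" by (simp add: ann_def ann.fold_mset_add_mset)
lemma ann_add': "ann (add_mset n M) v = ann M (A (int n) v)"
  by (simp add: ann_def ann.fold_mset_fun_left_comm[symmetric] ann.fold_mset_add_mset)

lemma cre_E: "cre M \<in> E (msum M)"
proof (induction M)
  case (add n M)
  then show ?case using A_E_minus[OF add, of "int n"] by (simp add: cre_add add.commute)
qed (simp add: vac_E)

lemma ann_linear: "Vector_Spaces.linear scale scale (ann M)"
proof (induction M)
  case (add n M)
  then show ?case by (intro linI) (simp_all add: ann_add lin_add[OF add] lin_scale[OF add] A_add A_scale)
qed (intro linI; simp)

text \<open>Speaking of all components at once makes the set of admissible v a subspace closed under
  creation, as \<open>cyclic\<close> requires.\<close>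

lemma hcomp_span_cre: "gr.hcomp v k \<in> span (cre ` partitions k)"
proof -
  have "v \<in> {v. \<forall>k. gr.hcomp v k \<in> span (cre ` partitions k)}"
  proof (rule cyclic)
    show "subspace {v. \<forall>k. gr.hcomp v k \<in> span (cre ` partitions k)}"
      by (rule subspaceI)
        (auto simp: gr.hcomp_add gr.hcomp_scale gr.hcomp_eig[OF subspace_0[OF gr.subspace_eig, of 0]] span_zero intro: span_add span_scale)
    have "{#} \<in> partitions 0" by (simp add: partitions_def)
    then have "cre {#} \<in> span (cre ` partitions 0)" by (intro span_base imageI)
    then show "vac \<in> {v. \<forall>k. gr.hcomp v k \<in> span (cre ` partitions k)}"
      by (auto simp: gr.hcomp_eig[OF vac_E] span_zero)
    fix m :: int and v assume m: "m > 0" and v: "v \<in> {v. \<forall>k. gr.hcomp v k \<in> span (cre ` partitions k)}"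
    show "A (- m) v \<in> {v. \<forall>k. gr.hcomp v k \<in> span (cre ` partitions k)}"
    proof (safe, unfold hcomp_A)
      fix k
      have "gr.hcomp v (k + - m) \<in> span (cre ` partitions (k - m))" using v by auto
      then show "A (- m) (gr.hcomp v (k + - m)) \<in> span (cre ` partitions k)"
      proof (induction rule: span_induct_alt)
        case (step c x y)
        then obtain M where M: "x = cre M" "M \<in> partitions (k - m)" by blast
        then have "A (- m) x = cre (add_mset (nat m) M)" "add_mset (nat m) M \<in> partitions k"
          using m by (auto simp: cre_add partitions_def)
        then have "A (- m) x \<in> span (cre ` partitions k)" by (auto intro: span_base)
        then show ?case using step by (auto simp: A_add A_scale intro: span_add span_scale)
      qed (simp add: span_zero)
    qed
  qed
  then show ?thesis by simp
qed

lemma E_eq_span: "E k = span (cre ` partitions k)"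
proof
  show "E k \<subseteq> span (cre ` partitions k)"
  proof
    fix v assume "v \<in> E k"
    then show "v \<in> span (cre ` partitions k)" using hcomp_span_cre[of v k] by (simp add: gr.hcomp_eig)
  qed
  show "span (cre ` partitions k) \<subseteq> E k"
    by (rule span_minimal) (use cre_E gr.subspace_eig in \<open>auto simp: partitions_def\<close>)
qed

lemma E_neg: "k < 0 \<Longrightarrow> E k = {0}"
proof -
  assume "k < 0"
  then have "msum M \<noteq> k" for M using msum_nonneg[of M] by auto
  then have "partitions k = {}" by (simp add: partitions_def)
  then show ?thesis by (simp add: E_eq_span)
qed

lemma E_0: "E 0 = span {vac}"
proof -
  have "partitions 0 = {{#}}"
  proof safe
    fix M assume "M \<in> partitions 0"
    then show "M = {#}" using msum_nonneg by (cases M) (auto simp: partitions_def add_nonneg_eq_0_iff)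
  qed (simp add: partitions_def)
  then show ?thesis by (simp add: E_eq_span)
qed

lemma A_vanish: "v \<in> E n \<Longrightarrow> m > n \<Longrightarrow> A m v = 0"
  using A_E[of v n m] E_neg[of "n - m"] by auto

text \<open>Vacuum expectation value; E 0 is the line through \<open>vac\<close>, so the scalar
  exists and is unique.\<close>

definition vev :: "'v \<Rightarrow> complex" where
  "vev v = (THE c. gr.hcomp v 0 = scale c vac)"

lemma vev_eqI: "gr.hcomp v 0 = scale c vac \<Longrightarrow> vev v = c"
  unfolding vev_def using vac_ne by (intro the_equality) auto

lemma vev: "gr.hcomp v 0 = scale (vev v) vac"
proof -
  have "gr.hcomp v 0 \<in> E 0" by (rule gr.hcomp_in)
  then obtain c where "gr.hcomp v 0 = scale c vac" unfolding E_0 span_singleton by blast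
  then show ?thesis using vev_eqI by metis
qed

lemma vev_add: "vev (v + w) = vev v + vev w"
  by (rule vev_eqI) (simp only: gr.hcomp_add vev[symmetric] scale_left_distrib)
lemma vev_scale: "vev (scale c v) = c * vev v"
  by (rule vev_eqI) (simp only: gr.hcomp_scale vev[symmetric] scale_scale[symmetric])
lemma vev_zero [simp]: "vev 0 = 0" using vev_scale[of 0 0] by simp
lemma vev_vac [simp]: "vev vac = 1"
  by (rule vev_eqI) (simp add: gr.hcomp_eig[OF vac_E])
lemma vev_E: "v \<in> E n \<Longrightarrow> n \<noteq> 0 \<Longrightarrow> vev v = 0"
  by (rule vev_eqI) (simp add: gr.hcomp_eig)
lemma vev_cre: "m \<ge> 0 \<Longrightarrow> vev (A (- m) v) = 0"
proof (cases "m = 0")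
  case False
  assume "m \<ge> 0"
  have "gr.hcomp v (- m) \<in> E (- m)" by (rule gr.hcomp_in)
  then have "gr.hcomp v (- m) = 0" using E_neg[of "- m"] \<open>m \<ge> 0\<close> False by auto
  then show ?thesis by (intro vev_eqI) (simp add: hcomp_A)
qed simp

text \<open>Annihilation removes the parts of M and the vacuum component is read off; the result is
  z_M times the coefficient of the monomial \<open>cre M\<close>.\<close>

definition fock_coeff :: "nat multiset \<Rightarrow> 'v \<Rightarrow> complex" where "fock_coeff M v = vev (ann M v)"

lemma fock_coeff_add: "fock_coeff M (v + w) = fock_coeff M v + fock_coeff M w"
  by (simp add: fock_coeff_def lin_add[OF ann_linear] vev_add)
lemma fock_coeff_scale: "fock_coeff M (scale c v) = c * fock_coeff M v"
  by (simp add: fock_coeff_def lin_scale[OF ann_linear] vev_scale)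
lemma fock_coeff_zero [simp]: "fock_coeff M 0 = 0" using fock_coeff_scale[of M 0 0] by simp

lemma fock_coeff_A: "fock_coeff M (A (int n) v) = fock_coeff (add_mset n M) v"
  by (simp add: fock_coeff_def ann_add')

text \<open>Moving A (- n) to the left past the annihilators meets \<open>count M n\<close> copies
  of A n, each contributing n.\<close>

lemma ann_A_minus:
  "ann M (A (- int n) v) = A (- int n) (ann M v) + scale (of_nat n * of_nat (count M n)) (ann (M - {#n#}) v)"
proof (cases "n = 0")
  case True
  then show ?thesis by (simp add: lin_zero[OF ann_linear])
next
  case False
  show ?thesis
  proof (induction M)
    case (add x M)
    have 1: "A (int x) (A (- int n) u) = A (- int n) (A (int x) u) + (if x = n then scale (of_nat n) u else 0)" for u
      using ccr[of "int x" "- int n" u] by (auto simp: algebra_simps)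
    show ?case
    proof (cases "x = n")
      case True
      have "scale (of_nat n * of_nat (count M n)) (A (int n) (ann (M - {#n#}) v)) = scale (of_nat n * of_nat (count M n)) (ann M v)"
      proof (cases "n \<in># M")
        case True
        then have "A (int n) (ann (M - {#n#}) v) = ann M v" by (simp flip: ann_add)
        then show ?thesis by simp
      qed (simp add: not_in_iff)
      then show ?thesis using True
        by (simp add: ann_add add A_add A_scale 1[of "ann M v", unfolded True, simplified] add.assoc distrib_left scale_left_distrib del: scale_cancel_left)
    next
      case False
      then show ?thesis by (simp add: ann_add add A_add A_scale 1)
    qed
  qed simp
qed

lemma fock_coeff_A_minus: "fock_coeff M (A (- int n) v) = of_nat n * of_nat (count M n) * fock_coeff (M - {#n#}) v"
  by (simp add: fock_coeff_def ann_A_minus vev_add vev_scale vev_cre)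

text \<open>This duality is derived from the commutation relations alone, so it also provides
  independence of the monomials in the modes a[n].\<close>

lemma fock_coeff_cre: "fock_coeff M (cre N) = (if M = N then z_mset M else 0)"
proof (induction N arbitrary: M)
  case empty
  show ?case
  proof (cases M)
    case (add n M')
    then show ?thesis by (simp add: fock_coeff_def ann_add' A_vac lin_zero[OF ann_linear])
  qed (simp add: fock_coeff_def)
next
  case (add n N)
  show ?case
  proof (cases "n \<in># M")
    case True
    then obtain M' where M: "M = add_mset n M'" by (metis multi_member_split)
    then show ?thesis by (simp add: cre_add fock_coeff_A_minus add z_mset_add)
  next
    case False
    then show ?thesis by (auto simp: cre_add fock_coeff_A_minus not_in_iff)
  qed
qed

lemma fock_coeff_finite: "finite {M. fock_coeff M v \<noteq> 0}"
proof -
  have "v \<in> {v. finite {M. fock_coeff M v \<noteq> 0}}"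
  proof (rule cyclic)
    show "subspace {v. finite {M. fock_coeff M v \<noteq> 0}}"
    proof (rule subspaceI)
      fix x y assume "x \<in> {v. finite {M. fock_coeff M v \<noteq> 0}}" "y \<in> {v. finite {M. fock_coeff M v \<noteq> 0}}"
      then have "finite ({M. fock_coeff M x \<noteq> 0} \<union> {M. fock_coeff M y \<noteq> 0})" by simp
      then have "finite {M. fock_coeff M (x + y) \<noteq> 0}" by (rule rev_finite_subset) (auto simp: fock_coeff_add)
      then show "x + y \<in> {v. finite {M. fock_coeff M v \<noteq> 0}}" by simp
    next
      fix c x assume "x \<in> {v. finite {M. fock_coeff M v \<noteq> 0}}"
      then have "finite {M. fock_coeff M x \<noteq> 0}" by simp
      then have "finite {M. fock_coeff M (scale c x) \<noteq> 0}" by (rule rev_finite_subset) (auto simp: fock_coeff_scale)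
      then show "scale c x \<in> {v. finite {M. fock_coeff M v \<noteq> 0}}" by simp
    qed simp
    have "{M. fock_coeff M vac \<noteq> 0} \<subseteq> {{#}}" using fock_coeff_cre[of _ "{#}"] by auto
    then show "vac \<in> {v. finite {M. fock_coeff M v \<noteq> 0}}" by (auto intro: finite_subset)
    fix m :: int and v assume m: "m > 0" and v: "v \<in> {v. finite {M. fock_coeff M v \<noteq> 0}}"
    have "{M. fock_coeff M (A (- m) v) \<noteq> 0} \<subseteq> add_mset (nat m) ` {M. fock_coeff M v \<noteq> 0}"
    proof
      fix M assume M: "M \<in> {M. fock_coeff M (A (- m) v) \<noteq> 0}"
      have "fock_coeff M (A (- m) v) = of_nat (nat m) * of_nat (count M (nat m)) * fock_coeff (M - {#nat m#}) v"
        using fock_coeff_A_minus[of M "nat m" v] m by simp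
      then have "fock_coeff (M - {#nat m#}) v \<noteq> 0" "nat m \<in># M"
        using M by (auto simp: not_in_iff)
      then show "M \<in> add_mset (nat m) ` {M. fock_coeff M v \<noteq> 0}"
        by (intro image_eqI[of _ _ "M - {#nat m#}"]) auto
    qed
    then show "A (- m) v \<in> {v. finite {M. fock_coeff M v \<noteq> 0}}"
      using v by (auto intro: finite_subset)
  qed
  then show ?thesis by simp
qed

lemma E_expand: "v \<in> E k \<Longrightarrow> v = (\<Sum>M\<in>partitions k. scale (fock_coeff M v / z_mset M) (cre M))"
  unfolding E_eq_span
proof (induction rule: span_induct_alt)
  case (step c x y)
  then obtain N where N: "x = cre N" "N \<in> partitions k" by blast
  have "(\<Sum>M\<in>partitions k. scale (fock_coeff M x / z_mset M) (cre M)) = (\<Sum>M\<in>partitions k. if M = N then cre N else 0)"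
    using N z_mset_nonzero by (intro sum.cong refl) (auto simp: fock_coeff_cre partitions_def)
  also have "\<dots> = x" using N finite_partitions by simp
  finally have x: "(\<Sum>M\<in>partitions k. scale (fock_coeff M x / z_mset M) (cre M)) = x" .
  have "(\<Sum>M\<in>partitions k. scale (fock_coeff M (scale c x + y) / z_mset M) (cre M))
    = scale c (\<Sum>M\<in>partitions k. scale (fock_coeff M x / z_mset M) (cre M)) + (\<Sum>M\<in>partitions k. scale (fock_coeff M y / z_mset M) (cre M))"
    by (simp add: scale_sum_right fock_coeff_add fock_coeff_scale add_divide_distrib scale_left_distrib sum.distrib)
  also have "\<dots> = scale c x + y" unfolding x by (simp only: step(2)[symmetric])
  finally show ?case ..
qed simp

section \<open>The invariant form on a Fock module\<close>

text \<open>The sign makes \<open>-A(-n)\<close> the adjoint of \<open>A(n)\<close>, as invariance demands for a primary state of weight one.\<close>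

definition form :: "'v \<Rightarrow> 'v \<Rightarrow> complex" where
  "form x y = Sum_any (\<lambda>M. (-1) ^ size M * fock_coeff M x * fock_coeff M y / z_mset M)"

lemma form_superset:
  assumes "finite F" "{M. fock_coeff M x \<noteq> 0} \<subseteq> F \<or> {M. fock_coeff M y \<noteq> 0} \<subseteq> F"
  shows "form x y = (\<Sum>M\<in>F. (-1) ^ size M * fock_coeff M x * fock_coeff M y / z_mset M)"
  unfolding form_def
  by (rule Sum_any.expand_superset) (use assms in auto)

lemma form_sym: "form x y = form y x"
  unfolding form_def by (rule Sum_any.cong) simp

lemma form_add_right: "form x (y + z) = form x y + form x z"
  unfolding form_superset[OF fock_coeff_finite disjI1[OF order.refl], of x]
  by (simp add: fock_coeff_add algebra_simps add_divide_distrib sum.distrib)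
lemma form_scale_right: "form x (scale c y) = c * form x y"
  unfolding form_superset[OF fock_coeff_finite disjI1[OF order.refl], of x]
  by (simp add: fock_coeff_scale sum_distrib_left mult_ac)
lemma form_add_left: "form (x + y) z = form x z + form y z"
  using form_add_right form_sym by metis
lemma form_scale_left: "form (scale c x) y = c * form x y"
  using form_scale_right form_sym by metis
lemma form_zero_left [simp]: "form 0 y = 0" using form_scale_left[of 0 0] by simp
lemma form_zero_right [simp]: "form y 0 = 0" using form_scale_right[of _ 0 0] by simp
lemma form_sum_right: "form x (sum g I) = (\<Sum>i\<in>I. form x (g i))"
  by (induction I rule: infinite_finite_induct) (auto simp: form_add_right)
lemma form_sum_left: "form (sum g I) y = (\<Sum>i\<in>I. form (g i) y)"
  by (induction I rule: infinite_finite_induct) (auto simp: form_add_left)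

lemma form_cre:
  assumes "0 \<notin># M"
  shows "form x (cre M) = (-1) ^ size M * fock_coeff M x"
  by (subst form_superset[of "{M}"]) (use z_mset_nonzero[OF assms] in \<open>auto simp: fock_coeff_cre\<close>)

lemma form_vac: "form vac vac = 1"
  using form_cre[of "{#}" vac] by (simp add: fock_coeff_def)

text \<open>Reindexing by adding a part n to M: the factor n times the multiplicity from
  \<open>fock_coeff_A_minus\<close> cancels against the growth of z_M, and the change of size gives
  the sign.\<close>

lemma form_A_nat: "form (A (int n) x) y = - form x (A (- int n) y)"
proof (cases "n = 0")
  case False
  define g where "g M = (-1) ^ size M * fock_coeff M x * fock_coeff M (A (- int n) y) / z_mset M" for M
  have g: "g (add_mset n M) = - ((-1) ^ size M * fock_coeff M (A (int n) x) * fock_coeff M y / z_mset M)" for M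
    using False by (simp add: g_def fock_coeff_A fock_coeff_A_minus z_mset_add field_simps del: of_nat_Suc of_nat_add)
  have g0: "g M = 0" if "n \<notin># M" for M using that by (simp add: g_def fock_coeff_A_minus not_in_iff)
  have "{M. g M \<noteq> 0} = add_mset n ` {M. g (add_mset n M) \<noteq> 0}"
  proof (safe)
    fix M assume "g M \<noteq> 0"
    then have "n \<in># M" using g0 by blast
    then obtain M' where "M = add_mset n M'" by (metis multi_member_split)
    then show "M \<in> add_mset n ` {M. g (add_mset n M) \<noteq> 0}" using \<open>g M \<noteq> 0\<close> by auto
  qed
  then have "Sum_any g = sum g (add_mset n ` {M. g (add_mset n M) \<noteq> 0})"
    unfolding Sum_any.expand_set by simp
  also have "\<dots> = Sum_any (\<lambda>M. g (add_mset n M))"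
    unfolding Sum_any.expand_set by (subst sum.reindex) (auto simp: inj_on_def)
  also have "\<dots> = Sum_any (\<lambda>M. - ((-1) ^ size M * fock_coeff M (A (int n) x) * fock_coeff M y / z_mset M))"
    by (rule Sum_any.cong) (rule g)
  also have "\<dots> = - form (A (int n) x) y"
    unfolding form_def Sum_any.expand_set by (simp add: sum_negf)
  finally show ?thesis by (simp add: form_def g_def)
qed simp

lemma form_A: "form (A n x) y = - form x (A (- n) y)"
proof (cases "n \<ge> 0")
  case True
  then show ?thesis using form_A_nat[of "nat n" x y] by simp
next
  case False
  then show ?thesis using form_A_nat[of "nat (- n)" y x] by (simp add: form_sym)
qed

text \<open>Two passes: with the vacuum in the first slot, a creation operator moved over from y
  annihilates it; afterwards the creation operators of x are moved to the second slot.\<close>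

lemma form_unique:
  assumes lin: "\<And>x. Vector_Spaces.linear scale (*) (\<lambda>y. \<beta> x y)" "\<And>y. Vector_Spaces.linear scale (*) (\<lambda>x. \<beta> x y)"
    and vac: "\<beta> vac vac = 1" and inv: "\<And>n x y. \<beta> (A n x) y = - \<beta> x (A (- n) y)"
  shows "\<beta> = form"
proof -
  have 1: "y \<in> {y. \<beta> vac y = form vac y}" for y
  proof (rule cyclic)
    show "subspace {y. \<beta> vac y = form vac y}"
      by (rule subspaceI) (auto simp: lin_add[OF lin(1)] lin_scale[OF lin(1)] lin_zero[OF lin(1)] form_add_right form_scale_right)
    show "vac \<in> {y. \<beta> vac y = form vac y}" by (simp add: vac form_vac)
    show "A (- m) v \<in> {y. \<beta> vac y = form vac y}" if "m > 0" for m v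
      using inv[of m vac v] form_A[of m vac v] that by (simp add: A_vac lin_zero[OF lin(2)])
  qed
  have "x \<in> {x. \<forall>y. \<beta> x y = form x y}" for x
  proof (rule cyclic)
    show "subspace {x. \<forall>y. \<beta> x y = form x y}"
      by (rule subspaceI) (auto simp: lin_add[OF lin(2)] lin_scale[OF lin(2)] lin_zero[OF lin(2)] form_add_left form_scale_left)
    show "vac \<in> {x. \<forall>y. \<beta> x y = form x y}" using 1 by simp
    show "A (- m) v \<in> {x. \<forall>y. \<beta> x y = form x y}" if "v \<in> {x. \<forall>y. \<beta> x y = form x y}" for m v
      using that by (auto simp: inv form_A)
  qed
  then show ?thesis by (auto simp: fun_eq_iff)
qed

lemma form_nondegenerate:
  assumes "x \<in> E n" "\<And>y. y \<in> E n \<Longrightarrow> form x y = 0"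
  shows "x = 0"
proof -
  have "fock_coeff M x = 0" if "M \<in> partitions n" for M
  proof -
    have "form x (cre M) = 0" using assms(2)[of "cre M"] cre_E[of M] that by (simp add: partitions_def)
    then show ?thesis using that by (simp add: form_cre partitions_def)
  qed
  then show ?thesis by (subst E_expand[OF assms(1)]) simp
qed

text \<open>The monomials are orthogonal with norms (-1)^(size M) z_M, so dividing the values of g
  on them by these norms gives w.\<close>

lemma form_represent:
  assumes add: "\<And>x y. x \<in> E n \<Longrightarrow> y \<in> E n \<Longrightarrow> g (x + y) = g x + g y"
    and scale: "\<And>c x. x \<in> E n \<Longrightarrow> g (scale c x) = c * g x"
  shows "\<exists>w\<in>E n. \<forall>x\<in>E n. form x w = g x"
proof
  define w where "w = (\<Sum>M\<in>partitions n. scale ((-1) ^ size M * g (cre M) / z_mset M) (cre M))"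
  have c: "cre M \<in> E n" if "M \<in> partitions n" for M using cre_E[of M] that by (simp add: partitions_def)
  then show "w \<in> E n" unfolding w_def
    by (intro subspace_sum[OF gr.subspace_eig] subspace_scale[OF gr.subspace_eig])
  show "\<forall>x\<in>E n. form x w = g x"
  proof
    fix x assume x: "x \<in> E n"
    have g0: "g 0 = 0" using scale[of 0 0] subspace_0[OF gr.subspace_eig] by simp
    have gs: "g (sum h I) = (\<Sum>i\<in>I. g (h i))" if "\<And>i. i \<in> I \<Longrightarrow> h i \<in> E n" for I and h :: "nat multiset \<Rightarrow> 'v"
      using that by (induction I rule: infinite_finite_induct) (auto simp: g0 add subspace_sum[OF gr.subspace_eig])
    have "g x = g (\<Sum>M\<in>partitions n. scale (fock_coeff M x / z_mset M) (cre M))"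
      using E_expand[OF x] by simp
    also have "\<dots> = (\<Sum>M\<in>partitions n. fock_coeff M x / z_mset M * g (cre M))"
      using c by (subst gs) (auto intro: subspace_scale[OF gr.subspace_eig] simp: scale)
    also have "\<dots> = form x w"
      unfolding w_def form_sum_right form_scale_right
      by (intro sum.cong refl) (auto simp: form_cre partitions_def field_simps simp flip: power_add mult_2)
    finally show "form x w = g x" ..
  qed
qed

lemma E_finite_dim: "\<exists>F. finite F \<and> E n \<subseteq> span F"
  unfolding E_eq_span using finite_partitions by blast

lemma A_cre_nat: "A (int n) (cre M) = scale (of_nat n * of_nat (count M n)) (cre (M - {#n#}))"
proof (cases "n = 0")
  case False
  show ?thesis
  proof (induction M)
    case (add x M)
    have 1: "A (int n) (A (- int x) u) = A (- int x) (A (int n) u) + (if x = n then scale (of_nat n) u else 0)" for u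
      using ccr[of "int n" "- int x" u] by (auto simp: algebra_simps)
    show ?case
    proof (cases "x = n")
      case True
      have "scale (of_nat n * of_nat (count M n)) (A (- int n) (cre (M - {#n#}))) = scale (of_nat n * of_nat (count M n)) (cre M)"
      proof (cases "n \<in># M")
        case True
        then have "A (- int n) (cre (M - {#n#})) = cre M" by (simp flip: cre_add)
        then show ?thesis by simp
      qed (simp add: not_in_iff)
      then show ?thesis using True
        by (simp add: cre_add add 1[of "cre M", unfolded True, simplified] A_scale distrib_left scale_left_distrib add.commute del: scale_cancel_left)
    next
      case False
      then show ?thesis by (simp add: cre_add add 1 A_scale)
    qed
  qed (simp add: A_vac)
qed simp

text \<open>A (- k) A k multiplies a monomial by k times the multiplicity of k. Summed over k this
  is the weight, and no part exceeds n.\<close>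

lemma sugawara:
  assumes "v \<in> E (int n)"
  shows "(\<Sum>k=1..n. A (- int k) (A (int k) v)) = scale (of_nat n) v"
  using assms unfolding E_eq_span
proof (induction rule: span_induct_alt)
  case (step c x y)
  then obtain M where M: "x = cre M" "M \<in> partitions (int n)" by blast
  have 1: "A (- int k) (A (int k) x) = scale (of_nat k * of_nat (count M k)) x" for k
  proof (cases "k \<in># M")
    case True
    then show ?thesis unfolding M A_cre_nat A_scale by (simp flip: cre_add)
  qed (simp add: M A_cre_nat not_in_iff)
  have "(\<Sum>k\<in>{1..n}. k * count M k) = sum_mset M" if "0 \<notin># M" "sum_mset M \<le> n" for M
    using that
  proof (induction M)
    case (add m M)
    have "(\<Sum>k\<in>{1..n}. k * count (add_mset m M) k) = (\<Sum>k\<in>{1..n}. k * count M k + (if k = m then m else 0))"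
      by (intro sum.cong) auto
    then show ?case using add by (simp add: sum.distrib Suc_le_eq)
  qed simp
  moreover have "0 \<notin># M" "sum_mset M = n" using M by (auto simp: partitions_def msum_def simp del: of_nat_sum_mset)
  ultimately have "(\<Sum>k\<in>{1..n}. k * count M k) = n" by simp
  then have "(\<Sum>k=1..n. A (- int k) (A (int k) x)) = scale (of_nat n) x"
    unfolding 1 scale_sum_left[symmetric] by (metis (no_types, lifting) of_nat_mult of_nat_sum sum.cong)
  then show ?case
    using step by (simp add: A_add A_scale sum.distrib scale_right_distrib scale_left_commute flip: scale_sum_right)
qed simp

end

section \<open>The Li-Zamolodchikov form of the square bracket Heisenberg algebra\<close>

lemma ln_pow_1: "ln_pow (Suc 0) j = (if j = 1 then 1 else 0)"
  by (cases "j \<le> 1") (auto simp: ln_pow_def fps_ln_nth le_Suc_eq ln_pow_0[unfolded ln_pow_def])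

text \<open>Apply (1 + w) d/dw to (1 + w)^(k-1) ln(1 + w)^n. This is what makes L[-1] act as
  translation in \<open>sqL_minus1_creation\<close>.\<close>

lemma sq_series_rec:
  "of_int n * fls_nth (sq_series k (n - 1)) i
    = of_int (i + 1) * fls_nth (sq_series k n) (i + 1) + of_int (i - (k - 1)) * fls_nth (sq_series k n) i"
proof -
  have "X_plus_1 * fls_deriv (sq_series k n) = of_int (k - 1) * sq_series k n + of_int n * sq_series k (n - 1)"
  proof -
    have "X_plus_1 * fls_deriv (X_plus_1 powi (k - 1)) = of_int (k - 1) * X_plus_1 powi (k - 1)"
    proof -
      have "fls_deriv X_plus_1 = 1" by (simp add: X_plus_1_def)
      then have "X_plus_1 * fls_deriv (X_plus_1 powi (k - 1)) = of_int (k - 1) * (X_plus_1 powi (k - 1 - 1) * X_plus_1)"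
        by (simp add: fls_deriv_powi mult_ac)
      also have "X_plus_1 powi (k - 1 - 1) * X_plus_1 = X_plus_1 powi (k - 1)"
        by (subst power_int_add_1[symmetric]) auto
      finally show ?thesis .
    qed
    then have "X_plus_1 * fls_deriv (X_plus_1 powi (k - 1)) * ln_fls powi n + X_plus_1 powi (k - 1) * (X_plus_1 * fls_deriv (ln_fls powi n))
      = of_int (k - 1) * X_plus_1 powi (k - 1) * ln_fls powi n + X_plus_1 powi (k - 1) * (of_int n * ln_fls powi (n - 1))"
      by (simp only: euler_ln_fls_powi)
    then show ?thesis
      unfolding sq_series_def fls_deriv_mult by (simp only: distrib_left mult_ac add.commute)
  qed
  then have "fls_nth (X_plus_1 * fls_deriv (sq_series k n)) i = fls_nth (of_int (k - 1) * sq_series k n + of_int n * sq_series k (n - 1)) i"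
    by simp
  then show ?thesis unfolding fls_nth_euler by (simp add: fls_of_int algebra_simps)
qed

text \<open>Coefficient of x^n in (1 - x/(1 + x))^m = (1 + x)^(-m).\<close>

lemma gbinomial_neg_vandermonde:
  fixes m :: complex
  shows "(\<Sum>j\<le>n. (-1) ^ j * (m gchoose j) * (- of_nat j gchoose (n - j))) = (- m gchoose n)"
proof -
  have "(\<Sum>j\<le>n. (-1) ^ j * (m gchoose j) * (- of_nat j gchoose (n - j)))
     = (\<Sum>j\<le>n. (-1) ^ n * ((m gchoose j) * ((of_nat n - 1) gchoose (n - j))))"
  proof (intro sum.cong refl)
    fix j assume "j \<in> {..n}"
    then have j: "j \<le> n" by simp
    have "(- of_nat j gchoose (n - j)) = (-1) ^ (n - j) * ((of_nat j + of_nat (n - j) - 1 :: complex) gchoose (n - j))"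
      by (rule gbinomial_minus)
    also have "of_nat j + of_nat (n - j) - 1 = (of_nat n - 1 :: complex)" using j by (simp add: of_nat_diff)
    also have "(-1) ^ j * (m gchoose j) * ((-1) ^ (n - j) * ((of_nat n - 1) gchoose (n - j)))
      = ((-1) ^ j * (-1) ^ (n - j)) * ((m gchoose j) * ((of_nat n - 1 :: complex) gchoose (n - j)))"
      by (simp only: mult_ac)
    also have "(-1 :: complex) ^ j * (-1) ^ (n - j) = (-1) ^ n" using j by (simp flip: power_add)
    finally show "(-1) ^ j * (m gchoose j) * (- of_nat j gchoose (n - j)) = (-1) ^ n * ((m gchoose j) * ((of_nat n - 1) gchoose (n - j)))"
      by (simp only: )
  qed
  also have "\<dots> = (-1) ^ n * ((m + (of_nat n - 1)) gchoose n)"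
    by (simp only: sum_distrib_left[symmetric] gbinomial_Vandermonde atMost_atLeast0)
  also have "\<dots> = (- m gchoose n)" by (simp add: gbinomial_minus[of m n] algebra_simps)
  finally show ?thesis .
qed

lemma sum_triangle_square:
  fixes f :: "nat \<Rightarrow> nat \<Rightarrow> 'a::comm_monoid_add"
  assumes "\<And>i j. i + j > R \<Longrightarrow> f i j = 0"
  shows "(\<Sum>k\<le>R. \<Sum>i\<le>k. f i (k - i)) = (\<Sum>i\<le>R. \<Sum>j\<le>R. f i j)"
proof -
  have "(\<Sum>i\<le>R. \<Sum>j\<le>R. f i j) = (\<Sum>(i,j)\<in>{..R} \<times> {..R}. f i j)"
    by (simp add: sum.cartesian_product)
  also have "\<dots> = (\<Sum>(i,j)\<in>{(i,j). i + j \<le> R}. f i j)"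
    by (rule sum.mono_neutral_right) (use assms not_less in \<open>auto simp: not_le\<close>)
  also have "\<dots> = (\<Sum>k\<le>R. \<Sum>i\<le>k. f i (k - i))"
    by (rule sum.triangle_reindex_eq)
  finally show ?thesis ..
qed

section \<open>The generator a: commutators and the square bracket Fock space\<close>

context heisenberg_voa
begin

lemma a_eq: "mode M a (-1) (vac M) = a" by (rule creation)

lemma a_CCR: "mode M a m (mode M a n v) = mode M a n (mode M a m v) + (if m = - n then smult M (of_int m) v else 0)"
  using heisenberg[of m n v] by (simp add: algebra_simps)

lemma a_a: "j \<ge> 0 \<Longrightarrow> mode M a j a = (if j = 1 then vac M else 0)"
  using a_CCR[of j "-1" "vac M"] by (simp add: a_eq creation_nonneg)

text \<open>These products determine the commutator of a(m) with L(n), here as for a primary state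
  of weight one.\<close>

lemma a_conf: "j \<ge> 0 \<Longrightarrow> mode M a j (conf M) = (if j = 1 then a else 0)"
  unfolding conformal_vector a_eq mode_scale_right a_CCR[of j "-1" a] a_a
  by (auto simp: a_eq a_a scale_right_distrib simp flip: scale_left_distrib)

lemma vir_a: "vir M n (mode M a m v) = mode M a m (vir M n v) - smult M (of_int m) (mode M a (m + n) v)"
proof -
  have "mode M a m (mode M (conf M) (n + 1) v) - mode M (conf M) (n + 1) (mode M a m v)
     = (\<Sum>j<2. smult M (of_int m gchoose j) (mode M (mode M a (int j) (conf M)) (m + (n + 1) - int j) v))"
    by (rule commutator) (simp add: a_conf)
  also have "\<dots> = smult M (of_int m) (mode M a (m + n) v)"
    by (simp add: a_conf numeral_2_eq_2)
  finally show ?thesis by (simp add: vir_def algebra_simps)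
qed

lemma vac_nonzero: "vac M \<noteq> 0"
proof -
  have "vac M \<in> fock_vector M a ` fock_index"
    by (rule image_eqI[of _ _ "[]"]) (auto simp: fock_vector_def fock_index_def)
  then show ?thesis using fock_basis dependent_zero unfolding is_basis_of_def by metis
qed

lemma fock_cyclic:
  assumes "subspace S" "vac M \<in> S" "\<And>m v. m > 0 \<Longrightarrow> v \<in> S \<Longrightarrow> mode M a (- m) v \<in> S"
  shows "v \<in> S"
proof -
  have "fock_vector M a ns \<in> S" if "\<forall>n\<in>set ns. n \<ge> 1" for ns
    using that by (induction ns) (auto simp: fock_vector_def assms)
  then have "span (fock_vector M a ` fock_index) \<subseteq> S"
    by (intro span_minimal assms(1)) (auto simp: fock_index_def)
  then show ?thesis using fock_basis unfolding is_basis_of_def by auto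
qed

sublocale round: heis_module "smult M" "mode M a" "vir M 0" "vac M"
  rewrites "heis_module.E (smult M) (vir M 0) = weight_space M"
proof -
  show h: "heis_module (smult M) (mode M a) (vir M 0) (vac M)"
  proof (intro heis_module.intro heis_module_axioms.intro)
    show "vector_space (smult M)" by (rule vector_space_axioms)
    show "Vector_Spaces.linear (smult M) (smult M) (vir M 0)" unfolding vir_def by (rule mode_linear_right)
    show "vir M 0 (vac M) = 0" by (simp add: vir_def creation_nonneg)
    show "vir M 0 (mode M a m v) = mode M a m (vir M 0 v) - smult M (of_int m) (mode M a m v)" for m v
      using vir_a[of 0 m v] by simp
    show "v \<in> S" if "subspace S" "vac M \<in> S" "\<And>m v. m > 0 \<Longrightarrow> v \<in> S \<Longrightarrow> mode M a (- m) v \<in> S" for S v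
      using fock_cyclic that by blast
  qed (simp_all add: mode_linear_right heisenberg creation_nonneg vac_nonzero)
  show "heis_module.E (smult M) (vir M 0) = weight_space M"
    by (rule ext) (simp add: heis_module.E_def[OF h] weight_space_def)
qed

abbreviation al :: "int \<Rightarrow> 'v \<Rightarrow> 'v" where "al \<equiv> sq_mode M a"

lemmas sq_add = lin_add[OF sq_mode_linear_left] lin_add[OF sq_mode_linear_right]
  and sq_scale = lin_scale[OF sq_mode_linear_left] lin_scale[OF sq_mode_linear_right]
  and sq_sum = lin_sum[OF sq_mode_linear_left] lin_sum[OF sq_mode_linear_right]
  and sq_zero = lin_zero[OF sq_mode_linear_left] lin_zero[OF sq_mode_linear_right]
  and sq_diff = lin_diff[OF sq_mode_linear_left] lin_diff[OF sq_mode_linear_right]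

lemma sq_vac: "sq_mode M (vac M) n w = (if n = -1 then w else 0)"
proof -
  have "sq_mode M (vac M) n w = Sum_any (\<lambda>N. if N = -1 then smult M (fls_nth (sq_series 0 n) N) w else 0)"
    unfolding sq_mode_weight[OF round.vac_E] smeared_def by (rule Sum_any.cong) (simp add: vacuum)
  also have "\<dots> = smult M (sq_coeff 0 (-1) n) w" by (simp add: sq_coeff_eq)
  also have "sq_coeff 0 (-1) n = (if n = -1 then 1 else 0)" by (simp add: sq_coeff_def)
  finally show ?thesis by simp
qed

lemma sq_creation_nonneg: "n \<ge> 0 \<Longrightarrow> sq_mode M v n (vac M) = 0"
proof (induction v rule: gr.eig_induct)
  case (eig k v)
  have "smeared M v (sq_series k n) (vac M) = (\<Sum>N\<in>{0..<0}. smult M (fls_nth (sq_series k n) N) (mode M v N (vac M)))"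
    by (rule smeared_eq) (use eig in \<open>auto simp: creation_nonneg intro: sq_series_nth_0\<close>)
  then show ?case by (simp add: sq_mode_weight[OF eig(1)])
qed (simp add: sq_add)

text \<open>Among the products of a with itself only a(1)a is non-zero, and \<open>ln_pow_1\<close>
  keeps j = 1 alone, so the square bracket products are the same.\<close>

lemma al_CCR: "al m (al n v) - al n (al m v) = (if m = - n then smult M (of_int m) v else 0)"
proof -
  have "al (int j) a = (if j = 1 then vac M else 0)" for j
    by (subst sq_mode_nat[OF weight_one, where J = 2]) (auto simp: a_a numeral_2_eq_2 ln_pow_0_right ln_pow_0 ln_pow_1 lessThan_Suc)
  then have "(\<Sum>j<2. smult M (of_int m gchoose j) (sq_mode M (al (int j) a) (m + n - int j) v))
      = (if m = - n then smult M (of_int m) v else 0)"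
    by (auto simp: numeral_2_eq_2 sq_vac sq_zero)
  moreover have "al m (al n v) - al n (al m v) = (\<Sum>j<2. smult M (of_int m gchoose j) (sq_mode M (al (int j) a) (m + n - int j) v))"
    by (rule sq_commutator_homogeneous[OF weight_one weight_one]) (simp add: a_a)
  ultimately show ?thesis by simp
qed

lemma conf_weight: "conf M \<in> weight_space M 2"
  unfolding conformal_vector a_eq using round.A_E_minus[OF weight_one, of 1]
  by (simp add: subspace_scale[OF subspace_weight_space])

definition sqL :: "int \<Rightarrow> 'v \<Rightarrow> 'v" where "sqL n = vir (square_bracket M) n"

text \<open>The shift of the conformal vector by c/24 affects a single mode, as the vacuum has only
  the mode of index -1.\<close>

lemma sqL_eq: "sqL n v = sq_mode M (conf M) (n + 1) v - (if n = -2 then smult M (1 / 24) v else 0)"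
  by (auto simp: sqL_def vir_def square_bracket_def sq_diff sq_scale sq_vac central_charge_one)

lemma sqL_linear: "Vector_Spaces.linear (smult M) (smult M) (sqL n)"
  unfolding sqL_def vir_def square_bracket_def by (simp add: sq_mode_linear_right)

lemmas sqL_add = lin_add[OF sqL_linear] and sqL_scale = lin_scale[OF sqL_linear]
  and sqL_zero [simp] = lin_zero[OF sqL_linear] and sqL_sum = lin_sum[OF sqL_linear]

lemma sqL_al: "sqL n (al m v) = al m (sqL n v) - smult M (of_int m) (al (m + n) v)"
proof -
  have "al (int j) (conf M) = (if j = 1 then a else 0)" for j
    by (subst sq_mode_nat[OF weight_one, where J = 2]) (auto simp: a_conf numeral_2_eq_2 ln_pow_0_right ln_pow_0 ln_pow_1 lessThan_Suc)
  then have "(\<Sum>j<2. smult M (of_int m gchoose j) (sq_mode M (al (int j) (conf M)) (m + (n + 1) - int j) v))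
      = smult M (of_int m) (al (m + n) v)"
    by (simp add: numeral_2_eq_2 sq_zero)
  moreover have "al m (sq_mode M (conf M) (n + 1) v) - sq_mode M (conf M) (n + 1) (al m v)
     = (\<Sum>j<2. smult M (of_int m gchoose j) (sq_mode M (al (int j) (conf M)) (m + (n + 1) - int j) v))"
    by (rule sq_commutator_homogeneous[OF weight_one conf_weight]) (simp add: a_conf)
  ultimately show ?thesis by (simp add: sqL_eq sq_diff sq_scale sq_zero algebra_simps)
qed

lemma sqL_vac: "n \<ge> -1 \<Longrightarrow> sqL n (vac M) = 0"
  by (simp add: sqL_eq sq_creation_nonneg)

text \<open>The least such space W is stable under the annihilators a[m] by the commutation
  relations, and then under every a(p), because these are recovered from the a[q] by triangularity;
  hence W contains the Fock space of the a(n).\<close>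

lemma sq_cyclic:
  assumes "subspace S" "vac M \<in> S" "\<And>m v. m > 0 \<Longrightarrow> v \<in> S \<Longrightarrow> al (- m) v \<in> S"
  shows "v \<in> S"
proof -
  define ok where "ok T \<longleftrightarrow> subspace T \<and> vac M \<in> T \<and> (\<forall>m>0. \<forall>v\<in>T. al (- m) v \<in> T)" for T
  define W where "W = \<Inter>(Collect ok)"
  have W_min: "W \<subseteq> T" if "ok T" for T using that by (auto simp: W_def)
  have W: "subspace W" "vac M \<in> W" and W_cre: "\<And>m v. m > 0 \<Longrightarrow> v \<in> W \<Longrightarrow> al (- m) v \<in> W"
    unfolding W_def by (auto simp: ok_def intro!: subspace_Inter)
  define T where "T = {v \<in> W. \<forall>m\<ge>0. al m v \<in> W}"
  have "ok T" unfolding ok_def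
  proof (intro conjI allI impI ballI)
    show "subspace T" unfolding T_def
      by (rule subspaceI) (use W in \<open>auto simp: sq_add sq_scale sq_zero subspace_0 subspace_add subspace_scale\<close>)
    show "vac M \<in> T" using W by (auto simp: T_def sq_creation_nonneg subspace_0)
    fix k :: int and v assume k: "k > 0" and v: "v \<in> T"
    have "al m (al (- k) v) \<in> W" if "m \<ge> 0" for m
    proof -
      have "al m (al (- k) v) = al (- k) (al m v) + (if m = k then smult M (of_int m) v else 0)"
        using al_CCR[of m "- k" v] by (simp add: algebra_simps)
      also have "\<dots> \<in> W"
        by (rule subspace_add[OF W(1)]) (use v k that W W_cre in \<open>auto simp: T_def subspace_0 subspace_scale\<close>)
      finally show ?thesis .
    qed
    then show "al (- k) v \<in> T" using v k W_cre by (auto simp: T_def)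
  qed
  from W_min[OF this] have W_al: "al m v \<in> W" if "v \<in> W" for m v
    using that W_cre[of "- m" v] by (cases "m \<ge> 0") (auto simp: T_def)
  have W_a: "mode M a p w \<in> W" if w: "w \<in> W" for p w
  proof -
    obtain N where N: "\<And>n. n \<ge> N \<Longrightarrow> mode M a n w = 0" using truncation'[of a w] by blast
    \<comment> \<open>Downward induction from the truncation bound N: the leading term of a[p]w is
      a(p)w, and the remaining ones have larger index.\<close>
    have "\<forall>p. p \<ge> N - int d \<longrightarrow> mode M a p w \<in> W" for d
    proof (induction d)
      case 0
      then show ?case using N W by (auto simp: subspace_0)
    next
      case (Suc d)
      have "mode M a p w \<in> W" if p: "p = N - int (Suc d)" for p
      proof -
        define c where "c = fls_nth (sq_series 1 p)"
        have "al p w = (\<Sum>q\<in>{p..<N}. smult M (c q) (mode M a q w))"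
          unfolding sq_mode_weight[OF weight_one] c_def by (rule smeared_eq) (auto simp: N intro: sq_series_nth_0)
        also have "{p..<N} = insert p {p+1..<N}" using p by auto
        finally have "al p w = mode M a p w + (\<Sum>q\<in>{p+1..<N}. smult M (c q) (mode M a q w))"
          by (simp add: c_def sq_series_nth_eq)
        then have "mode M a p w = al p w - (\<Sum>q\<in>{p+1..<N}. smult M (c q) (mode M a q w))" by simp
        moreover have "(\<Sum>q\<in>{p+1..<N}. smult M (c q) (mode M a q w)) \<in> W"
          using Suc p by (intro subspace_sum[OF W(1)] subspace_scale[OF W(1)]) auto
        ultimately show ?thesis using W_al[OF w] subspace_diff[OF W(1)] by simp
      qed
      moreover have "p = N - int (Suc d) \<or> p \<ge> N - int d" if "p \<ge> N - int (Suc d)" for p using that by auto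
      ultimately show ?case using Suc by blast
    qed
    from spec[OF this[of "nat (N - p)"], of p] show ?thesis by (cases "N \<ge> p") (use N W in \<open>auto simp: subspace_0\<close>)
  qed
  have "v \<in> W" by (rule fock_cyclic[OF W W_a])
  moreover have "W \<subseteq> S" using assms by (intro W_min) (auto simp: ok_def)
  ultimately show ?thesis by blast
qed

sublocale sq: heis_module "smult M" al "sqL 0" "vac M"
proof (intro heis_module.intro heis_module_axioms.intro)
  show "vector_space (smult M)" by (rule vector_space_axioms)
  show "sqL 0 (al m v) = al m (sqL 0 v) - smult M (of_int m) (al m v)" for m v
    using sqL_al[of 0 m v] by simp
  show "v \<in> S" if "subspace S" "vac M \<in> S" "\<And>m v. m > 0 \<Longrightarrow> v \<in> S \<Longrightarrow> al (- m) v \<in> S" for S v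
    using sq_cyclic that by blast
qed (simp_all add: sq_mode_linear_right al_CCR sq_creation_nonneg vac_nonzero sqL_linear sqL_vac)

lemma square_bracket_sel [simp]:
  "smult (square_bracket M) = smult M" "mode (square_bracket M) = sq_mode M" "vac (square_bracket M) = vac M"
  by (simp_all add: square_bracket_def)

lemma sq_E: "weight_space (square_bracket M) n = sq.E n"
  unfolding weight_space_def sq.E_def by (simp add: sqL_def)

lemma sq_commutator':
  assumes "x \<in> sq.E k" "k \<le> int R"
  shows "al m (sq_mode M x n w) - sq_mode M x n (al m w)
    = (\<Sum>j\<le>R. smult M (of_int m gchoose j) (sq_mode M (al (int j) x) (m + n - int j) w))"
proof -
  obtain J where J: "\<And>j. j \<ge> J \<Longrightarrow> al (int j) x = 0"
    and eq: "al m (sq_mode M x n w) - sq_mode M x n (al m w)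
     = (\<Sum>j<J. smult M (of_int m gchoose j) (sq_mode M (al (int j) x) (m + n - int j) w))"
    using sq_commutator[OF weight_one, of x] by blast
  have R: "al (int j) x = 0" if "j > R" for j
    by (rule sq.A_vanish[OF assms(1)]) (use assms(2) that in auto)
  show ?thesis unfolding eq
    by (rule sum.mono_neutral_cong) (auto simp: J R sq_zero not_less not_le)
qed

text \<open>Derived on monomials from the commutator of L[n] with a[m] and from L[n] killing the
  vacuum, which accounts for the range of n.\<close>

lemma sqL_E: "v \<in> sq.E k \<Longrightarrow> n \<ge> -1 \<Longrightarrow> sqL n v \<in> sq.E (k - n)"
  unfolding sq.E_eq_span
proof (induction rule: span_induct_alt)
  case base
  then show ?case by (simp add: span_zero)
next
  case (step c x y)
  have "sqL n (sq.cre M) \<in> sq.E (msum M - n)" for M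
  proof (induction M)
    case empty
    then show ?case using step by (simp add: sqL_vac subspace_0[OF sq.gr.subspace_eig])
  next
    case (add m M)
    have 1: "al (- int m) (sqL n (sq.cre M)) \<in> sq.E (int m + msum M - n)"
      using sq.A_E_minus[OF add, of "int m"] by (simp add: algebra_simps)
    have 2: "al (- int m + n) (sq.cre M) \<in> sq.E (int m + msum M - n)"
      using sq.A_E[OF sq.cre_E, of "- int m + n" M] by (simp add: algebra_simps)
    show ?case using 1 2 unfolding sq.cre_add sqL_al
      by (auto intro!: subspace_diff[OF sq.gr.subspace_eig] subspace_add[OF sq.gr.subspace_eig] subspace_scale[OF sq.gr.subspace_eig])
  qed
  then show ?case using step unfolding sq.E_eq_span[symmetric]
    by (auto simp: sqL_add sqL_scale partitions_def intro!: subspace_add[OF sq.gr.subspace_eig] subspace_scale[OF sq.gr.subspace_eig])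
qed

section \<open>Adjoint modes\<close>

abbreviation L1 :: "'v \<Rightarrow> 'v" where "L1 \<equiv> sqL 1"

lemma L1_pow_E: "v \<in> sq.E k \<Longrightarrow> (L1 ^^ i) v \<in> sq.E (k - int i)"
proof (induction i)
  case (Suc i)
  then show ?case using sqL_E[of "(L1 ^^ i) v" "k - int i" 1] by (simp add: algebra_simps)
qed simp

lemma L1_pow_linear: "Vector_Spaces.linear (smult M) (smult M) (L1 ^^ i)"
  by (rule linI; induction i) (simp_all add: sqL_add sqL_scale)

definition L1_div :: "nat \<Rightarrow> 'v \<Rightarrow> 'v" where "L1_div i v = smult M (1 / fact i) ((L1 ^^ i) v)"

lemma L1_div_linear: "Vector_Spaces.linear (smult M) (smult M) (L1_div i)"
  unfolding L1_div_def
  by (rule linI) (simp_all add: lin_add[OF L1_pow_linear] lin_scale[OF L1_pow_linear] scale_right_distrib)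

lemma L1_div_E: "v \<in> sq.E k \<Longrightarrow> L1_div i v \<in> sq.E (k - int i)"
  unfolding L1_div_def by (intro subspace_scale[OF sq.gr.subspace_eig] L1_pow_E)

lemma L1_div_Suc: "L1 (L1_div i v) = smult M (of_nat (Suc i)) (L1_div (Suc i) v)"
  by (simp add: L1_div_def sqL_scale field_simps del: of_nat_Suc)

text \<open>Coefficientwise, e^(zL[1]) a[j] e^(-zL[1]) is the sum over l of (-j gchoose l) z^l
  a[j+l], because the commutator of L[1] with a[j] is - j a[j+1].\<close>

lemma L1_div_al: "L1_div i (al j v) = (\<Sum>l\<le>i. smult M (- of_int j gchoose l) (al (j + int l) (L1_div (i - l) v)))"
proof (induction i)
  case 0
  then show ?case by (simp add: L1_div_def)
next
  case (Suc i)
  define X where "X l = al (j + int l) (L1_div (Suc i - l) v)" for l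
  have "smult M (of_nat (Suc i)) (L1_div (Suc i) (al j v)) = L1 (L1_div i (al j v))" by (rule L1_div_Suc[symmetric])
  also have "\<dots> = (\<Sum>l\<le>i. smult M ((- of_int j gchoose l) * of_nat (Suc i - l)) (X l)
      + smult M ((- of_int j gchoose l) * (- of_int (j + int l))) (X (Suc l)))"
    unfolding Suc sqL_sum
  proof (intro sum.cong refl)
    fix l assume l: "l \<in> {..i}"
    have e: "Suc (i - l) = Suc i - l" using l by auto
    have "L1 (al (j + int l) (L1_div (i - l) v)) = al (j + int l) (smult M (of_nat (Suc i - l)) (L1_div (Suc i - l) v))
        - smult M (of_int (j + int l)) (al (j + int l + 1) (L1_div (i - l) v))"
      unfolding sqL_al L1_div_Suc e ..
    also have "\<dots> = smult M (of_nat (Suc i - l)) (X l) - smult M (of_int (j + int l)) (X (Suc l))"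
      by (simp add: X_def sq_scale add_ac)
    finally show "L1 (smult M (- of_int j gchoose l) (al (j + int l) (L1_div (i - l) v)))
      = smult M ((- of_int j gchoose l) * of_nat (Suc i - l)) (X l)
      + smult M ((- of_int j gchoose l) * (- of_int (j + int l))) (X (Suc l))"
      unfolding sqL_scale scale_right_diff_distrib scale_scale mult_minus_right scale_minus_left
      by (simp add: scale_right_diff_distrib)
  qed
  also have "\<dots> = (\<Sum>l\<le>Suc i. smult M ((- of_int j gchoose l) * of_nat (Suc i - l)) (X l))
      + (\<Sum>l\<le>Suc i. smult M (of_nat l * (- of_int j gchoose l)) (X l))"
  proof -
    have "(- of_int j gchoose l) * (- of_int (j + int l)) = of_nat (Suc l) * (- of_int j gchoose Suc l :: complex)" for l
      using gbinomial_absorb_comp[of "- of_int j :: complex" l] gbinomial_absorption[of l "- of_int j :: complex"]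
      by (simp add: algebra_simps)
    then have "(\<Sum>l\<le>i. smult M ((- of_int j gchoose l) * (- of_int (j + int l))) (X (Suc l)))
       = (\<Sum>l\<le>Suc i. smult M (of_nat l * (- of_int j gchoose l)) (X l))"
      by (subst sum.atMost_Suc_shift) simp
    moreover have "(\<Sum>l\<le>i. smult M ((- of_int j gchoose l) * of_nat (Suc i - l)) (X l))
       = (\<Sum>l\<le>Suc i. smult M ((- of_int j gchoose l) * of_nat (Suc i - l)) (X l))" by simp
    ultimately show ?thesis by (simp only: sum.distrib)
  qed
  also have "\<dots> = (\<Sum>l\<le>Suc i. smult M (of_nat (Suc i)) (smult M (- of_int j gchoose l) (X l)))"
    unfolding sum.distrib[symmetric]
    by (intro sum.cong refl) (simp add: of_nat_diff algebra_simps flip: scale_left_distrib)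
  also have "\<dots> = smult M (of_nat (Suc i)) (\<Sum>l\<le>Suc i. smult M (- of_int j gchoose l) (X l))"
    by (rule scale_sum_right[symmetric])
  finally show ?case unfolding X_def by (simp del: of_nat_Suc sum.atMost_Suc)
qed

lemma L1_div_0 [simp]: "L1_div 0 v = v" by (simp add: L1_div_def)

text \<open>The mode adjoint to \<open>v[n]\<close>: the coefficient of \<open>z\<^bsup>-n-1\<^esup>\<close> in \<open>Y[e\<^bsup>zL[1]\<^esup> (-z\<^sup>-\<^sup>2)\<^bsup>L[0]\<^esup> v, z\<^sup>-\<^sup>1] c\<close>.\<close>

definition adj :: "int \<Rightarrow> 'v \<Rightarrow> int \<Rightarrow> 'v \<Rightarrow> 'v" where
  "adj k v n c = smult M ((-1) powi k) (\<Sum>i\<le>nat k. sq_mode M (L1_div i v) (2 * k - n - int i - 2) c)"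

lemma adj_superset:
  assumes "v \<in> sq.E k" "k \<le> int R"
  shows "adj k v n c = smult M ((-1) powi k) (\<Sum>i\<le>R. sq_mode M (L1_div i v) (2 * k - n - int i - 2) c)"
proof -
  have "L1_div i v = 0" if "i > nat k" for i
    using L1_div_E[OF assms(1), of i] sq.E_neg[of "k - int i"] that by auto
  then have "(\<Sum>i\<le>nat k. sq_mode M (L1_div i v) (2 * k - n - int i - 2) c) = (\<Sum>i\<le>R. sq_mode M (L1_div i v) (2 * k - n - int i - 2) c)"
    by (intro sum.mono_neutral_left) (use assms(2) in \<open>auto simp: sq_zero\<close>)
  then show ?thesis by (simp add: adj_def)
qed

text \<open>The adjoint modes commute with a[-m] as v[n] does with a[m], which is what invariance of
  \<open>sq.form\<close> demands. Both sides are combinations of the vectors X I J; on the right the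
  coefficient for J is the sum over j of (-1)^j (m gchoose j)(-j gchoose (J - j)), produced by
  moving e^(zL[1]) past a[j].\<close>

lemma adj_commutator:
  assumes v: "v \<in> sq.E k" and R: "k \<le> int R"
  shows "al (- m) (adj k v n c) - adj k v n (al (- m) c)
    = (\<Sum>j\<le>R. smult M (of_int m gchoose j) (adj (k - int j) (al (int j) v) (m + n - int j) c))"
proof -
  define X where "X I J = sq_mode M (al (int J) (L1_div I v)) (2 * k - n - m - int I - int J - 2) c" for I J
  have X0: "X I J = 0" if "I + J > R" for I J
  proof -
    have "al (int J) (L1_div I v) \<in> sq.E (k - int I - int J)" by (intro sq.A_E L1_div_E v)
    then have "al (int J) (L1_div I v) = 0" using sq.E_neg[of "k - int I - int J"] that R by auto
    then show ?thesis by (simp add: X_def sq_zero)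
  qed
  have "al (- m) (adj k v n c) - adj k v n (al (- m) c)
     = smult M ((-1) powi k) (\<Sum>i\<le>R. al (- m) (sq_mode M (L1_div i v) (2 * k - n - int i - 2) c) - sq_mode M (L1_div i v) (2 * k - n - int i - 2) (al (- m) c))"
    unfolding adj_superset[OF v R] by (simp add: sq_scale sq_sum sum_subtractf scale_right_diff_distrib)
  also have "\<dots> = smult M ((-1) powi k) (\<Sum>i\<le>R. \<Sum>j\<le>R. smult M (- of_int m gchoose j) (X i j))"
  proof (intro arg_cong[where f = "smult M _"] sum.cong refl)
    fix i
    have "al (- m) (sq_mode M (L1_div i v) (2 * k - n - int i - 2) c) - sq_mode M (L1_div i v) (2 * k - n - int i - 2) (al (- m) c)
      = (\<Sum>j\<le>R. smult M (of_int (- m) gchoose j) (sq_mode M (al (int j) (L1_div i v)) (- m + (2 * k - n - int i - 2) - int j) c))"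
      by (rule sq_commutator'[OF L1_div_E[OF v]]) (use R in auto)
    also have "\<dots> = (\<Sum>j\<le>R. smult M (- of_int m gchoose j) (X i j))"
      by (simp add: X_def algebra_simps)
    finally show "al (- m) (sq_mode M (L1_div i v) (2 * k - n - int i - 2) c) - sq_mode M (L1_div i v) (2 * k - n - int i - 2) (al (- m) c) = \<dots>" .
  qed
  also have "\<dots> = smult M ((-1) powi k) (\<Sum>J\<le>R. \<Sum>I\<le>R. smult M (- of_int m gchoose J) (X I J))"
    by (subst sum.swap) simp
  \<comment> \<open>\<open>gbinomial_neg_vandermonde\<close> splits the coefficient (-m gchoose J)
    into these contributions.\<close>
  also have "\<dots> = smult M ((-1) powi k) (\<Sum>J\<le>R. \<Sum>j\<le>J. smult M ((-1) ^ j * (of_int m gchoose j) * (- of_nat j gchoose (J - j))) (\<Sum>I\<le>R. X I J))"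
  proof (rule arg_cong[where f = "smult M _"], rule sum.cong[OF refl])
    fix J
    have "(- of_int m gchoose J :: complex) = (\<Sum>j\<le>J. (-1) ^ j * (of_int m gchoose j) * (- of_nat j gchoose (J - j)))"
      by (rule gbinomial_neg_vandermonde[symmetric])
    then show "(\<Sum>I\<le>R. smult M (- of_int m gchoose J) (X I J))
      = (\<Sum>j\<le>J. smult M ((-1) ^ j * (of_int m gchoose j) * (- of_nat j gchoose (J - j))) (\<Sum>I\<le>R. X I J))"
      unfolding scale_sum_right[symmetric] scale_sum_left[symmetric] by (simp only:)
  qed
  also have "\<dots> = smult M ((-1) powi k) (\<Sum>J\<le>R. \<Sum>j\<le>J. (\<lambda>j l. smult M ((-1) ^ j * (of_int m gchoose j) * (- of_nat j gchoose l)) (\<Sum>I\<le>R. X I (j + l))) j (J - j))"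
    by (intro arg_cong[where f = "smult M _"] sum.cong refl) auto
  also have "\<dots> = smult M ((-1) powi k) (\<Sum>j\<le>R. \<Sum>l\<le>R. smult M ((-1) ^ j * (of_int m gchoose j) * (- of_nat j gchoose l)) (\<Sum>I\<le>R. X I (j + l)))"
    by (subst sum_triangle_square) (auto simp: X0)
  also have "\<dots> = (\<Sum>j\<le>R. smult M (of_int m gchoose j) (smult M ((-1) powi (k - int j)) (\<Sum>l\<le>R. \<Sum>I\<le>R. smult M (- of_nat j gchoose l) (X I (j + l)))))"
  proof (unfold scale_sum_right[of "(-1) powi k"], intro sum.cong refl)
    fix j
    have "(-1 :: complex) powi k * (-1) ^ j = (-1) powi (k - int j)"
      by (simp add: power_int_diff power_int_minus field_simps flip: power_mult_distrib)
    then have e: "(-1) powi k * ((-1) ^ j * (of_int m gchoose j) * x) = (of_int m gchoose j) * ((-1) powi (k - int j) * x)" for x :: complex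
      by (metis mult.assoc mult.commute)
    show "(\<Sum>l\<le>R. smult M ((-1) powi k) (smult M ((-1) ^ j * (of_int m gchoose j) * (- of_nat j gchoose l)) (\<Sum>I\<le>R. X I (j + l))))
      = smult M (of_int m gchoose j) (smult M ((-1) powi (k - int j)) (\<Sum>l\<le>R. \<Sum>I\<le>R. smult M (- of_nat j gchoose l) (X I (j + l))))"
      unfolding scale_scale e by (simp only: scale_sum_right scale_scale mult.assoc)
  qed
  also have "\<dots> = (\<Sum>j\<le>R. smult M (of_int m gchoose j) (adj (k - int j) (al (int j) v) (m + n - int j) c))"
  proof (intro sum.cong refl arg_cong[where f = "smult M _"])
    fix j
    have "(\<Sum>i\<le>R. sq_mode M (L1_div i (al (int j) v)) (2 * (k - int j) - (m + n - int j) - int i - 2) c)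
      = (\<Sum>i\<le>R. \<Sum>l\<le>i. (\<lambda>l I. smult M (- of_nat j gchoose l) (X I (j + l))) l (i - l))"
    proof (intro sum.cong refl)
      fix i
      have "sq_mode M (L1_div i (al (int j) v)) (2 * (k - int j) - (m + n - int j) - int i - 2) c
       = (\<Sum>l\<le>i. smult M (- of_nat j gchoose l) (sq_mode M (al (int j + int l) (L1_div (i - l) v)) (2 * (k - int j) - (m + n - int j) - int i - 2) c))"
        unfolding L1_div_al sq_sum sq_scale by simp
      also have "\<dots> = (\<Sum>l\<le>i. smult M (- of_nat j gchoose l) (X (i - l) (j + l)))"
      proof (intro sum.cong refl arg_cong[where f = "smult M _"])
        fix l assume "l \<in> {..i}"
        then have "int (j + l) = int j + int l"
          "2 * (k - int j) - (m + n - int j) - int i - 2 = 2 * k - n - m - int (i - l) - int (j + l) - 2" by auto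
        then show "sq_mode M (al (int j + int l) (L1_div (i - l) v)) (2 * (k - int j) - (m + n - int j) - int i - 2) c = X (i - l) (j + l)"
          unfolding X_def by (simp only:)
      qed
      finally show "sq_mode M (L1_div i (al (int j) v)) (2 * (k - int j) - (m + n - int j) - int i - 2) c
       = (\<Sum>l\<le>i. (\<lambda>l I. smult M (- of_nat j gchoose l) (X I (j + l))) l (i - l))" by simp
    qed
    also have "\<dots> = (\<Sum>l\<le>R. \<Sum>I\<le>R. smult M (- of_nat j gchoose l) (X I (j + l)))"
      by (subst sum_triangle_square) (auto simp: X0)
    finally have *: "(\<Sum>i\<le>R. sq_mode M (L1_div i (al (int j) v)) (2 * (k - int j) - (m + n - int j) - int i - 2) c) = \<dots>" .
    have "adj (k - int j) (al (int j) v) (m + n - int j) c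
      = smult M ((-1) powi (k - int j)) (\<Sum>i\<le>R. sq_mode M (L1_div i (al (int j) v)) (2 * (k - int j) - (m + n - int j) - int i - 2) c)"
      by (rule adj_superset[OF sq.A_E[OF v]]) (use R in auto)
    then show "smult M ((-1) powi (k - int j)) (\<Sum>l\<le>R. \<Sum>I\<le>R. smult M (- of_nat j gchoose l) (X I (j + l)))
      = adj (k - int j) (al (int j) v) (m + n - int j) c" unfolding * ..
  qed
  finally show ?thesis .
qed

section \<open>Translation and the vacuum case of invariance\<close>

lemma sqL_minus1: "sqL (-1) w = vir M (-1) w + vir M 0 w"
proof -
  obtain T where T: "\<And>n. n \<ge> T \<Longrightarrow> mode M (conf M) n w = 0" using truncation'[of "conf M" w] by blast
  have "sqL (-1) w = smeared M (conf M) (sq_series 2 0) w" by (simp add: sqL_eq sq_mode_weight[OF conf_weight])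
  also have "sq_series 2 0 = 1 + fls_X" by (simp add: sq_series_def X_plus_1_def)
  also have "smeared M (conf M) (1 + fls_X) w = (\<Sum>n\<in>{0..<max T 2}. smult M (fls_nth (1 + fls_X) n) (mode M (conf M) n w))"
    by (rule smeared_eq) (use T in auto)
  also have "\<dots> = (\<Sum>n\<in>{0,1}. smult M (fls_nth (1 + fls_X) n) (mode M (conf M) n w))"
    by (rule sum.mono_neutral_right) auto
  finally show ?thesis by (simp add: vir_def)
qed

text \<open>Translation covariance on the vacuum: L[-1] = L(-1) + L(0) acts on the smearing series
  by \<open>sq_series_rec\<close>.\<close>

lemma sqL_minus1_creation: "sqL (-1) (sq_mode M v n (vac M)) = smult M (- of_int n) (sq_mode M v (n - 1) (vac M))"
proof (induction v rule: gr.eig_induct)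
  case (add x y)
  then show ?case by (simp add: sq_add sqL_add scale_right_distrib)
next
  case (eig k v)
  define S where "S = fls_nth (sq_series k n)"
  \<comment> \<open>Low enough for the series of both n and n - 1.\<close>
  define lo where "lo = min n 0 - 1"
  have smeared: "smeared M v (sq_series k n') (vac M) = (\<Sum>N\<in>{lo..<0}. smult M (fls_nth (sq_series k n') N) (mode M v N (vac M)))" if "n' \<ge> lo" for n'
    by (rule smeared_eq) (use that in \<open>auto simp: creation_nonneg intro: sq_series_nth_0\<close>)
  have t: "vir M (-1) (mode M v N (vac M)) = smult M (- of_int N) (mode M v (N - 1) (vac M))" for N
  proof -
    obtain J where J: "\<And>n. n \<ge> J \<Longrightarrow> mode M (conf M) n v = 0" using truncation'[of "conf M" v] by blast
    have "mode M (conf M) 0 (mode M v N (vac M)) - mode M v N (mode M (conf M) 0 (vac M))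
       = (\<Sum>j<Suc (nat J). smult M (of_int 0 gchoose j) (mode M (mode M (conf M) (int j) v) (0 + N - int j) (vac M)))"
      by (rule commutator) (use J in auto)
    also have "\<dots> = (\<Sum>j\<in>{0}. smult M (of_int 0 gchoose j) (mode M (mode M (conf M) (int j) v) (0 + N - int j) (vac M)))"
      by (rule sum.mono_neutral_right) (auto simp: gbinomial_0(2) gr0_conv_Suc)
    also have "\<dots> = mode M (vir M (-1) v) N (vac M)" by (simp add: vir_def)
    finally show ?thesis by (simp add: vir_def[of M "-1"] creation_nonneg) (simp flip: vir_def[of M "-1", simplified] add: translation)
  qed
  have w: "vir M 0 (mode M v N (vac M)) = smult M (of_int (k - N - 1)) (mode M v N (vac M))" for N
    using weight_mode[OF eig round.vac_E, of N] by (simp add: weight_space_def)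
  have lin: "vir M i (sum g A) = (\<Sum>x\<in>A. vir M i (g x))" "vir M i (smult M c x) = smult M c (vir M i x)" for i g and A :: "int set" and c x
    unfolding vir_def by (rule mode_sum_right, rule mode_scale_right)
  have "sqL (-1) (sq_mode M v n (vac M)) = (\<Sum>N\<in>{lo..<0}. smult M (S N) (smult M (- of_int N) (mode M v (N - 1) (vac M))))
     + (\<Sum>N\<in>{lo..<0}. smult M (S N) (smult M (of_int (k - N - 1)) (mode M v N (vac M))))"
    unfolding sqL_minus1 sq_mode_weight[OF eig] by (subst (1 2) smeared) (auto simp: lo_def lin t w S_def)
  also have "(\<Sum>N\<in>{lo..<0}. smult M (S N) (smult M (- of_int N) (mode M v (N - 1) (vac M))))
    = (\<Sum>N\<in>{lo-1..<-1}. smult M (S (N + 1)) (smult M (- of_int (N + 1)) (mode M v N (vac M))))"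
    by (rule sum.reindex_bij_witness[of _ "\<lambda>N. N + 1" "\<lambda>N. N - 1"]) auto
  \<comment> \<open>The ranges differ in two boundary terms: at lo - 1 the series vanishes, at -1
    the factor N + 1 does.\<close>
  also have "\<dots> = (\<Sum>N\<in>{lo..<0}. smult M (S (N + 1)) (smult M (- of_int (N + 1)) (mode M v N (vac M))))"
  proof (rule sum.mono_neutral_cong)
    fix N assume "N \<in> {lo - 1..<- 1} - {lo..<0}"
    then have "N = lo - 1" by auto
    then have "S (N + 1) = 0" unfolding S_def by (intro sq_series_nth_0) (auto simp: lo_def)
    then show "smult M (S (N + 1)) (smult M (- of_int (N + 1)) (mode M v N (vac M))) = 0" by simp
  next
    fix N assume "N \<in> {lo..<0} - {lo - 1..<- 1}"
    then have "N = -1" by auto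
    then show "smult M (S (N + 1)) (smult M (- of_int (N + 1)) (mode M v N (vac M))) = 0" by simp
  qed auto
  also have "\<dots> + (\<Sum>N\<in>{lo..<0}. smult M (S N) (smult M (of_int (k - N - 1)) (mode M v N (vac M))))
    = (\<Sum>N\<in>{lo..<0}. smult M (- of_int n * fls_nth (sq_series k (n - 1)) N) (mode M v N (vac M)))"
    unfolding sum.distrib[symmetric] scale_scale scale_left_distrib[symmetric]
  proof (intro sum.cong refl arg_cong[where f = "\<lambda>c. smult M c _"])
    fix N
    show "S (N + 1) * - of_int (N + 1) + S N * of_int (k - N - 1) = - of_int n * fls_nth (sq_series k (n - 1)) N"
      using sq_series_rec[of n k N] by (simp add: S_def algebra_simps)
  qed
  also have "\<dots> = smult M (- of_int n) (smeared M v (sq_series k (n - 1)) (vac M))"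
    by (subst smeared) (auto simp: lo_def scale_sum_right)
  finally show ?case unfolding sq_mode_weight[OF eig] .
qed

lemma sq_creation: "sq_mode M v (-1) (vac M) = v"
proof (induction v rule: gr.eig_induct)
  case (add x y)
  then show ?case by (simp add: sq_add)
next
  case (eig k v)
  have "smeared M v (sq_series k (-1)) (vac M) = (\<Sum>N\<in>{-1..<0}. smult M (fls_nth (sq_series k (-1)) N) (mode M v N (vac M)))"
    by (rule smeared_eq) (auto simp: creation_nonneg intro: sq_series_nth_0)
  also have "{-1..<0::int} = {-1}" by auto
  also have "fls_nth (sq_series k (-1)) (-1) = sq_coeff k (-1) (-1)" by (simp add: sq_coeff_eq)
  then have "(\<Sum>N\<in>{-1}. smult M (fls_nth (sq_series k (-1)) N) (mode M v N (vac M))) = v"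
    by (simp add: sq_coeff_def creation)
  finally show ?case by (simp add: sq_mode_weight[OF eig])
qed

lemma vev_sqL_minus1: "sq.vev (sqL (-1) v) = 0"
proof (induction v rule: sq.gr.eig_induct)
  case (add x y)
  then show ?case by (simp add: sqL_add sq.vev_add)
next
  case (eig k v)
  have *: "sqL (-1) v \<in> sq.E (k + 1)" using sqL_E[OF eig, of "-1"] by simp
  show ?case
  proof (cases "k = -1")
    case True
    then have "v = 0" using eig sq.E_neg[of "-1"] by auto
    then show ?thesis by simp
  qed (use * sq.vev_E in auto)
qed

text \<open>For n <= -2 the vector v[n] applied to the vacuum is a multiple of L[-1] of the one for
  n + 1, and the image of L[-1] has no vacuum component.\<close>

lemma vev_creation: "sq.vev (sq_mode M v n (vac M)) = (if n = -1 then sq.vev v else 0)"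
proof -
  consider "n \<ge> 0" | "n = -1" | "n \<le> -2" by linarith
  then show ?thesis
  proof cases
    case 3
    have "of_int (n + 1) * sq.vev (sq_mode M v n (vac M)) = - sq.vev (sqL (-1) (sq_mode M v (n + 1) (vac M)))"
      unfolding sqL_minus1_creation sq.vev_scale by (simp add: algebra_simps)
    then have "of_int (n + 1) * sq.vev (sq_mode M v n (vac M)) = 0" by (simp only: vev_sqL_minus1 minus_zero)
    moreover have "(of_int (n + 1) :: complex) \<noteq> 0" using 3 by (subst of_int_eq_0_iff) auto
    ultimately show ?thesis using 3 by (simp del: of_int_add)
  qed (auto simp: sq_creation_nonneg sq_creation)
qed

lemma form_vac_left: "sq.form (vac M) y = sq.vev y"
  using sq.form_cre[of "{#}" y] by (simp add: sq.form_sym sq.fock_coeff_def)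

text \<open>Weight one is spanned by a[-1] on the vacuum, which L[1] sends to a[0] on the vacuum,
  that is, to 0. The existence of an invariant form with vacuum of norm one rests on this.\<close>

lemma L1_E1: "v \<in> sq.E 1 \<Longrightarrow> L1 v = 0"
proof -
  have "partitions 1 = {{#1#}}"
  proof safe
    fix N assume N: "N \<in> partitions 1"
    show "N = {#1#}"
    proof (cases N)
      case (add m N')
      then have "m = 1" "msum N' = 0" using N msum_nonneg[of N'] by (auto simp: partitions_def)
      then show ?thesis using add N msum_nonneg by (cases N') (auto simp: partitions_def add_nonneg_eq_0_iff)
    qed (use N in \<open>auto simp: partitions_def\<close>)
  qed (auto simp: partitions_def)
  moreover assume "v \<in> sq.E 1"
  ultimately obtain c where "v = smult M c (sq.cre {#1#})"
    using sq.E_expand[of v 1] by auto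
  moreover have "L1 (sq.cre {#1#}) = 0"
    using sqL_al[of 1 "-1" "vac M"] by (simp add: sq.cre_add sqL_vac sq_zero)
  ultimately show ?thesis by (simp add: sqL_scale)
qed

lemma L1_div_top: "v \<in> sq.E (int (Suc k)) \<Longrightarrow> L1_div (Suc k) v = 0"
proof -
  assume "v \<in> sq.E (int (Suc k))"
  then have "(L1 ^^ k) v \<in> sq.E 1" using L1_pow_E[of v "int (Suc k)" k] by simp
  then show ?thesis using L1_E1 by (simp add: L1_div_def)
qed

text \<open>Only the descendant of v of weight zero under powers of L[1] could contribute, and it
  vanishes by \<open>L1_div_top\<close>.\<close>

lemma vev_adj_vac:
  assumes v: "v \<in> sq.E k" and "k > 0"
  shows "sq.vev (adj k v n (vac M)) = 0"
proof -
  have "sq.vev (L1_div i v) = 0" for i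
  proof (cases "k = int i")
    case True
    then obtain k' where "i = Suc k'" using assms(2) by (cases i) auto
    then show ?thesis using L1_div_top v True by simp
  qed (use sq.vev_E[OF L1_div_E[OF v]] in auto)
  then have "sq.vev (sq_mode M (L1_div i v) N (vac M)) = 0" for i N by (simp add: vev_creation)
  moreover have "sq.vev (sum g I) = (\<Sum>i\<in>I. sq.vev (g i))" for g and I :: "nat set"
    by (induction I rule: infinite_finite_induct) (auto simp: sq.vev_add)
  ultimately show ?thesis by (simp add: adj_def sq.vev_scale)
qed

lemma form_diff_right: "sq.form x (y - z) = sq.form x y - sq.form x z"
  using sq.form_add_right[of x "y - z" z] by simp
lemma form_diff_left: "sq.form (y - z) x = sq.form y x - sq.form z x"
  using form_diff_right sq.form_sym by metis

lemma adj_add: "adj k (v + w) n c = adj k v n c + adj k w n c"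
  by (simp add: adj_def lin_add[OF L1_div_linear] sq_add sum.distrib scale_right_distrib)
lemma adj_scale: "adj k (smult M r v) n c = smult M r (adj k v n c)"
  by (simp add: adj_def lin_scale[OF L1_div_linear] sq_scale scale_left_commute flip: scale_sum_right)
lemma adj_zero [simp]: "adj k 0 n c = 0" using adj_scale[of k 0 0] by simp
lemma adj_add_right: "adj k v n (c + d) = adj k v n c + adj k v n d"
  by (simp add: adj_def sq_add sum.distrib scale_right_distrib)
lemma adj_scale_right: "adj k v n (smult M r c) = smult M r (adj k v n c)"
  by (simp add: adj_def sq_scale scale_left_commute flip: scale_sum_right)
lemma adj_zero_right [simp]: "adj k v n 0 = 0" using adj_scale_right[of k v n 0 0] by simp

text \<open>Commuting \<open>a[m]\<close> past \<open>v[n]\<close> and past its adjoint produces only states \<open>a[j]v\<close> with \<open>j \<ge> 0\<close>, that is, shorter Fock monomials; this drives the induction.\<close>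

lemma sq_form_invariant_cre:
  assumes "0 \<notin># N"
  shows "sq.form (sq_mode M (sq.cre N) n b) c = sq.form b (adj (msum N) (sq.cre N) n c)"
  using assms
proof (induction "size N" arbitrary: N n b c rule: less_induct)
  case less
  define v where "v = sq.cre N"
  define k where "k = msum N"
  define R where "R = nat k"
  have v: "v \<in> sq.E k" unfolding v_def k_def by (rule sq.cre_E)
  have R: "k \<le> int R" by (simp add: R_def)
  have IH: "sq.form (sq_mode M (al (int j) v) n b) c = sq.form b (adj (k - int j) (al (int j) v) n c)" for j n b c
  proof (cases "j \<in># N")
    case True
    then have "size (N - {#j#}) < size N" by (simp add: size_Diff1_less)
    moreover have "0 \<notin># N - {#j#}" using less.prems by (meson in_diffD)
    moreover have "msum (N - {#j#}) = k - int j"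
      using True unfolding k_def by (metis add_diff_cancel_left' insert_DiffM msum_add)
    ultimately have "sq.form (sq_mode M (sq.cre (N - {#j#})) n b) c = sq.form b (adj (k - int j) (sq.cre (N - {#j#})) n c)"
      using less.hyps[of "N - {#j#}"] by simp
    then show ?thesis by (simp add: v_def sq.A_cre_nat sq_scale adj_scale sq.form_scale_left sq.form_scale_right)
  next
    case False
    then have "al (int j) v = 0" by (simp add: v_def sq.A_cre_nat not_in_iff)
    then show ?thesis by (simp add: sq_zero)
  qed
  \<comment> \<open>The two commutators agree term by term, by the induction hypothesis for the
    shorter monomials a[j]v.\<close>
  have comm: "sq.form (al m (sq_mode M v n b) - sq_mode M v n (al m b)) c
     = sq.form b (al (- m) (adj k v n c) - adj k v n (al (- m) c))" for m n b c
    unfolding sq_commutator'[OF v R] adj_commutator[OF v R] sq.form_sum_left sq.form_sum_right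
      sq.form_scale_left sq.form_scale_right IH ..
  \<comment> \<open>For non-empty N both sides are vacuum expectation values that vanish.\<close>
  have base: "sq.form (sq_mode M v n (vac M)) (vac M) = sq.form (vac M) (adj k v n (vac M))" for n
  proof (cases "N = {#}")
    case True
    then show ?thesis by (simp add: v_def k_def adj_def sq_vac)
  next
    case False
    then obtain m N' where "N = add_mset m N'" by (meson multiset_cases)
    then have "k > 0" using less.prems msum_nonneg[of N'] by (simp add: k_def)
    then show ?thesis unfolding sq.form_sym[of _ "vac M"] form_vac_left
      using vev_adj_vac[OF v] sq.vev_E[OF v] by (simp add: vev_creation)
  qed
  \<comment> \<open>First slot the vacuum: creation operators are peeled off c.\<close>
  have vacl: "c \<in> {c. \<forall>n. sq.form (sq_mode M v n (vac M)) c = sq.form (vac M) (adj k v n c)}" for c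
  proof (rule sq_cyclic)
    show "subspace {c. \<forall>n. sq.form (sq_mode M v n (vac M)) c = sq.form (vac M) (adj k v n c)}"
      by (rule subspaceI) (auto simp: sq.form_add_right sq.form_scale_right adj_add_right adj_scale_right)
    show "vac M \<in> {c. \<forall>n. sq.form (sq_mode M v n (vac M)) c = sq.form (vac M) (adj k v n c)}" using base by simp
    fix m :: int and c assume m: "m > 0"
    show "al (- m) c \<in> {c. \<forall>n. sq.form (sq_mode M v n (vac M)) c = sq.form (vac M) (adj k v n c)}"
    proof safe
      fix n
      have z: "sq.form (vac M) (al (- m) x) = 0" for x
        using sq.form_A[of m "vac M" x] m by (simp add: sq_creation_nonneg)
      have "sq.form (sq_mode M v n (vac M)) (al (- m) c) = - sq.form (al m (sq_mode M v n (vac M))) c"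
        by (simp add: sq.form_A)
      also have "\<dots> = - sq.form (al m (sq_mode M v n (vac M)) - sq_mode M v n (al m (vac M))) c"
        using m by (simp add: sq_creation_nonneg sq_zero)
      also have "\<dots> = sq.form (vac M) (adj k v n (al (- m) c))"
        unfolding comm form_diff_right z by simp
      finally show "sq.form (sq_mode M v n (vac M)) (al (- m) c) = sq.form (vac M) (adj k v n (al (- m) c))" .
    qed
  qed
  \<comment> \<open>General first slot: creation operators are peeled off b and moved across the
    form.\<close>
  have "b \<in> {b. \<forall>n c. sq.form (sq_mode M v n b) c = sq.form b (adj k v n c)}"
  proof (rule sq_cyclic)
    show "subspace {b. \<forall>n c. sq.form (sq_mode M v n b) c = sq.form b (adj k v n c)}"
      by (rule subspaceI) (auto simp: sq_add sq_scale sq_zero sq.form_add_left sq.form_scale_left)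
    show "vac M \<in> {b. \<forall>n c. sq.form (sq_mode M v n b) c = sq.form b (adj k v n c)}" using vacl by simp
    fix m :: int and b assume b: "b \<in> {b. \<forall>n c. sq.form (sq_mode M v n b) c = sq.form b (adj k v n c)}"
    show "al (- m) b \<in> {b. \<forall>n c. sq.form (sq_mode M v n b) c = sq.form b (adj k v n c)}"
    proof safe
      fix n c
      have "sq.form (sq_mode M v n (al (- m) b)) c
        = sq.form (al (- m) (sq_mode M v n b)) c - sq.form (al (- m) (sq_mode M v n b) - sq_mode M v n (al (- m) b)) c"
        by (simp add: form_diff_left)
      also have "\<dots> = - sq.form (sq_mode M v n b) (al m c) - sq.form b (al m (adj k v n c) - adj k v n (al m c))"
        unfolding comm sq.form_A by simp
      also have "sq.form (sq_mode M v n b) (al m c) = sq.form b (adj k v n (al m c))" using b by simp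
      finally show "sq.form (sq_mode M v n (al (- m) b)) c = sq.form (al (- m) b) (adj k v n c)"
        by (simp add: form_diff_right sq.form_A)
    qed
  qed
  then show ?case by (simp add: v_def k_def)
qed

lemma sq_form_invariant:
  assumes "v \<in> sq.E k"
  shows "sq.form (sq_mode M v n b) c = sq.form b (adj k v n c)"
  using assms unfolding sq.E_eq_span
proof (induction rule: span_induct_alt)
  case (step r x y)
  then obtain N where "x = sq.cre N" "0 \<notin># N" "msum N = k" by (auto simp: partitions_def)
  then show ?case using step sq_form_invariant_cre[of N n b c]
    by (simp add: sq_add sq_scale adj_add adj_scale sq.form_add_left sq.form_add_right sq.form_scale_left sq.form_scale_right)
qed (simp add: sq_zero)

lemma form_linear: "Vector_Spaces.linear (smult M) (*) (\<lambda>y. sq.form x y)" "Vector_Spaces.linear (smult M) (*) (\<lambda>x. sq.form x y)"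
  by (rule lin_formI; simp add: sq.form_add_right sq.form_add_left sq.form_scale_right sq.form_scale_left)+

lemma form_adj:
  assumes "v \<in> sq.E k"
  shows "sq.form b (adj k v n c)
    = (-1) powi k * Sum_any (\<lambda>j::nat. sq.form b (sq_mode M ((sqL 1 ^^ j) v) (2 * k - n - int j - 2) c) / fact j)"
proof -
  have "Sum_any (\<lambda>j::nat. sq.form b (sq_mode M ((sqL 1 ^^ j) v) (2 * k - n - int j - 2) c) / fact j)
    = (\<Sum>j\<le>nat k. sq.form b (sq_mode M ((sqL 1 ^^ j) v) (2 * k - n - int j - 2) c) / fact j)"
  proof (rule Sum_any.expand_superset)
    have "(L1 ^^ j) v = 0" if "j > nat k" for j
      using L1_pow_E[OF assms, of j] sq.E_neg[of "k - int j"] that by auto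
    then have "sq.form b (sq_mode M ((sqL 1 ^^ j) v) (2 * k - n - int j - 2) c) / fact j = 0" if "j > nat k" for j
      using that by (simp add: sq_zero)
    then show "{j. sq.form b (sq_mode M ((sqL 1 ^^ j) v) (2 * k - n - int j - 2) c) / fact j \<noteq> 0} \<subseteq> {..nat k}"
      using not_less by auto
  qed simp
  also have "\<dots> = (\<Sum>j\<le>nat k. sq.form b (sq_mode M (L1_div j v) (2 * k - n - int j - 2) c))"
    by (simp add: L1_div_def sq_scale sq.form_scale_right)
  finally show ?thesis by (simp add: adj_def sq.form_scale_right sq.form_sum_right)
qed

lemma is_liz_sq_form: "is_liz_metric (square_bracket M) sq.form"
  unfolding is_liz_metric_def sq_E square_bracket_sel
  using form_linear sq.form_vac sq_form_invariant form_adj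
  by (auto simp: sqL_def)

text \<open>Uniqueness uses invariance for a alone: L[1]a = 0 reduces the adjoint of a[n] to -
  a[-n], and \<open>form_unique\<close> applies.\<close>

lemma liz_metric_sq: "liz_metric (square_bracket M) = sq.form"
  unfolding liz_metric_def
proof (rule the_equality)
  show "is_liz_metric (square_bracket M) sq.form" by (rule is_liz_sq_form)
  fix \<beta> assume b: "is_liz_metric (square_bracket M) \<beta>"
  show "\<beta> = sq.form"
  proof (rule sq.form_unique)
    have a: "a \<in> sq.E 1"
      using sq.cre_E[of "{#1#}"] by (simp add: sq.cre_add sq_creation)
    have L: "(L1 ^^ j) a = (if j = 0 then a else 0)" for j
      using L1_E1[OF a] by (induction j) auto
    show "\<beta> (al n x) y = - \<beta> x (al (- n) y)" for n x y
    proof -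
      have l: "\<And>x. Vector_Spaces.linear (smult M) (*) (\<lambda>y. \<beta> x y)" using b by (simp add: is_liz_metric_def)
      have "\<beta> (al n x) y = (-1) powi 1 * Sum_any (\<lambda>j::nat. \<beta> x (sq_mode M ((L1 ^^ j) a) (2 * 1 - n - int j - 2) y) / fact j)"
        using b a unfolding is_liz_metric_def sq_E square_bracket_sel sqL_def[symmetric] by blast
      also have "Sum_any (\<lambda>j::nat. \<beta> x (sq_mode M ((L1 ^^ j) a) (2 * 1 - n - int j - 2) y) / fact j)
        = Sum_any (\<lambda>j::nat. if j = 0 then \<beta> x (al (- n) y) else 0)"
        by (rule Sum_any.cong) (simp add: L sq_zero lin_zero[OF l])
      finally show ?thesis by simp
    qed
  qed (use b in \<open>simp_all add: is_liz_metric_def\<close>)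
qed

end

section \<open>Zhu recursion for one-point functions\<close>

lemma minus_one_power_cancel: "(-1 :: complex) ^ j * ((-1) ^ j * x) = x"
  by (cases "even j") auto

text \<open>The expansion of \<open>q\<^sup>n / (1 - q\<^sup>n)\<close>.\<close>

definition q_frac :: "nat \<Rightarrow> complex fps" where
  "q_frac n = Abs_fps (\<lambda>i. if i > 0 \<and> n dvd i then 1 else 0)"

lemma q_frac_eq:
  assumes "n > 0"
  shows "(1 - fps_X ^ n) * q_frac n = fps_X ^ n"
proof (rule fps_ext)
  fix i
  have *: "fps_nth ((1 - fps_X ^ n) * q_frac n) i = fps_nth (q_frac n) i - (if i < n then 0 else fps_nth (q_frac n) (i - n))"
    by (simp add: left_diff_distrib fps_X_power_mult_nth)
  show "fps_nth ((1 - fps_X ^ n) * q_frac n) i = fps_nth (fps_X ^ n) i"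
  proof (cases "i < n")
    case True
    then have "\<not> (i > 0 \<and> n dvd i)" using nat_dvd_not_less by blast
    then show ?thesis unfolding * using True by (simp add: q_frac_def)
  next
    case False
    then have "n dvd i - n \<longleftrightarrow> n dvd i" by (simp add: dvd_minus_self)
    then show ?thesis unfolding * using False assms by (cases "i = n") (auto simp: q_frac_def)
  qed
qed

text \<open>Cyclicity of the trace produces an equation of this shape, the factor X^n recording a
  shift of the weight by n.\<close>

lemma q_frac_solve:
  assumes n: "n > 0" and T: "T = fps_X ^ n * (T + P)"
  shows "T = q_frac n * P"
proof -
  have "1 - fps_X ^ n \<noteq> (0 :: complex fps)"
  proof
    assume eq: "1 - fps_X ^ n = (0 :: complex fps)"
    have "fps_nth (1 - fps_X ^ n :: complex fps) 0 = 1" using n by simp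
    then show False unfolding eq by simp
  qed
  moreover have "(1 - fps_X ^ n) * T = (1 - fps_X ^ n) * (q_frac n * P)"
  proof -
    have "T - fps_X ^ n * T = fps_X ^ n * (T + P) - fps_X ^ n * T"
      by (rule arg_cong[where f = "\<lambda>x. x - fps_X ^ n * T", OF T])
    also have "\<dots> = fps_X ^ n * P" by (simp only: distrib_left add_diff_cancel_left')
    finally have "(1 - fps_X ^ n) * T = fps_X ^ n * P" by (simp add: left_diff_distrib)
    also have "\<dots> = (1 - fps_X ^ n) * q_frac n * P" using q_frac_eq[OF n] by simp
    finally show ?thesis by (simp add: mult.assoc)
  qed
  ultimately show ?thesis by (simp only: mult_cancel_left) simp
qed

definition sigma_fps :: "nat \<Rightarrow> complex fps" where
  "sigma_fps r = Abs_fps (\<lambda>N. if N = 0 then 0 else of_nat (divisor_sum r N))"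

lemma q_frac_mult_nth_0: "N < n \<Longrightarrow> fps_nth (q_frac n * G) N = 0"
  unfolding fps_mult_nth by (rule sum.neutral) (auto simp: q_frac_def dest: dvd_imp_le)

text \<open>Lambert series: summing n^r q^n / (1 - q^n) over n gives the divisor sums, and only n <=
  N reaches the coefficient N.\<close>

lemma sum_q_frac:
  "(\<Sum>n=1..N. of_nat n ^ r * fps_nth (q_frac n * G) N) = fps_nth (sigma_fps r * G) N"
proof -
  have "(\<Sum>n=1..N. of_nat n ^ r * fps_nth (q_frac n) i) = fps_nth (sigma_fps r) i" if "i \<le> N" for i
  proof (cases "i = 0")
    case False
    have "(\<Sum>n=1..N. of_nat n ^ r * fps_nth (q_frac n) i) = (\<Sum>n\<in>{n\<in>{1..N}. n dvd i}. of_nat n ^ r)"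
      unfolding sum.inter_filter[OF finite_atLeastAtMost] using False by (intro sum.cong) (auto simp: q_frac_def)
    also have "{n\<in>{1..N}. n dvd i} = {d. d dvd i}"
      using that False by (auto dest: dvd_imp_le intro: Nat.gr0I simp: Suc_le_eq)
    finally show ?thesis using False by (simp add: sigma_fps_def divisor_sum_def)
  qed (simp add: q_frac_def sigma_fps_def)
  then have "fps_nth (sigma_fps r * G) N = (\<Sum>i=0..N. (\<Sum>n=1..N. of_nat n ^ r * fps_nth (q_frac n) i) * fps_nth G (N - i))"
    unfolding fps_mult_nth by (intro sum.cong) auto
  also have "\<dots> = (\<Sum>n=1..N. of_nat n ^ r * fps_nth (q_frac n * G) N)"
    unfolding fps_mult_nth sum_distrib_left sum_distrib_right by (subst sum.swap) (simp add: mult.assoc)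
  finally show ?thesis ..
qed

text \<open>The q-expansion of C(k,j,tau)/j for k, j > 0. The sign (-1)^(k-1) stems from the
  positive modes of a and (-1)^j from the negative ones; they cancel when k + j is odd.\<close>

definition C_fps :: "nat \<Rightarrow> nat \<Rightarrow> complex fps" where
  "C_fps k j = fps_const (bern_coeff k j)
     + fps_const (((-1) ^ (k - 1) - (-1) ^ j) / (fact (k - 1) * fact j)) * sigma_fps (k - 1 + j)"

context heisenberg_voa
begin

section \<open>Traces of products of a mode of a with a mode of v\<close>

abbreviation W :: "int \<Rightarrow> 'v set" where "W \<equiv> weight_space M"
abbreviation tr :: "int \<Rightarrow> ('v \<Rightarrow> 'v) \<Rightarrow> complex" where "tr N \<equiv> trace_on M (W N)"

lemmas W_subspace = subspace_weight_space

lemma mode_W: "v \<in> W d \<Longrightarrow> w \<in> W N \<Longrightarrow> mode M v (d - 1 + n) w \<in> W (N - n)"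
  using weight_mode[of v d w N "d - 1 + n"] by (simp add: algebra_simps)

lemma zero_mode_W: "w \<in> W N \<Longrightarrow> zero_mode M v w \<in> W N"
proof (induction v rule: gr.eig_induct)
  case (add x y)
  then show ?case by (simp add: lin_add[OF zero_mode_linear] subspace_add[OF W_subspace])
next
  case (eig k v)
  then show ?case using mode_W[OF eig, of 0] by (simp add: zero_mode_weight[OF eig(1)])
qed

definition wtrace :: "int \<Rightarrow> 'v \<Rightarrow> complex" where "wtrace N v = tr N (zero_mode M v)"

lemma wtrace_add: "wtrace N (v + w) = wtrace N v + wtrace N w"
proof -
  have "zero_mode M (v + w) = (\<lambda>x. zero_mode M v x + zero_mode M w x)"
    by (simp add: fun_eq_iff lin_add[OF zero_mode_linear])
  then show ?thesis unfolding wtrace_def by (simp add: trace_on_add[OF W_subspace] zero_mode_W)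
qed

lemma wtrace_scale: "wtrace N (smult M c v) = c * wtrace N v"
proof -
  have "zero_mode M (smult M c v) = (\<lambda>x. smult M c (zero_mode M v x))"
    by (simp add: fun_eq_iff lin_scale[OF zero_mode_linear])
  then show ?thesis unfolding wtrace_def by (simp add: trace_on_scale[OF W_subspace] zero_mode_W)
qed

lemma wtrace_neg: "N < 0 \<Longrightarrow> wtrace N v = 0"
  unfolding wtrace_def using round.E_neg[of N] by (simp add: trace_on_trivial)

definition one_pt :: "'v \<Rightarrow> complex fps" where "one_pt v = Abs_fps (\<lambda>N. wtrace (int N) v)"

lemma one_pt_add: "one_pt (v + w) = one_pt v + one_pt w"
  by (rule fps_ext) (simp add: one_pt_def wtrace_add)
lemma one_pt_scale: "one_pt (smult M c v) = fps_const c * one_pt v"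
  by (rule fps_ext) (simp add: one_pt_def wtrace_scale)
lemma one_pt_zero [simp]: "one_pt 0 = 0" using one_pt_scale[of 0 0] by simp
lemma one_pt_sum: "one_pt (sum f I) = (\<Sum>i\<in>I. one_pt (f i))"
  by (induction I rule: infinite_finite_induct) (auto simp: one_pt_add)

lemma W_finite_dim: "\<exists>F. finite F \<and> W N \<subseteq> span F" by (rule weight_finite_dim)

lemma trace_comm_W:
  assumes "\<And>w. w \<in> W N \<Longrightarrow> f w \<in> W N'" "\<And>w. w \<in> W N' \<Longrightarrow> g w \<in> W N"
    "Vector_Spaces.linear (smult M) (smult M) f" "Vector_Spaces.linear (smult M) (smult M) g"
  shows "tr N (\<lambda>w. g (f w)) = tr N' (\<lambda>w. f (g w))"
  by (rule trace_on_comm) (use assms W_subspace W_finite_dim in auto)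

lemma a_W: "w \<in> W N \<Longrightarrow> mode M a n w \<in> W (N - n)" by (rule round.A_E)

text \<open>For v of weight d, the trace series of the commutator of a(n) with v(d - 1 - n): its
  terms are zero modes of the states a(i)v.\<close>

definition P_fps :: "nat \<Rightarrow> 'v \<Rightarrow> int \<Rightarrow> complex fps" where
  "P_fps J v n = (\<Sum>i<J. fps_const (of_int n gchoose i) * one_pt (mode M a (int i) v))"

lemma trace_shift:
  assumes v: "v \<in> W d"
  shows "tr N (\<lambda>w. mode M a n (mode M v (d - 1 - n) w)) = tr (N + n) (\<lambda>w. mode M v (d - 1 - n) (mode M a n w))"
proof (rule trace_comm_W)
  show "mode M v (d - 1 - n) w \<in> W (N + n)" if "w \<in> W N" for w using mode_W[OF v that, of "- n"] by simp
  show "mode M a n w \<in> W N" if "w \<in> W (N + n)" for w using a_W[OF that, of n] by simp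
qed (rule mode_linear_right)+

lemma trace_commutator:
  assumes v: "v \<in> W d" and J: "\<And>i. i \<ge> J \<Longrightarrow> mode M a (int i) v = 0"
  shows "tr N (\<lambda>w. mode M a n (mode M v (d - 1 - n) w))
    = tr N (\<lambda>w. mode M v (d - 1 - n) (mode M a n w)) + (\<Sum>i<J. (of_int n gchoose i) * wtrace N (mode M a (int i) v))"
proof -
  have ai: "mode M a (int i) v \<in> W (d - int i)" for i using a_W[OF v] .
  have in1: "mode M v (d - 1 - n) (mode M a n w) \<in> W N" if "w \<in> W N" for w
    using mode_W[OF v a_W[OF that, of n], of "- n"] by simp
  have eq: "mode M a n (mode M v (d - 1 - n) w) = mode M v (d - 1 - n) (mode M a n w)
      + (\<Sum>i<J. smult M (of_int n gchoose i) (zero_mode M (mode M a (int i) v) w))" for w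
  proof -
    have "mode M a n (mode M v (d - 1 - n) w) - mode M v (d - 1 - n) (mode M a n w)
      = (\<Sum>i<J. smult M (of_int n gchoose i) (mode M (mode M a (int i) v) (n + (d - 1 - n) - int i) w))"
      by (rule commutator) (rule J)
    also have "\<dots> = (\<Sum>i<J. smult M (of_int n gchoose i) (zero_mode M (mode M a (int i) v) w))"
      by (intro sum.cong refl) (simp add: zero_mode_weight[OF ai] algebra_simps)
    finally show ?thesis by (simp add: algebra_simps)
  qed
  have "tr N (\<lambda>w. mode M a n (mode M v (d - 1 - n) w)) = tr N (\<lambda>w. mode M v (d - 1 - n) (mode M a n w))
      + tr N (\<lambda>w. \<Sum>i<J. smult M (of_int n gchoose i) (zero_mode M (mode M a (int i) v) w))"
    unfolding eq
    by (rule trace_on_add[OF W_subspace in1])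
      (auto intro!: subspace_sum[OF W_subspace] subspace_scale[OF W_subspace] zero_mode_W)
  also have "tr N (\<lambda>w. \<Sum>i<J. smult M (of_int n gchoose i) (zero_mode M (mode M a (int i) v) w))
      = (\<Sum>i<J. tr N (\<lambda>w. smult M (of_int n gchoose i) (zero_mode M (mode M a (int i) v) w)))"
    by (rule trace_on_sum[OF W_subspace]) (auto intro!: subspace_scale[OF W_subspace] zero_mode_W)
  also have "\<dots> = (\<Sum>i<J. (of_int n gchoose i) * wtrace N (mode M a (int i) v))"
    unfolding wtrace_def by (intro sum.cong refl trace_on_scale[OF W_subspace]) (rule zero_mode_W)
  finally show ?thesis .
qed

text \<open>Moving a(n) cyclically around the trace shifts the weight by n, giving the factor q^n,
  and restoring the order adds the commutator \<open>P_fps\<close>. On weights below n the operator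
  a(n) is zero.\<close>

lemma trace_pos:
  assumes v: "v \<in> W d" and J: "\<And>i. i \<ge> J \<Longrightarrow> mode M a (int i) v = 0" and n: "n > 0"
  shows "tr (int N) (\<lambda>w. mode M v (d - 1 - int n) (mode M a (int n) w)) = fps_nth (q_frac n * P_fps J v (int n)) N"
proof -
  define T where "T = Abs_fps (\<lambda>N. tr (int N) (\<lambda>w. mode M v (d - 1 - int n) (mode M a (int n) w)))"
  have "T = fps_X ^ n * (T + P_fps J v (int n))"
  proof (rule fps_ext)
    fix i
    show "fps_nth T i = fps_nth (fps_X ^ n * (T + P_fps J v (int n))) i"
    proof (cases "i < n")
      case True
      have "tr (int i) (\<lambda>w. mode M v (d - 1 - int n) (mode M a (int n) w)) = tr (int i) (\<lambda>w. 0)"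
        by (rule trace_on_cong[OF W_subspace]) (use True in \<open>simp add: round.A_vanish[of _ "int i"]\<close>)
      then show ?thesis using True by (simp add: T_def fps_X_power_mult_nth trace_on_0[OF W_subspace])
    next
      case False
      then have e: "int (i - n) + int n = int i" by simp
      have "fps_nth T i = tr (int (i - n)) (\<lambda>w. mode M a (int n) (mode M v (d - 1 - int n) w))"
        unfolding T_def fps_nth_Abs_fps using trace_shift[OF v, of "int (i - n)" "int n"] unfolding e by (rule sym)
      also have "\<dots> = fps_nth (T + P_fps J v (int n)) (i - n)"
        using trace_commutator[OF v J, where N = "int (i - n)" and n = "int n"] unfolding T_def P_fps_def
        by (simp add: fps_sum_nth one_pt_def del: of_nat_diff)
      finally show ?thesis using False by (simp add: fps_X_power_mult_nth)
    qed
  qed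
  from q_frac_solve[OF n this] show ?thesis by (simp add: T_def fps_eq_iff)
qed

text \<open>The same cycle with a(-n) in front; the commutator now enters with the opposite
  sign.\<close>

lemma trace_neg:
  assumes v: "v \<in> W d" and J: "\<And>i. i \<ge> J \<Longrightarrow> mode M a (int i) v = 0" and n: "n > 0"
  shows "tr (int N) (\<lambda>w. mode M a (- int n) (mode M v (d - 1 + int n) w)) = - fps_nth (q_frac n * P_fps J v (- int n)) N"
proof -
  define T where "T = Abs_fps (\<lambda>N. tr (int N) (\<lambda>w. mode M a (- int n) (mode M v (d - 1 + int n) w)))"
  have "T = fps_X ^ n * (T + (- P_fps J v (- int n)))"
  proof (rule fps_ext)
    fix i
    show "fps_nth T i = fps_nth (fps_X ^ n * (T + (- P_fps J v (- int n)))) i"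
    proof (cases "i < n")
      case True
      have "tr (int i) (\<lambda>w. mode M a (- int n) (mode M v (d - 1 + int n) w)) = tr (int i) (\<lambda>w. 0)"
      proof (rule trace_on_cong[OF W_subspace])
        fix w assume "w \<in> W (int i)"
        then have "mode M v (d - 1 + int n) w \<in> W (int i - int n)" by (rule mode_W[OF v])
        then have "mode M v (d - 1 + int n) w = 0" using round.E_neg[of "int i - int n"] True by auto
        then show "mode M a (- int n) (mode M v (d - 1 + int n) w) = 0" by simp
      qed
      then show ?thesis using True by (simp add: T_def fps_X_power_mult_nth trace_on_0[OF W_subspace])
    next
      case False
      then have e: "int i + - int n = int (i - n)" by simp
      have "fps_nth T i = tr (int (i - n)) (\<lambda>w. mode M v (d - 1 + int n) (mode M a (- int n) w))"
        unfolding T_def fps_nth_Abs_fps using trace_shift[OF v, of "int i" "- int n"]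
        unfolding e diff_minus_eq_add .
      also have "\<dots> = fps_nth (T + (- P_fps J v (- int n))) (i - n)"
        using trace_commutator[OF v J, where N = "int (i - n)" and n = "- int n"] unfolding T_def P_fps_def
        by (simp add: fps_sum_nth one_pt_def del: of_nat_diff)
      finally show ?thesis using False by (simp add: fps_X_power_mult_nth)
    qed
  qed
  from q_frac_solve[OF n this] have "T = - (q_frac n * P_fps J v (- int n))" by simp
  then show ?thesis by (simp add: T_def fps_eq_iff)
qed

lemma gbinomial_flip: "(-1) ^ j * (of_int (- 1 - int h) gchoose j :: complex) = of_nat ((h + j) choose h)"
proof -
  have "(of_int (- 1 - int h) gchoose j :: complex) = (- (of_nat h + 1) gchoose j)"
    by (rule arg_cong[where f = "\<lambda>x. x gchoose j"]) simp
  also have "\<dots> = (-1) ^ j * ((of_nat h + 1 + of_nat j - 1) gchoose j)" by (rule gbinomial_minus)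
  also have "of_nat h + 1 + of_nat j - 1 = (of_nat (h + j) :: complex)" by simp
  also have "(of_nat (h + j) gchoose j :: complex) = of_nat ((h + j) choose j)" by (rule binomial_gbinomial[symmetric])
  also have "(h + j) choose j = (h + j) choose h" by (metis add_diff_cancel_right' binomial_symmetric le_add2)
  finally show ?thesis by (simp only: minus_one_power_cancel)
qed

text \<open>The iterate formula writes the zero mode of a(-1-h)v in normal order: X has a creation
  operator on the left, Y a mode a(j) with j >= 0 on the right. Their traces are given by
  \<open>trace_neg\<close> and \<open>trace_pos\<close>.\<close>

lemma one_pt_a_neg:
  assumes v: "v \<in> W d" and J: "\<And>i. i \<ge> J \<Longrightarrow> mode M a (int i) v = 0"
  shows "fps_nth (one_pt (mode M a (- 1 - int h) v)) N
    = (\<Sum>n=1..N. (of_int (- int n - 1) gchoose h) * fps_nth (q_frac n * P_fps J v (int n)) N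
         - (of_int (int n - 1) gchoose h) * fps_nth (q_frac n * P_fps J v (- int n)) N)"
proof -
  define b where "b j = (of_nat ((h + j) choose h) :: complex)" for j
  define X where "X j w = mode M a (- int (h + 1 + j)) (mode M v (d - 1 + int (h + 1 + j)) w)" for j w
  define Y where "Y j w = mode M v (d - 1 - int j) (mode M a (int j) w)" for j w
  have XW: "X j w \<in> W (int N)" if "w \<in> W (int N)" for j w
    using a_W[OF mode_W[OF v that, of "int (h + 1 + j)"], of "- int (h + 1 + j)"] by (simp add: X_def)
  have YW: "Y j w \<in> W (int N)" if "w \<in> W (int N)" for j w
    using mode_W[OF v a_W[OF that, of "int j"], of "- int j"] by (simp add: Y_def)
  have av: "mode M a (- 1 - int h) v \<in> W (d + 1 + int h)" using a_W[OF v, of "- 1 - int h"] by (simp add: algebra_simps)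
  have "zero_mode M (mode M a (- 1 - int h) v) w = (\<Sum>j\<le>N. smult M (b j) (X j w) + smult M ((-1) ^ h * b j) (Y j w))"
    if w: "w \<in> W (int N)" for w
  proof -
    have X0: "X j w = 0" if "j > N" for j
    proof -
      have "mode M v (d - 1 + int (h + 1 + j)) w \<in> W (int N - int (h + 1 + j))" by (rule mode_W[OF v w])
      then have "mode M v (d - 1 + int (h + 1 + j)) w = 0" using round.E_neg[of "int N - int (h + 1 + j)"] that by auto
      then show ?thesis by (simp add: X_def)
    qed
    have Y0: "Y j w = 0" if "j > N" for j
      unfolding Y_def using round.A_vanish[OF w, of "int j"] that by simp
    have s: "(-1 :: complex) powi (- 1 - int h) = - ((-1) ^ h)"
      by (simp add: power_int_diff power_int_minus field_simps flip: power_mult_distrib)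
    have "zero_mode M (mode M a (- 1 - int h) v) w = mode M (mode M a (- 1 - int h) v) (d + int h) w"
      by (simp add: zero_mode_weight[OF av])
    also have "\<dots> = Sum_any (\<lambda>j. smult M (b j) (X j w) + smult M ((-1) ^ h * b j) (Y j w))"
      unfolding iterate_any
    proof (rule Sum_any.cong)
      fix j
      have e: "- 1 - int h - int j = - int (h + 1 + j)" "d + int h + int j = d - 1 + int (h + 1 + j)"
        "d + int h + (- 1 - int h) - int j = d - 1 - int j" by auto
      show "smult M ((- 1) ^ j * (of_int (- 1 - int h) gchoose j))
          (mode M a (- 1 - int h - int j) (mode M v (d + int h + int j) w) -
           smult M ((- 1) powi (- 1 - int h)) (mode M v (d + int h + (- 1 - int h) - int j) (mode M a (int j) w)))
        = smult M (b j) (X j w) + smult M ((-1) ^ h * b j) (Y j w)"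
        unfolding gbinomial_flip s e X_def[symmetric] Y_def[symmetric] b_def[symmetric]
        by (simp add: scale_right_distrib mult.commute)
    qed
    also have "\<dots> = (\<Sum>j\<le>N. smult M (b j) (X j w) + smult M ((-1) ^ h * b j) (Y j w))"
    proof (rule Sum_any.expand_superset)
      have "smult M (b j) (X j w) + smult M ((-1) ^ h * b j) (Y j w) = 0" if "\<not> j \<le> N" for j
        using X0 Y0 that by simp
      then show "{j. smult M (b j) (X j w) + smult M ((-1) ^ h * b j) (Y j w) \<noteq> 0} \<subseteq> {..N}" by auto
    qed simp
    finally show ?thesis .
  qed
  then have "fps_nth (one_pt (mode M a (- 1 - int h) v)) N = tr (int N) (\<lambda>w. \<Sum>j\<le>N. smult M (b j) (X j w) + smult M ((-1) ^ h * b j) (Y j w))"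
    unfolding one_pt_def wtrace_def fps_nth_Abs_fps by (intro trace_on_cong[OF W_subspace])
  also have "\<dots> = (\<Sum>j\<le>N. tr (int N) (\<lambda>w. smult M (b j) (X j w) + smult M ((-1) ^ h * b j) (Y j w)))"
    by (rule trace_on_sum[OF W_subspace]) (intro subspace_add[OF W_subspace] subspace_scale[OF W_subspace] XW YW)
  also have "\<dots> = (\<Sum>j\<le>N. b j * tr (int N) (X j) + (-1) ^ h * b j * tr (int N) (Y j))"
  proof (intro sum.cong refl)
    fix j
    have "tr (int N) (\<lambda>w. smult M c (X j w)) = c * tr (int N) (X j)" "tr (int N) (\<lambda>w. smult M c (Y j w)) = c * tr (int N) (Y j)" for c
      by (rule trace_on_scale[OF W_subspace]; rule XW YW; assumption)+
    then show "tr (int N) (\<lambda>w. smult M (b j) (X j w) + smult M ((-1) ^ h * b j) (Y j w))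
      = b j * tr (int N) (X j) + (-1) ^ h * b j * tr (int N) (Y j)"
      by (subst trace_on_add[OF W_subspace]) (auto intro!: subspace_scale[OF W_subspace] XW YW)
  qed
  also have "\<dots> = (\<Sum>j\<le>N. b j * tr (int N) (X j)) + (\<Sum>j\<le>N. (-1) ^ h * b j * tr (int N) (Y j))"
    by (rule sum.distrib)
  also have "(\<Sum>j\<le>N. b j * tr (int N) (X j)) = (\<Sum>n=1..N. - (of_int (int n - 1) gchoose h) * fps_nth (q_frac n * P_fps J v (- int n)) N)"
  proof -
    have "(\<Sum>j\<le>N. b j * tr (int N) (X j)) = (\<Sum>j\<le>N. - b j * fps_nth (q_frac (h + 1 + j) * P_fps J v (- int (h + 1 + j))) N)"
      unfolding X_def by (intro sum.cong refl, subst trace_neg[OF v J]) auto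
    \<comment> \<open>Here n = h + 1 + j. The range can then be extended down to 1, since (n - 1
      gchoose h) vanishes for n <= h, and cut at N, beyond which \<open>q_frac n\<close> has no
      coefficient of degree at most N.\<close>
    also have "\<dots> = (\<Sum>n\<in>{h+1..h+1+N}. - (of_int (int n - 1) gchoose h) * fps_nth (q_frac n * P_fps J v (- int n)) N)"
    proof (rule sum.reindex_bij_witness[of _ "\<lambda>n. n - (h + 1)" "\<lambda>j. h + 1 + j"])
      fix j
      have "of_int (int (h + 1 + j) - 1) = (of_nat (h + j) :: complex)" by simp
      then have "(of_int (int (h + 1 + j) - 1) gchoose h) = b j"
        unfolding b_def by (simp only: binomial_gbinomial)
      then show "- (of_int (int (h + 1 + j) - 1) gchoose h) * fps_nth (q_frac (h + 1 + j) * P_fps J v (- int (h + 1 + j))) N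
        = - b j * fps_nth (q_frac (h + 1 + j) * P_fps J v (- int (h + 1 + j))) N" by (simp only:)
    qed auto
    also have "\<dots> = (\<Sum>n=1..N. - (of_int (int n - 1) gchoose h) * fps_nth (q_frac n * P_fps J v (- int n)) N)"
    proof (rule sum.mono_neutral_cong)
      fix n assume "n \<in> {1..N} - {h + 1..h + 1 + N}"
      then have n: "n \<ge> 1" "n - 1 < h" by auto
      then have "of_int (int n - 1) = (of_nat (n - 1) :: complex)" by (simp add: of_nat_diff)
      then have "(of_int (int n - 1) gchoose h :: complex) = of_nat ((n - 1) choose h)"
        by (simp only: binomial_gbinomial)
      then show "- (of_int (int n - 1) gchoose h) * fps_nth (q_frac n * P_fps J v (- int n)) N = 0"
        using n by simp
    next
      fix n assume "n \<in> {h + 1..h + 1 + N} - {1..N}"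
      then show "- (of_int (int n - 1) gchoose h) * fps_nth (q_frac n * P_fps J v (- int n)) N = 0"
        by (subst q_frac_mult_nth_0) auto
    qed auto
    finally show ?thesis .
  qed
  also have "(\<Sum>j\<le>N. (-1) ^ h * b j * tr (int N) (Y j)) = (\<Sum>n=1..N. (of_int (- int n - 1) gchoose h) * fps_nth (q_frac n * P_fps J v (int n)) N)"
  proof -
    have "(\<Sum>j\<le>N. (-1) ^ h * b j * tr (int N) (Y j)) = (\<Sum>n=1..N. (-1) ^ h * b n * tr (int N) (Y n))"
    proof (rule sum.mono_neutral_right)
      show "\<forall>i\<in>{..N} - {1..N}. (- 1) ^ h * b i * tr (int N) (Y i) = 0"
      proof
        fix i assume "i \<in> {..N} - {1..N}"
        then have "i = 0" by auto
        then have "Y i = (\<lambda>w. 0)" by (simp add: Y_def fun_eq_iff)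
        then show "(- 1) ^ h * b i * tr (int N) (Y i) = 0" by (simp add: trace_on_0[OF W_subspace])
      qed
    qed auto
    also have "\<dots> = (\<Sum>n=1..N. (of_int (- int n - 1) gchoose h) * fps_nth (q_frac n * P_fps J v (int n)) N)"
    proof (intro sum.cong refl)
      fix n assume n: "n \<in> {1..N}"
      have "(-1) ^ h * b n = (of_int (- int n - 1) gchoose h)"
      proof -
        have "(-1) ^ h * (of_int (- 1 - int n) gchoose h :: complex) = of_nat ((n + h) choose n)" by (rule gbinomial_flip)
        also have "(n + h) choose n = (h + n) choose h" by (metis add.commute add_diff_cancel_right' binomial_symmetric le_add2)
        finally have "(-1) ^ h * ((-1) ^ h * (of_int (- 1 - int n) gchoose h :: complex)) = (-1) ^ h * b n" by (simp add: b_def)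
        moreover have "of_int (- 1 - int n) = (of_int (- int n - 1) :: complex)" by simp
        ultimately show ?thesis by (simp only: minus_one_power_cancel)
      qed
      moreover have "tr (int N) (Y n) = fps_nth (q_frac n * P_fps J v (int n)) N"
        unfolding Y_def using n by (intro trace_pos[OF v J]) auto
      ultimately show "(-1) ^ h * b n * tr (int N) (Y n) = (of_int (- int n - 1) gchoose h) * fps_nth (q_frac n * P_fps J v (int n)) N"
        by simp
    qed
    finally show ?thesis .
  qed
  finally show ?thesis by (simp add: sum_subtractf sum_negf)
qed

text \<open>Coefficients of (1 + w)^n = e^(nz): \<open>sum_ln_pow_gchoose\<close> trades binomials
  and the modes a(i) for powers of n and the modes a[j].\<close>

lemma P_fps_eq:
  assumes J: "\<And>i. i \<ge> J \<Longrightarrow> mode M a (int i) v = 0"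
  shows "P_fps J v n = (\<Sum>j<J. fps_const (of_int n ^ j / fact j) * one_pt (al (int j) v))"
proof -
  have "one_pt (al (int j) v) = (\<Sum>i<J. fps_const (ln_pow i j) * one_pt (mode M a (int i) v))" for j
  proof -
    have "al (int j) v = (\<Sum>i<J. smult M (ln_pow i j) (mode M a (int i) v))"
      by (rule sq_mode_nat[OF weight_one]) (rule J)
    then show ?thesis by (simp only: one_pt_sum one_pt_scale)
  qed
  then have "(\<Sum>j<J. fps_const (of_int n ^ j / fact j) * one_pt (al (int j) v))
    = (\<Sum>i<J. \<Sum>j<J. fps_const (of_int n ^ j / fact j * ln_pow i j) * one_pt (mode M a (int i) v))"
    unfolding sum_distrib_left by (simp add: sum_distrib_left mult.assoc[symmetric], subst sum.swap) simp
  also have "\<dots> = (\<Sum>i<J. fps_const (\<Sum>j<J. of_int n ^ j / fact j * ln_pow i j) * one_pt (mode M a (int i) v))"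
  proof (intro sum.cong refl)
    fix i
    have "fps_const (\<Sum>j<J. of_int n ^ j / fact j * ln_pow i j) = (\<Sum>j<J. fps_const (of_int n ^ j / fact j * ln_pow i j))"
      by (rule fps_ext) (simp add: fps_sum_nth)
    then show "(\<Sum>j<J. fps_const (of_int n ^ j / fact j * ln_pow i j) * one_pt (mode M a (int i) v))
      = fps_const (\<Sum>j<J. of_int n ^ j / fact j * ln_pow i j) * one_pt (mode M a (int i) v)"
      by (simp only: sum_distrib_right)
  qed
  also have "\<dots> = P_fps J v n"
    unfolding P_fps_def
  proof (intro sum.cong refl arg_cong2[where f = "(*)"] arg_cong[where f = fps_const])
    fix i assume "i \<in> {..<J}"
    then have "(\<Sum>j<J. of_int n ^ j / fact j * ln_pow i j) = (\<Sum>j\<le>i. of_int n ^ j / fact j * ln_pow i j)"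
      by (intro sum.mono_neutral_right) (auto simp: ln_pow_0)
    then show "(\<Sum>j<J. of_int n ^ j / fact j * ln_pow i j) = (of_int n gchoose i)" by (simp only: sum_ln_pow_gchoose)
  qed
  finally show ?thesis ..
qed

text \<open>The series ln(1 + w)^(-k) is split at degree 0. Its regular part gives the
  \<open>bern_coeff\<close> terms. Its polar part goes through \<open>one_pt_a_neg\<close>, where
  the sum over h is a residue, a power of n of exponent k - 1; together with n^j/j! from
  \<open>P_fps_eq\<close> it builds the divisor sums.\<close>

lemma one_pt_recursion_homogeneous:
  assumes v: "v \<in> W d" and J: "\<And>i. i \<ge> J \<Longrightarrow> mode M a (int i) v = 0" and k: "k > 0"
  shows "one_pt (al (- int k) v) = (\<Sum>j<J. C_fps k j * one_pt (al (int j) v))"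
proof (rule fps_ext)
  fix N
  define l where "l = fls_nth (ln_fls powi (- int k))"
  have "al (- int k) v = (\<Sum>n\<in>{- int k..<int J}. smult M (l n) (mode M a n v))"
    unfolding sq_mode_weight[OF weight_one] sq_series_1[symmetric] l_def
  proof (rule smeared_eq)
    fix n assume "n \<ge> int J"
    then show "mode M a n v = 0" using J[of "nat n"] by auto
  qed (rule sq_series_nth_0)
  also have "{- int k..<int J} = {- int k..<0} \<union> {0..<int J}" by auto
  also have "(\<Sum>n\<in>{- int k..<0} \<union> {0..<int J}. smult M (l n) (mode M a n v))
    = (\<Sum>n\<in>{- int k..<0}. smult M (l n) (mode M a n v)) + (\<Sum>n\<in>{0..<int J}. smult M (l n) (mode M a n v))"
    by (rule sum.union_disjoint) auto
  also have "(\<Sum>n\<in>{- int k..<0}. smult M (l n) (mode M a n v)) = (\<Sum>h<k. smult M (l (- 1 - int h)) (mode M a (- 1 - int h) v))"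
    by (rule sum.reindex_bij_witness[of _ "\<lambda>h. - 1 - int h" "\<lambda>n. nat (- 1 - n)"]) auto
  also have "(\<Sum>n\<in>{0..<int J}. smult M (l n) (mode M a n v)) = (\<Sum>i<J. smult M (l (int i)) (mode M a (int i) v))"
    by (rule sum.reindex_bij_witness[of _ int nat]) auto
  also have "\<dots> = (\<Sum>j<J. smult M (bern_coeff k j) (al (int j) v))"
  proof -
    have "(\<Sum>i<J. smult M (l (int i)) (mode M a (int i) v)) = (\<Sum>i<J. \<Sum>j<J. smult M (bern_coeff k j) (smult M (ln_pow i j) (mode M a (int i) v)))"
    proof (intro sum.cong refl)
      fix i assume "i \<in> {..<J}"
      then have "(\<Sum>j\<le>i. bern_coeff k j * ln_pow i j) = (\<Sum>j<J. bern_coeff k j * ln_pow i j)"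
        by (intro sum.mono_neutral_left) (auto simp: ln_pow_0)
      then have "l (int i) = (\<Sum>j<J. bern_coeff k j * ln_pow i j)"
        unfolding l_def ln_fls_neg_powi_nth[OF k] .
      then show "smult M (l (int i)) (mode M a (int i) v) = (\<Sum>j<J. smult M (bern_coeff k j) (smult M (ln_pow i j) (mode M a (int i) v)))"
        by (simp add: scale_sum_left)
    qed
    also have "\<dots> = (\<Sum>j<J. smult M (bern_coeff k j) (al (int j) v))"
    proof -
      have "al (int j) v = (\<Sum>i<J. smult M (ln_pow i j) (mode M a (int i) v))" for j
        by (rule sq_mode_nat[OF weight_one]) (rule J)
      then show ?thesis by (simp only: scale_sum_right) (rule sum.swap)
    qed
    finally show ?thesis .
  qed
  finally have "fps_nth (one_pt (al (- int k) v)) N = (\<Sum>h<k. l (- 1 - int h) * fps_nth (one_pt (mode M a (- 1 - int h) v)) N)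
     + (\<Sum>j<J. bern_coeff k j * fps_nth (one_pt (al (int j) v)) N)"
    by (simp add: one_pt_add one_pt_sum one_pt_scale fps_sum_nth)
  also have "(\<Sum>h<k. l (- 1 - int h) * fps_nth (one_pt (mode M a (- 1 - int h) v)) N)
    = (\<Sum>n=1..N. ((- of_nat n) ^ (k - 1) / fact (k - 1)) * fps_nth (q_frac n * P_fps J v (int n)) N
         - (of_nat n ^ (k - 1) / fact (k - 1)) * fps_nth (q_frac n * P_fps J v (- int n)) N)"
  proof -
    have r: "(\<Sum>h<k. l (- 1 - int h) * (of_int (n - 1) gchoose h)) = of_int n ^ (k - 1) / fact (k - 1)" for n
      using sq_series_residue[OF k, of n] by (simp add: l_def mult.commute)
    have "(\<Sum>h<k. l (- 1 - int h) * fps_nth (one_pt (mode M a (- 1 - int h) v)) N)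
      = (\<Sum>n=1..N. (\<Sum>h<k. l (- 1 - int h) * (of_int (- int n - 1) gchoose h)) * fps_nth (q_frac n * P_fps J v (int n)) N
          - (\<Sum>h<k. l (- 1 - int h) * (of_int (int n - 1) gchoose h)) * fps_nth (q_frac n * P_fps J v (- int n)) N)"
    proof -
      have "l (- 1 - int h) * fps_nth (one_pt (mode M a (- 1 - int h) v)) N
        = (\<Sum>n=1..N. l (- 1 - int h) * (of_int (- int n - 1) gchoose h) * fps_nth (q_frac n * P_fps J v (int n)) N
            - l (- 1 - int h) * (of_int (int n - 1) gchoose h) * fps_nth (q_frac n * P_fps J v (- int n)) N)" for h
      proof -
        have "fps_nth (one_pt (mode M a (- 1 - int h) v)) N
          = (\<Sum>n=1..N. (of_int (- int n - 1) gchoose h) * fps_nth (q_frac n * P_fps J v (int n)) N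
             - (of_int (int n - 1) gchoose h) * fps_nth (q_frac n * P_fps J v (- int n)) N)"
          by (rule one_pt_a_neg[OF v]) (rule J)
        then show ?thesis by (simp only: sum_distrib_left right_diff_distrib mult.assoc)
      qed
      then show ?thesis
        by (simp only: sum_distrib_right sum_subtractf[symmetric]) (rule sum.swap)
    qed
    then show ?thesis unfolding r by simp
  qed
  also have "\<dots> = (\<Sum>j<J. (((-1) ^ (k - 1) - (-1) ^ j) / (fact (k - 1) * fact j)) * fps_nth (sigma_fps (k - 1 + j) * one_pt (al (int j) v)) N)"
  proof -
    have P: "fps_nth (q_frac n * P_fps J v m) N = (\<Sum>j<J. of_int m ^ j / fact j * fps_nth (q_frac n * one_pt (al (int j) v)) N)" for n m
    proof -
      have "P_fps J v m = (\<Sum>j<J. fps_const (of_int m ^ j / fact j) * one_pt (al (int j) v))"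
        by (rule P_fps_eq) (rule J)
      then have "q_frac n * P_fps J v m = (\<Sum>j<J. fps_const (of_int m ^ j / fact j) * (q_frac n * one_pt (al (int j) v)))"
        by (simp add: sum_distrib_left mult.left_commute)
      then show ?thesis by (simp add: fps_sum_nth)
    qed
    have "(\<Sum>n=1..N. ((- of_nat n) ^ (k - 1) / fact (k - 1)) * fps_nth (q_frac n * P_fps J v (int n)) N
         - (of_nat n ^ (k - 1) / fact (k - 1)) * fps_nth (q_frac n * P_fps J v (- int n)) N)
      = (\<Sum>n=1..N. \<Sum>j<J. (((-1) ^ (k - 1) - (-1) ^ j) / (fact (k - 1) * fact j)) * (of_nat n ^ (k - 1 + j) * fps_nth (q_frac n * one_pt (al (int j) v)) N))"
      unfolding P sum_distrib_left sum_subtractf[symmetric]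
    proof (intro sum.cong refl)
      fix n j
      have "(- of_nat n :: complex) ^ i = (-1) ^ i * of_nat n ^ i" for i by (rule power_minus)
      then show "(- of_nat n) ^ (k - 1) / fact (k - 1) * (of_int (int n) ^ j / fact j * fps_nth (q_frac n * one_pt (al (int j) v)) N) -
           of_nat n ^ (k - 1) / fact (k - 1) * (of_int (- int n) ^ j / fact j * fps_nth (q_frac n * one_pt (al (int j) v)) N) =
           ((- 1) ^ (k - 1) - (- 1) ^ j) / (fact (k - 1) * fact j) * (of_nat n ^ (k - 1 + j) * fps_nth (q_frac n * one_pt (al (int j) v)) N)"
        by (simp add: power_add field_simps)
    qed
    also have "\<dots> = (\<Sum>j<J. (((-1) ^ (k - 1) - (-1) ^ j) / (fact (k - 1) * fact j)) * (\<Sum>n=1..N. of_nat n ^ (k - 1 + j) * fps_nth (q_frac n * one_pt (al (int j) v)) N))"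
      unfolding sum_distrib_left by (rule sum.swap)
    finally show ?thesis unfolding sum_q_frac .
  qed
  also have "\<dots> + (\<Sum>j<J. bern_coeff k j * fps_nth (one_pt (al (int j) v)) N) = fps_nth (\<Sum>j<J. C_fps k j * one_pt (al (int j) v)) N"
    by (simp add: C_fps_def fps_sum_nth distrib_right sum.distrib mult.assoc)
  finally show "fps_nth (one_pt (al (- int k) v)) N = fps_nth (\<Sum>j<J. C_fps k j * one_pt (al (int j) v)) N" .
qed

text \<open>Linearity removes homogeneity for L(0), and the term j = 0 disappears because a[0] =
  0.\<close>

lemma one_pt_recursion:
  assumes R: "\<And>j. j > R \<Longrightarrow> al (int j) v = 0" and k: "k > 0"
  shows "one_pt (al (- int k) v) = (\<Sum>j=1..R. C_fps k j * one_pt (al (int j) v))"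
proof -
  define I where "I = {k. component M v k \<noteq> 0}"
  have I: "finite I" unfolding I_def by (rule gr.hcomp_finite)
  have v: "v = (\<Sum>k\<in>I. component M v k)"
    unfolding I_def by (subst gr.hcomp_sum[symmetric], rule Sum_any.expand_set)
  obtain T where T: "\<And>n k. n \<ge> T \<Longrightarrow> k \<in> I \<Longrightarrow> mode M a n (component M v k) = 0"
    using truncation_finite[OF I, of "\<lambda>_. a" "component M v"] by blast
  define J where "J = max (nat T) (Suc R)"
  have J: "mode M a (int i) (component M v k) = 0" if "i \<ge> J" "k \<in> I" for i k
    using that T[of "int i" k] by (simp add: J_def nat_le_iff)
  have "one_pt (al (- int k) v) = (\<Sum>d\<in>I. one_pt (al (- int k) (component M v d)))"
    by (subst v) (simp only: sq_sum one_pt_sum)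
  also have "\<dots> = (\<Sum>d\<in>I. \<Sum>j<J. C_fps k j * one_pt (al (int j) (component M v d)))"
    by (intro sum.cong refl one_pt_recursion_homogeneous[OF gr.hcomp_in _ k] J)
  also have "\<dots> = (\<Sum>j<J. C_fps k j * one_pt (al (int j) v))"
    by (subst sum.swap, subst (2) v) (simp only: sq_sum one_pt_sum sum_distrib_left)
  also have "\<dots> = (\<Sum>j=1..R. C_fps k j * one_pt (al (int j) v))"
  proof (rule sum.mono_neutral_right)
    show "\<forall>i\<in>{..<J} - {1..R}. C_fps k i * one_pt (al (int i) v) = 0"
    proof
      fix i assume "i \<in> {..<J} - {1..R}"
      then have "i = 0 \<or> i > R" by auto
      then have "al (int i) v = 0" using R by auto
      then show "C_fps k i * one_pt (al (int i) v) = 0" by simp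
    qed
  qed (auto simp: J_def)
  finally show ?thesis .
qed

end

section \<open>Convergence and the genus one partition function\<close>

definition conv_disc :: "complex fps \<Rightarrow> bool" where "conv_disc f \<longleftrightarrow> fps_conv_radius f \<ge> 1"

lemma conv_disc_add: "conv_disc f \<Longrightarrow> conv_disc g \<Longrightarrow> conv_disc (f + g)"
  unfolding conv_disc_def by (rule order_trans[OF _ fps_conv_radius_add]) simp
lemma conv_disc_mult: "conv_disc f \<Longrightarrow> conv_disc g \<Longrightarrow> conv_disc (f * g)"
  unfolding conv_disc_def by (rule order_trans[OF _ fps_conv_radius_mult]) simp
lemma conv_disc_const [simp]: "conv_disc (fps_const c)" by (simp add: conv_disc_def)
lemma conv_disc_0 [simp]: "conv_disc 0" by (simp add: conv_disc_def)
lemma conv_disc_1 [simp]: "conv_disc 1" by (simp add: conv_disc_def)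
lemma conv_disc_sum: "(\<And>i. i \<in> I \<Longrightarrow> conv_disc (f i)) \<Longrightarrow> conv_disc (sum f I)"
  by (induction I rule: infinite_finite_induct) (auto intro: conv_disc_add)

lemma conv_disc_less: "conv_disc f \<Longrightarrow> norm z < 1 \<Longrightarrow> ereal (norm z) < fps_conv_radius f"
  unfolding conv_disc_def by (rule less_le_trans[of _ 1]) simp_all

lemma conv_disc_summable: "conv_disc f \<Longrightarrow> norm z < 1 \<Longrightarrow> summable (\<lambda>n. norm (fps_nth f n * z ^ n))"
  by (intro norm_summable_fps conv_disc_less)

lemma conv_disc_sums: "conv_disc f \<Longrightarrow> norm z < 1 \<Longrightarrow> (\<lambda>n. fps_nth f n * z ^ n) sums eval_fps f z"
  unfolding eval_fps_def by (rule summable_sums[OF summable_norm_cancel[OF conv_disc_summable]])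

lemma conv_disc_eval_add: "conv_disc f \<Longrightarrow> conv_disc g \<Longrightarrow> norm z < 1 \<Longrightarrow> eval_fps (f + g) z = eval_fps f z + eval_fps g z"
  by (intro eval_fps_add conv_disc_less)
lemma conv_disc_eval_mult: "conv_disc f \<Longrightarrow> conv_disc g \<Longrightarrow> norm z < 1 \<Longrightarrow> eval_fps (f * g) z = eval_fps f z * eval_fps g z"
  by (intro eval_fps_mult conv_disc_less)
lemma conv_disc_eval_sum: "(\<And>i. i \<in> I \<Longrightarrow> conv_disc (f i)) \<Longrightarrow> norm z < 1 \<Longrightarrow> eval_fps (sum f I) z = (\<Sum>i\<in>I. eval_fps (f i) z)"
  by (induction I rule: infinite_finite_induct) (auto simp: conv_disc_eval_add conv_disc_sum)

text \<open>Abel's lemma: bounded terms at a point x between r and 1 are dominated at r by a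
  geometric series.\<close>

lemma conv_discI:
  assumes "\<And>x. 0 < x \<Longrightarrow> x < 1 \<Longrightarrow> \<exists>M. \<forall>n. norm (fps_nth f n) * x ^ n \<le> M"
  shows "conv_disc f"
  unfolding conv_disc_def fps_conv_radius_def
proof (rule conv_radius_geI_ex')
  fix r :: real assume r: "0 < r" "ereal r < 1"
  then have r1: "r < 1" by simp
  define x where "x = (r + 1) / 2"
  have x: "0 < x" "x < 1" "r < x" using r r1 by (auto simp: x_def)
  obtain C where C: "\<And>n. norm (fps_nth f n) * x ^ n \<le> C" using assms[of x] x by blast
  show "summable (\<lambda>n. fps_nth f n * of_real r ^ n)"
  proof (rule summable_comparison_test')
    show "summable (\<lambda>n. C * (r / x) ^ n)"
      using x r by (intro summable_mult summable_geometric) auto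
    show "norm (fps_nth f n * of_real r ^ n) \<le> C * (r / x) ^ n" for n
    proof -
      have "norm (fps_nth f n * of_real r ^ n) = (norm (fps_nth f n) * x ^ n) * (r / x) ^ n"
        using x r by (simp add: norm_mult norm_power power_divide)
      also have "\<dots> \<le> C * (r / x) ^ n" using x r C by (intro mult_right_mono) auto
      finally show ?thesis .
    qed
  qed
qed

lemma conv_disc_powers: "conv_disc (Abs_fps (\<lambda>n. of_nat n ^ r))"
proof (induction r)
  case 0
  show ?case by (rule conv_discI) (auto intro!: exI[of _ 1] simp: power_le_one)
next
  case (Suc r)
  have "Abs_fps (\<lambda>n. of_nat n ^ Suc r) = fps_X * fps_deriv (Abs_fps (\<lambda>n. of_nat n ^ r) :: complex fps)"
  proof (rule fps_ext)
    fix n show "fps_nth (Abs_fps (\<lambda>n. of_nat n ^ Suc r)) n = fps_nth (fps_X * fps_deriv (Abs_fps (\<lambda>n. of_nat n ^ r) :: complex fps)) n"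
      by (cases n) (simp_all add: fps_X_mult_nth)
  qed
  moreover have "conv_disc (fps_deriv (Abs_fps (\<lambda>n. of_nat n ^ r)))"
    using Suc unfolding conv_disc_def by (rule order_trans[OF _ fps_conv_radius_deriv])
  moreover have "conv_disc fps_X" by (simp add: conv_disc_def)
  ultimately show ?case by (simp only: conv_disc_mult)
qed

lemma divisor_sum_le: "divisor_sum r n \<le> n ^ Suc r"
proof (cases "n = 0")
  case False
  have "divisor_sum r n \<le> (\<Sum>d | d dvd n. n ^ r)"
    unfolding divisor_sum_def using False by (intro sum_mono power_mono) (auto dest: dvd_imp_le)
  also have "\<dots> = card {d. d dvd n} * n ^ r" by simp
  also have "card {d. d dvd n} \<le> card {1..n}"
    using False by (intro card_mono) (auto dest: dvd_imp_le intro: Nat.gr0I simp: Suc_le_eq)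
  finally show ?thesis by simp
qed (simp add: divisor_sum_def)

lemma conv_disc_sigma: "conv_disc (sigma_fps r)"
proof (rule conv_discI)
  fix x :: real assume x: "0 < x" "x < 1"
  have "summable (\<lambda>n. norm (fps_nth (Abs_fps (\<lambda>n. of_nat n ^ Suc r)) n * complex_of_real x ^ n))"
    using x by (intro conv_disc_summable conv_disc_powers) auto
  then have "(\<lambda>n. norm (fps_nth (Abs_fps (\<lambda>n. of_nat n ^ Suc r)) n * complex_of_real x ^ n)) \<longlonglongrightarrow> 0"
    by (rule summable_LIMSEQ_zero)
  then have "Bseq (\<lambda>n. norm (fps_nth (Abs_fps (\<lambda>n. of_nat n ^ Suc r)) n * complex_of_real x ^ n))"
    by (intro convergent_imp_Bseq convergentI)
  then obtain C where C: "\<And>n. norm (norm (fps_nth (Abs_fps (\<lambda>n. of_nat n ^ Suc r)) n * complex_of_real x ^ n)) \<le> C"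
    unfolding Bseq_def by blast
  have "norm (fps_nth (sigma_fps r) n) * x ^ n \<le> C" for n
  proof -
    have "norm (fps_nth (sigma_fps r) n) \<le> real (n ^ Suc r)"
      using divisor_sum_le[of r n] unfolding sigma_fps_def by (simp del: power_Suc)
    then have "norm (fps_nth (sigma_fps r) n) * x ^ n \<le> real (n ^ Suc r) * x ^ n"
      using x by (intro mult_right_mono) auto
    also have "\<dots> \<le> C" using C[of n] x by (simp add: norm_mult norm_power)
    finally show ?thesis .
  qed
  then show "\<exists>M. \<forall>n. norm (fps_nth (sigma_fps r) n) * x ^ n \<le> M" by blast
qed

lemma conv_disc_C_fps: "conv_disc (C_fps k j)"
  unfolding C_fps_def by (intro conv_disc_add conv_disc_mult conv_disc_const conv_disc_sigma)

lemma norm_nome_less_1: "Im \<tau> > 0 \<Longrightarrow> norm (nome \<tau>) < 1"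
  by (simp add: nome_def)

lemma eval_C_fps:
  assumes "k > 0" "j > 0" "Im \<tau> > 0"
  shows "eval_fps (C_fps k j) (nome \<tau>) = C_coeff k j \<tau> / of_nat j"
proof -
  define q where "q = nome \<tau>"
  have q: "norm q < 1" using assms norm_nome_less_1 by (simp add: q_def)
  have ev: "eval_fps (C_fps k j) q = bern_coeff k j
     + ((-1) ^ (k - 1) - (-1) ^ j) / (fact (k - 1) * fact j) * eval_fps (sigma_fps (k - 1 + j)) q"
    unfolding C_fps_def using q by (simp add: conv_disc_eval_add conv_disc_eval_mult conv_disc_mult conv_disc_sigma)
  have fj: "fact j = of_nat j * (fact (j - 1) :: complex)" using assms by (simp add: fact_reduce)
  show ?thesis
  proof (cases "odd (k + j)")
    case True
    \<comment> \<open>The index k + j is odd and at least 2, hence not the exceptional index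
      1.\<close>
    then have "bernoulli_number (k + j) = 0" using assms by (intro bernoulli_odd) auto
    moreover have "(-1 :: complex) ^ (k - 1) = (-1) ^ j"
      using True assms by (cases k) auto
    ultimately show ?thesis using True unfolding q_def[symmetric] ev
      by (simp add: C_coeff_def eisenstein_E_def bern_coeff_def)
  next
    case False
    have s: "(-1 :: complex) ^ (k - 1) - (-1) ^ j = 2 * (-1) ^ (k + 1)"
      using False assms by (cases k) auto
    have "(\<lambda>n. fps_nth (sigma_fps (k - 1 + j)) n * q ^ n) sums eval_fps (sigma_fps (k - 1 + j)) q"
      using q by (intro conv_disc_sums conv_disc_sigma)
    then have "(\<lambda>n. fps_nth (sigma_fps (k - 1 + j)) (Suc n) * q ^ Suc n) sums eval_fps (sigma_fps (k - 1 + j)) q"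
      by (subst sums_Suc_iff) (simp add: sigma_fps_def)
    then have "(\<lambda>n. of_nat (divisor_sum (k + j - 1) (Suc n)) * q ^ Suc n) sums eval_fps (sigma_fps (k - 1 + j)) q"
      using assms by (simp add: sigma_fps_def)
    then have e: "eval_fps (sigma_fps (k - 1 + j)) q = suminf (\<lambda>n. of_nat (divisor_sum (k + j - 1) (Suc n)) * q ^ Suc n)"
      by (rule sums_unique)
    have k1: "(-1 :: complex) ^ k = - ((-1) ^ (k + 1))" by simp
    define S where "S = eval_fps (sigma_fps (k - 1 + j)) q"
    define s1 where "s1 = (-1 :: complex) ^ (k + 1)"
    have "eval_fps (C_fps k j) q = s1 * (fact (k + j - 1) / (fact (k - 1) * fact j)) * (- bernoulli_number (k + j) / fact (k + j)) + 2 * s1 / (fact (k - 1) * fact j) * S"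
      unfolding ev bern_coeff_def s k1 S_def s1_def by simp
    also have "\<dots> = s1 * (fact (k + j - 1) / (fact (k - 1) * fact j)) * (- bernoulli_number (k + j) / fact (k + j) + 2 / fact (k + j - 1) * S)"
      by (simp add: field_simps)
    also have "\<dots> = C_coeff k j \<tau> / of_nat j"
      using False unfolding C_coeff_def eisenstein_E_def S_def e s1_def fj unfolding q_def by simp
    finally show ?thesis by (simp add: q_def)
  qed
qed

text \<open>With b(n) = d(n) x^n and S the sum of sigma_1(i) x^i, the recursion bounds n b(n) by S
  times the maximum of the earlier b; once n >= S this maximum no longer grows.\<close>

lemma sigma_recursion_bounded:
  fixes d :: "nat \<Rightarrow> nat"
  assumes rec: "\<And>N. of_nat N * of_nat (d N) = fps_nth (sigma_fps 1 * Abs_fps (\<lambda>n. of_nat (d n))) N"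
  shows "conv_disc (Abs_fps (\<lambda>n. of_nat (d n)))"
proof (rule conv_discI)
  fix x :: real assume x: "0 < x" "x < 1"
  define s where "s i = (if i = 0 then 0 else real (divisor_sum 1 i))" for i
  have "summable (\<lambda>n. norm (fps_nth (sigma_fps 1) n * complex_of_real x ^ n))"
    using x by (intro conv_disc_summable conv_disc_sigma) auto
  moreover have "norm (fps_nth (sigma_fps 1) n * complex_of_real x ^ n) = s n * x ^ n" for n
    using x by (simp add: s_def sigma_fps_def norm_mult norm_power)
  ultimately have sm: "summable (\<lambda>n. s n * x ^ n)" by simp
  define S where "S = suminf (\<lambda>n. s n * x ^ n)"
  have s0: "s n * x ^ n \<ge> 0" for n using x by (simp add: s_def)
  have S: "(\<Sum>i\<in>{0..N}. s i * x ^ i) \<le> S" for N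
    unfolding S_def by (rule sum_le_suminf[OF sm]) (use s0 in auto)
  define b where "b n = real (d n) * x ^ n" for n
  have b0: "b n \<ge> 0" for n using x by (simp add: b_def)
  have brec: "real N * b N = (\<Sum>i=0..N. (s i * x ^ i) * b (N - i))" for N
  proof -
    have "complex_of_real (real N * real (d N)) = complex_of_real (\<Sum>i=0..N. s i * real (d (N - i)))"
      using rec[of N] by (simp add: fps_mult_nth sigma_fps_def s_def if_distrib[of of_real] cong: if_cong)
    then have "real N * real (d N) = (\<Sum>i=0..N. s i * real (d (N - i)))" by (simp only: of_real_eq_iff)
    then have "real N * b N = (\<Sum>i=0..N. s i * real (d (N - i)) * x ^ N)"
      by (simp add: b_def sum_distrib_right flip: mult.assoc)
    also have "\<dots> = (\<Sum>i=0..N. (s i * x ^ i) * b (N - i))"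
      by (intro sum.cong refl) (simp add: b_def flip: power_add)
    finally show ?thesis .
  qed
  define K where "K = nat \<lceil>S\<rceil>"
  define C where "C = Max (b ` {..K})"
  have C: "b n \<le> C" if "n \<le> K" for n unfolding C_def using that by (intro Max_ge) auto
  then have C0: "C \<ge> 0" using b0[of 0] by (meson le0 order_trans)
  have "b n \<le> C" for n
  proof (induction n rule: less_induct)
    case (less n)
    show ?case
    proof (cases "n \<le> K")
      case False
      then have "S \<le> real n" unfolding K_def by linarith
      have "real n * b n \<le> (\<Sum>i=0..n. (s i * x ^ i) * C)"
        unfolding brec
      proof (rule sum_mono)
        fix i assume "i \<in> {0..n}"
        show "s i * x ^ i * b (n - i) \<le> s i * x ^ i * C"
        proof (cases "i = 0")
          case False
          then have "n - i < n" using \<open>\<not> n \<le> K\<close> by auto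
          then show ?thesis using less s0 by (intro mult_left_mono) auto
        qed (simp add: s_def)
      qed
      also have "\<dots> = (\<Sum>i=0..n. s i * x ^ i) * C" by (simp add: sum_distrib_right)
      also have "\<dots> \<le> S * C" using S C0 by (intro mult_right_mono) auto
      also have "\<dots> \<le> real n * C" using \<open>S \<le> real n\<close> C0 by (intro mult_right_mono)
      finally show ?thesis using False by simp
    qed (rule C)
  qed
  then show "\<exists>M. \<forall>n. norm (fps_nth (Abs_fps (\<lambda>n. complex_of_nat (d n))) n) * x ^ n \<le> M"
    by (auto simp: b_def)
qed

section \<open>The Euler product from its logarithmic derivative\<close>

definition theta :: "complex fps \<Rightarrow> complex fps" where "theta f = fps_X * fps_deriv f"

lemma theta_nth: "fps_nth (theta f) n = of_nat n * fps_nth f n"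
  by (cases n) (simp_all add: theta_def fps_X_mult_nth)

lemma theta_mult: "theta (f * g) = theta f * g + f * theta g"
  by (simp add: theta_def algebra_simps)

lemma theta_one_minus_X:
  assumes "n > 0"
  shows "theta (1 - fps_X ^ n) = - of_nat n * q_frac n * (1 - fps_X ^ n)"
proof -
  have "theta (1 - fps_X ^ n) = - of_nat n * fps_X ^ n"
    using assms by (intro fps_ext) (auto simp: theta_nth fps_X_power_nth fps_mult_of_nat_nth)
  also have "\<dots> = - of_nat n * ((1 - fps_X ^ n) * q_frac n)" by (simp only: q_frac_eq[OF assms])
  finally show ?thesis by (simp only: mult_ac)
qed

lemma theta_partial_product:
  "theta (\<Prod>n=1..K. 1 - fps_X ^ n) = - (\<Sum>n=1..K. of_nat n * q_frac n) * (\<Prod>n=1..K. 1 - fps_X ^ n)"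
proof (induction K)
  case 0
  then show ?case by (simp add: theta_def)
next
  case (Suc K)
  have "theta (\<Prod>n=1..Suc K. 1 - fps_X ^ n) = theta (\<Prod>n=1..K. 1 - fps_X ^ n) * (1 - fps_X ^ Suc K)
      + (\<Prod>n=1..K. 1 - fps_X ^ n) * theta (1 - fps_X ^ Suc K)"
    by (simp add: theta_mult del: power_Suc)
  also have "\<dots> = - (\<Sum>n=1..K. of_nat n * q_frac n) * (\<Prod>n=1..K. 1 - fps_X ^ n) * (1 - fps_X ^ Suc K)
     + (\<Prod>n=1..K. 1 - fps_X ^ n) * (- of_nat (Suc K) * q_frac (Suc K) * (1 - fps_X ^ Suc K))"
    by (simp only: Suc theta_one_minus_X zero_less_Suc)
  also have "\<dots> = - ((\<Sum>n=1..K. of_nat n * q_frac n) + of_nat (Suc K) * q_frac (Suc K)) * ((\<Prod>n=1..K. 1 - fps_X ^ n) * (1 - fps_X ^ Suc K))"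
  proof -
    have "- s * p * x + p * (- m * r * x) = - (s + m * r) * (p * x)" for s p x m r :: "complex fps"
      by (simp add: algebra_simps)
    then show ?thesis by (simp only:)
  qed
  finally show ?case by simp
qed

text \<open>U K is the series of d times the first K factors of the product. Its logarithmic
  derivative c K keeps only the divisors n > K, so U K = 1 + O(q^(K+1)), with coefficients bounded
  by those of d; hence its values tend to 1.\<close>

lemma euler_product:
  fixes d :: "nat \<Rightarrow> nat"
  assumes rec: "\<And>N. of_nat N * of_nat (d N) = fps_nth (sigma_fps 1 * Abs_fps (\<lambda>n. of_nat (d n))) N"
    and d0: "d 0 = 1" and q: "norm (q :: complex) < 1"
  shows "eval_fps (Abs_fps (\<lambda>n. of_nat (d n))) q * prodinf (\<lambda>n. 1 - q ^ Suc n) = 1"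
proof -
  define F where "F = Abs_fps (\<lambda>n. complex_of_nat (d n))"
  have F: "conv_disc F" unfolding F_def by (rule sigma_recursion_bounded[OF rec])
  define P :: "nat \<Rightarrow> complex fps" where "P = (\<lambda>K. \<Prod>n=1..K. 1 - fps_X ^ n)"
  have conv_X: "conv_disc (1 - fps_X ^ n)" for n
    using conv_disc_add[of 1 "- (fps_X ^ n)"] by (simp add: conv_disc_def)
  have P: "conv_disc (P K)" "eval_fps (P K) q = (\<Prod>n=1..K. 1 - q ^ n)" for K
  proof (induction K)
    case (Suc K)
    have "P (Suc K) = P K * (1 - fps_X ^ Suc K)" by (simp add: P_def)
    moreover have "eval_fps (1 - fps_X ^ Suc K) q = 1 - q ^ Suc K"
      by (subst eval_fps_diff) (simp_all del: power_Suc)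
    ultimately show "conv_disc (P (Suc K))" "eval_fps (P (Suc K)) q = (\<Prod>n=1..Suc K. 1 - q ^ n)"
      using Suc conv_X q by (simp_all add: conv_disc_mult conv_disc_eval_mult del: power_Suc)
  qed (simp_all add: P_def)
  define U where "U K = F * P K" for K
  define c where "c K = sigma_fps 1 - (\<Sum>n=1..K. of_nat n * q_frac n)" for K
  have c_nth: "fps_nth (c K) i = (if i = 0 then 0 else of_nat (\<Sum>n | n dvd i \<and> n > K. n))" for K i
  proof (cases "i = 0")
    case False
    have "fps_nth (\<Sum>n=1..K. of_nat n * q_frac n) i = (\<Sum>n\<in>{1..K}. if n dvd i then of_nat n else 0)"
      unfolding fps_sum_nth using False by (intro sum.cong refl) (simp add: fps_mult_of_nat_nth q_frac_def)
    also have "\<dots> = of_nat (\<Sum>n\<in>{n\<in>{1..K}. n dvd i}. n)"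
      unfolding of_nat_sum by (rule sum.inter_filter[symmetric]) simp
    also have "{n\<in>{1..K}. n dvd i} = {n. n dvd i \<and> n \<le> K}" using False by (auto intro: Nat.gr0I simp: Suc_le_eq)
    finally have 1: "fps_nth (\<Sum>n=1..K. of_nat n * q_frac n) i = of_nat (\<Sum>n | n dvd i \<and> n \<le> K. n)" .
    have fin: "finite {n. n dvd i \<and> n \<le> K}" "finite {n. n dvd i \<and> n > K}"
      using False by (auto intro: finite_subset[OF _ finite_divisors_nat[of i]])
    have "divisor_sum 1 i = sum id ({n. n dvd i \<and> n \<le> K} \<union> {n. n dvd i \<and> n > K})"
      unfolding divisor_sum_def by (intro sum.cong) auto
    also have "\<dots> = sum id {n. n dvd i \<and> n \<le> K} + sum id {n. n dvd i \<and> n > K}"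
      by (rule sum.union_disjoint[OF fin]) auto
    finally have "divisor_sum 1 i = (\<Sum>n | n dvd i \<and> n \<le> K. n) + (\<Sum>n | n dvd i \<and> n > K. n)"
      by simp
    then have "fps_nth (sigma_fps 1) i = of_nat (\<Sum>n | n dvd i \<and> n \<le> K. n) + of_nat (\<Sum>n | n dvd i \<and> n > K. n)"
      using False by (simp only: sigma_fps_def fps_nth_Abs_fps if_False of_nat_add)
    then show ?thesis using False 1 by (simp only: c_def fps_sub_nth if_False add_diff_cancel_left')
  qed (simp add: c_def sigma_fps_def fps_sum_nth fps_mult_of_nat_nth q_frac_def)
  have thF: "theta F = sigma_fps 1 * F"
    by (rule fps_ext) (simp only: theta_nth F_def fps_nth_Abs_fps rec)
  have thU: "theta (U K) = c K * U K" for K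
    unfolding U_def theta_mult thF P_def theta_partial_product c_def by (simp add: algebra_simps)
  have U_rec: "of_nat N * fps_nth (U K) N = (\<Sum>i=0..N. fps_nth (c K) i * fps_nth (U K) (N - i))" for K N
    using arg_cong[OF thU[of K], of "\<lambda>f. fps_nth f N"] by (simp only: theta_nth fps_mult_nth)
  have U_0: "fps_nth (U K) 0 = 1" for K
  proof -
    have "fps_nth (P K) 0 = 1" by (induction K) (simp_all add: P_def)
    then show ?thesis by (simp add: U_def F_def d0)
  qed
  have U_low: "fps_nth (U K) N = 0" if "0 < N" "N \<le> K" for K N
  proof -
    have "fps_nth (c K) i = 0" if "i \<le> N" for i
    proof -
      have "{n. n dvd i \<and> n > K} = {}" if "i > 0" using that \<open>i \<le> N\<close> \<open>N \<le> K\<close> by (auto dest: dvd_imp_le)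
      then have "i > 0 \<Longrightarrow> (\<Sum>n | n dvd i \<and> n > K. n) = 0" by (simp only: sum.empty)
      then show ?thesis unfolding c_nth by (cases "i = 0") (simp_all del: of_nat_sum)
    qed
    then have "of_nat N * fps_nth (U K) N = 0" unfolding U_rec by (intro sum.neutral) auto
    then show ?thesis using that by simp
  qed
  have c_le: "norm (fps_nth (c K) i) \<le> (if i = 0 then 0 else real (divisor_sum 1 i))" for K i
  proof (cases "i = 0")
    case False
    have "(\<Sum>n | n dvd i \<and> n > K. n) \<le> divisor_sum 1 i"
      unfolding divisor_sum_def power_one_right using False by (intro sum_mono2) auto
    then show ?thesis using False unfolding c_nth by (simp del: of_nat_sum)
  qed (simp add: c_nth)
  have F_rec: "real N * real (d N) = (\<Sum>i=0..N. (if i = 0 then 0 else real (divisor_sum 1 i)) * real (d (N - i)))" for N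
  proof -
    have "complex_of_real (real N * real (d N)) = complex_of_real (\<Sum>i=0..N. (if i = 0 then 0 else real (divisor_sum 1 i)) * real (d (N - i)))"
      using rec[of N] by (simp add: fps_mult_nth sigma_fps_def if_distrib[of of_real] cong: if_cong)
    then show ?thesis by (simp only: of_real_eq_iff)
  qed
  \<comment> \<open>The recursion for U K has coefficients dominated by those of the recursion for
    d.\<close>
  have U_le: "norm (fps_nth (U K) N) \<le> real (d N)" for K N
  proof (induction N rule: less_induct)
    case (less N)
    show ?case
    proof (cases "N = 0")
      case False
      have "real N * norm (fps_nth (U K) N) = norm (of_nat N * fps_nth (U K) N)" by (simp add: norm_mult)
      also have "\<dots> \<le> (\<Sum>i=0..N. norm (fps_nth (c K) i * fps_nth (U K) (N - i)))"
        unfolding U_rec by (rule norm_sum)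
      also have "\<dots> \<le> (\<Sum>i=0..N. (if i = 0 then 0 else real (divisor_sum 1 i)) * real (d (N - i)))"
      proof (rule sum_mono)
        fix i assume "i \<in> {0..N}"
        show "norm (fps_nth (c K) i * fps_nth (U K) (N - i)) \<le> (if i = 0 then 0 else real (divisor_sum 1 i)) * real (d (N - i))"
        proof (cases "i = 0")
          case True
          then show ?thesis by (simp add: c_nth)
        next
          case i: False
          then have "N - i < N" using False by simp
          then show ?thesis unfolding norm_mult using c_le less by (intro mult_mono) auto
        qed
      qed
      also have "\<dots> = real N * real (d N)" by (rule F_rec[symmetric])
      finally show ?thesis using False by simp
    qed (simp add: U_0 d0)
  qed
  have sF: "summable (\<lambda>n. real (d n) * norm q ^ n)"
    using conv_disc_summable[OF F q] by (simp add: F_def norm_mult norm_power)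
  have U_conv: "conv_disc (U K)" for K unfolding U_def by (intro conv_disc_mult F P)
  have lim: "(\<lambda>K. eval_fps (U K) q) \<longlonglongrightarrow> 1"
  proof (rule LIM_zero_cancel, rule Lim_null_comparison)
    show "(\<lambda>K. suminf (\<lambda>n. real (d (n + Suc K)) * norm q ^ (n + Suc K))) \<longlonglongrightarrow> 0"
      using LIMSEQ_ignore_initial_segment[OF suminf_exist_split2[OF sF], of 1] by simp
    show "\<forall>\<^sub>F K in sequentially. norm (eval_fps (U K) q - 1) \<le> suminf (\<lambda>n. real (d (n + Suc K)) * norm q ^ (n + Suc K))"
    proof (rule always_eventually, rule allI)
      fix K
      have sU: "summable (\<lambda>n. fps_nth (U K) n * q ^ n)" using conv_disc_sums[OF U_conv q] by (rule sums_summable)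
      have "eval_fps (U K) q = suminf (\<lambda>n. fps_nth (U K) (n + Suc K) * q ^ (n + Suc K)) + (\<Sum>n<Suc K. fps_nth (U K) n * q ^ n)"
        unfolding eval_fps_def by (rule suminf_split_initial_segment[OF sU])
      also have "(\<Sum>n<Suc K. fps_nth (U K) n * q ^ n) = (\<Sum>n\<in>{0}. fps_nth (U K) n * q ^ n)"
        by (rule sum.mono_neutral_right) (auto simp: U_low)
      finally have "eval_fps (U K) q - 1 = suminf (\<lambda>n. fps_nth (U K) (n + Suc K) * q ^ (n + Suc K))"
        by (simp add: U_0)
      also have "norm \<dots> \<le> suminf (\<lambda>n. real (d (n + Suc K)) * norm q ^ (n + Suc K))"
      proof (rule norm_suminf_le)
        show "summable (\<lambda>n. real (d (n + Suc K)) * norm q ^ (n + Suc K))"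
          using sF by (subst summable_iff_shift)
        show "norm (fps_nth (U K) (n + Suc K) * q ^ (n + Suc K)) \<le> real (d (n + Suc K)) * norm q ^ (n + Suc K)" for n
          unfolding norm_mult norm_power by (intro mult_right_mono U_le) auto
      qed
      finally show "norm (eval_fps (U K) q - 1) \<le> suminf (\<lambda>n. real (d (n + Suc K)) * norm q ^ (n + Suc K))" .
    qed
  qed
  have "summable (\<lambda>n. norm (q ^ Suc n))"
    using q by (subst summable_Suc_iff) (simp add: norm_power summable_geometric)
  then have "convergent_prod (\<lambda>n. 1 - q ^ Suc n)"
    by (intro abs_convergent_prod_imp_convergent_prod summable_imp_abs_convergent_prod) (simp del: power_Suc)
  then have "(\<lambda>K. \<Prod>n\<le>K. 1 - q ^ Suc n) \<longlonglongrightarrow> prodinf (\<lambda>n. 1 - q ^ Suc n)"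
    by (rule convergent_prod_LIMSEQ)
  then have "(\<lambda>K. eval_fps F q * (\<Prod>n\<le>K. 1 - q ^ Suc n)) \<longlonglongrightarrow> eval_fps F q * prodinf (\<lambda>n. 1 - q ^ Suc n)"
    by (intro tendsto_intros)
  moreover have "eval_fps F q * (\<Prod>n\<le>K. 1 - q ^ Suc n) = eval_fps (U (Suc K)) q" for K
  proof -
    have "(\<Prod>n\<le>K. 1 - q ^ Suc n) = (\<Prod>n=1..Suc K. 1 - q ^ n)"
      by (rule prod.reindex_bij_witness[of _ "\<lambda>n. n - 1" Suc]) auto
    then show ?thesis unfolding U_def using conv_disc_eval_mult[OF F P(1) q] P(2) by simp
  qed
  ultimately have "(\<lambda>K. eval_fps (U (Suc K)) q) \<longlonglongrightarrow> eval_fps F q * prodinf (\<lambda>n. 1 - q ^ Suc n)" by simp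
  moreover have "(\<lambda>K. eval_fps (U (Suc K)) q) \<longlonglongrightarrow> 1" using lim by (rule LIMSEQ_Suc)
  ultimately show ?thesis unfolding F_def by (rule LIMSEQ_unique)
qed

context heisenberg_voa
begin

section \<open>One-point functions as convergent q-series\<close>

lemma zero_mode_vac: "zero_mode M (vac M) = (\<lambda>w. w)"
  unfolding zero_mode_weight[OF round.vac_E] by (simp add: fun_eq_iff vacuum)

text \<open>Taken in the natural numbers because the convergence estimates use positivity.\<close>

definition wdim :: "nat \<Rightarrow> nat" where
  "wdim N = (SOME n. tr (int N) (\<lambda>w. w) = of_nat n)"

lemma trace_id_W: "tr (int N) (\<lambda>w. w) = of_nat (wdim N)"
proof -
  have "\<exists>n. tr (int N) (\<lambda>w. w) = of_nat n" using trace_on_id[OF W_subspace, of "int N"] by blast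
  then show ?thesis unfolding wdim_def by (rule someI_ex)
qed

lemma one_pt_vac: "one_pt (vac M) = Abs_fps (\<lambda>N. of_nat (wdim N))"
  by (simp add: one_pt_def wtrace_def zero_mode_vac trace_id_W)

lemma wdim_0: "wdim 0 = 1"
proof -
  obtain B where B: "is_basis_of M B (W 0)" "tr 0 (\<lambda>w. w) = of_nat (card B)"
    using trace_on_id[OF W_subspace, of 0] by blast
  have "card B = dim (W 0)" using B(1) unfolding is_basis_of_def by (intro basis_card_eq_dim) auto
  also have "W 0 = span {vac M}" by (rule round.E_0)
  also have "dim (span {vac M}) = 1"
    by (subst dim_span_eq_card_independent) (simp_all add: vac_nonzero)
  finally have "(of_nat (wdim 0) :: complex) = of_nat 1" using B(2) trace_id_W[of 0] by simp
  then show ?thesis by (simp only: of_nat_eq_iff)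
qed

text \<open>Both sides are the trace of \<open>L(0) = o(\<omega>)\<close>, the right one by recursion applied to \<open>\<omega> = a(-1)a/2\<close>.\<close>

lemma wdim_rec: "of_nat N * of_nat (wdim N) = fps_nth (sigma_fps 1 * Abs_fps (\<lambda>n. of_nat (wdim n))) N"
proof -
  have J: "mode M a (int i) a = 0" if "i \<ge> 2" for i using that by (simp add: a_a)
  have P: "P_fps 2 a n = fps_const (of_int n) * one_pt (vac M)" for n
    by (simp add: P_fps_def numeral_2_eq_2 a_a)
  have "fps_nth (one_pt (mode M a (- 1 - int 0) a)) N = (\<Sum>n=1..N. 2 * (of_nat n ^ 1 * fps_nth (q_frac n * one_pt (vac M)) N))"
  proof -
    have "fps_nth (one_pt (mode M a (- 1 - int 0) a)) N
      = (\<Sum>n=1..N. (of_int (- int n - 1) gchoose 0) * fps_nth (q_frac n * P_fps 2 a (int n)) N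
         - (of_int (int n - 1) gchoose 0) * fps_nth (q_frac n * P_fps 2 a (- int n)) N)"
      by (rule one_pt_a_neg[OF weight_one]) (rule J)
    also have "\<dots> = (\<Sum>n=1..N. 2 * (of_nat n ^ 1 * fps_nth (q_frac n * one_pt (vac M)) N))"
      unfolding P by (intro sum.cong refl) (simp add: mult.left_commute[of "q_frac _"])
    finally show ?thesis .
  qed
  also have "\<dots> = 2 * fps_nth (sigma_fps 1 * one_pt (vac M)) N"
    unfolding sum_distrib_left[symmetric] sum_q_frac ..
  finally have 1: "fps_nth (one_pt (mode M a (- 1) a)) N = 2 * fps_nth (sigma_fps 1 * one_pt (vac M)) N" by simp
  have "conf M = smult M (1/2) (mode M a (-1) a)" unfolding conformal_vector a_eq ..
  then have "one_pt (conf M) = fps_const (1/2) * one_pt (mode M a (-1) a)" by (simp only: one_pt_scale)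
  then have "fps_nth (one_pt (conf M)) N = fps_nth (sigma_fps 1 * one_pt (vac M)) N" using 1 by simp
  moreover have "fps_nth (one_pt (conf M)) N = of_nat N * of_nat (wdim N)"
  proof -
    have "fps_nth (one_pt (conf M)) N = tr (int N) (zero_mode M (conf M))" by (simp add: one_pt_def wtrace_def)
    also have "\<dots> = tr (int N) (\<lambda>w. smult M (of_nat N) w)"
      unfolding zero_mode_weight[OF conf_weight]
      by (rule trace_on_cong[OF W_subspace]) (simp add: weight_space_def vir_def)
    also have "\<dots> = of_nat N * of_nat (wdim N)"
      by (subst trace_on_scale[OF W_subspace]) (auto simp: trace_id_W)
    finally show ?thesis .
  qed
  ultimately show ?thesis by (simp add: one_pt_vac)
qed

lemma conv_disc_one_pt_vac: "conv_disc (one_pt (vac M))"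
  unfolding one_pt_vac by (rule sigma_recursion_bounded) (rule wdim_rec)

text \<open>Recursion expresses the one-point series of a monomial through those of shorter
  monomials, down to the vacuum.\<close>

lemma conv_disc_one_pt: "conv_disc (one_pt v)"
proof (induction v rule: sq.gr.eig_induct)
  case (add x y)
  then show ?case by (simp add: one_pt_add conv_disc_add)
next
  case (eig k v)
  have cre: "conv_disc (one_pt (sq.cre N))" if "0 \<notin># N" for N
    using that
  proof (induction "size N" arbitrary: N rule: less_induct)
    case less
    show ?case
    proof (cases N)
      case empty
      then show ?thesis by (simp add: conv_disc_one_pt_vac)
    next
      case (add m N')
      then have m: "m > 0" "0 \<notin># N'" using less.prems by auto
      have R: "al (int j) (sq.cre N') = 0" if "j > nat (msum N')" for j
        by (rule sq.A_vanish[OF sq.cre_E]) (use that in auto)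
      have "one_pt (sq.cre N) = (\<Sum>j=1..nat (msum N'). C_fps m j * one_pt (al (int j) (sq.cre N')))"
        unfolding add sq.cre_add by (rule one_pt_recursion[OF _ m(1)]) (rule R)
      also have "conv_disc \<dots>"
      proof (intro conv_disc_sum conv_disc_mult conv_disc_C_fps)
        fix j
        show "conv_disc (one_pt (al (int j) (sq.cre N')))"
        proof (cases "j \<in># N'")
          case True
          then have "size (N' - {#j#}) < size N" by (simp add: add size_Diff1_less less_SucI)
          moreover have "0 \<notin># N' - {#j#}" using m by (meson in_diffD)
          ultimately have "conv_disc (one_pt (sq.cre (N' - {#j#})))" using less.hyps by blast
          then show ?thesis by (simp add: sq.A_cre_nat one_pt_scale conv_disc_mult)
        next
          case False
          then show ?thesis by (simp add: sq.A_cre_nat not_in_iff)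
        qed
      qed
      finally show ?thesis .
    qed
  qed
  show ?case
    using eig unfolding sq.E_eq_span
  proof (induction rule: span_induct_alt)
    case (step c x y)
    then show ?case using cre by (auto simp: partitions_def one_pt_add one_pt_scale intro!: conv_disc_add conv_disc_mult)
  qed simp
qed

text \<open>Weight spaces of negative weight are zero, so the sum over the integers is a power
  series in q.\<close>

lemma graded_trace_eval:
  assumes "Im \<tau> > 0"
  shows "genus1_point M v \<tau> = eval_fps (one_pt v) (nome \<tau>)"
proof -
  define q where "q = nome \<tau>"
  have q: "norm q < 1" using assms norm_nome_less_1 by (simp add: q_def)
  define g where "g n = wtrace n v * q powi n" for n
  have "((\<lambda>n. fps_nth (one_pt v) n * q ^ n) has_sum eval_fps (one_pt v) q) UNIV"
    by (intro norm_summable_imp_has_sum conv_disc_summable conv_disc_sums conv_disc_one_pt q)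
  then have "((g \<circ> int) has_sum eval_fps (one_pt v) q) UNIV" by (simp add: o_def g_def one_pt_def)
  then have "(g has_sum eval_fps (one_pt v) q) (range int)" by (simp add: has_sum_reindex)
  then have "infsum g (range int) = eval_fps (one_pt v) q" by (rule infsumI)
  moreover have "infsum g UNIV = infsum g (range int)"
  proof (rule infsum_cong_neutral)
    fix x :: int assume "x \<in> UNIV - range int"
    then have "x < 0" by (metis DiffD2 not_less range_eqI zero_le_imp_eq_int)
    then show "g x = 0" by (simp add: g_def wtrace_neg)
  qed auto
  ultimately show ?thesis by (simp add: genus1_point_def graded_trace_def g_def[abs_def] wtrace_def q_def)
qed

lemma genus1_partition_eval:
  assumes "Im \<tau> > 0"
  shows "genus1_partition M \<tau> = eval_fps (one_pt (vac M)) (nome \<tau>)"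
  using graded_trace_eval[OF assms, of "vac M"]
  by (simp add: genus1_partition_def genus1_point_def zero_mode_vac)

lemma genus1_partition_eta:
  assumes "Im \<tau> > 0"
  shows "genus1_partition M \<tau> = nome_root24 \<tau> / dedekind_eta \<tau>"
proof -
  have "eval_fps (one_pt (vac M)) (nome \<tau>) * prodinf (\<lambda>n. 1 - nome \<tau> ^ Suc n) = 1"
    unfolding one_pt_vac by (rule euler_product[OF wdim_rec wdim_0 norm_nome_less_1[OF assms]])
  moreover have "nome_root24 \<tau> \<noteq> 0" by (simp add: nome_root24_def)
  ultimately show ?thesis
    unfolding genus1_partition_eval[OF assms] dedekind_eta_def
    by (metis divide_self_if mult.commute mult_zero_right nonzero_divide_mult_cancel_left nonzero_eq_divide_eq zero_neq_one)
qed

lemma genus1_point_linear: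
  assumes "Im \<tau> > 0"
  shows "genus1_point M (v + w) \<tau> = genus1_point M v \<tau> + genus1_point M w \<tau>"
    "genus1_point M (smult M c v) \<tau> = c * genus1_point M v \<tau>"
  using assms norm_nome_less_1[OF assms]
  by (simp_all add: graded_trace_eval one_pt_add one_pt_scale conv_disc_eval_add conv_disc_eval_mult conv_disc_one_pt)

lemma genus1_recursion:
  assumes "Im \<tau> > 0" "k > 0" "\<And>j. j > R \<Longrightarrow> al (int j) v = 0"
  shows "genus1_point M (al (- int k) v) \<tau> = (\<Sum>j=1..R. C_coeff k j \<tau> / of_nat j * genus1_point M (al (int j) v) \<tau>)"
proof -
  have q: "norm (nome \<tau>) < 1" by (rule norm_nome_less_1[OF assms(1)])
  have "genus1_point M (al (- int k) v) \<tau> = eval_fps (\<Sum>j=1..R. C_fps k j * one_pt (al (int j) v)) (nome \<tau>)"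
    unfolding graded_trace_eval[OF assms(1)] by (subst one_pt_recursion[where R = R]) (use assms in auto)
  also have "\<dots> = (\<Sum>j=1..R. eval_fps (C_fps k j) (nome \<tau>) * eval_fps (one_pt (al (int j) v)) (nome \<tau>))"
    using q by (subst conv_disc_eval_sum) (auto simp: conv_disc_eval_mult conv_disc_mult conv_disc_C_fps conv_disc_one_pt)
  also have "\<dots> = (\<Sum>j=1..R. C_coeff k j \<tau> / of_nat j * genus1_point M (al (int j) v) \<tau>)"
    unfolding graded_trace_eval[OF assms(1)] by (intro sum.cong refl) (simp add: eval_C_fps assms)
  finally show ?thesis .
qed

end

section \<open>Truncated matrices\<close>

lemma suminf_fps_nth:
  fixes f :: "nat \<Rightarrow> complex fps"
  assumes "\<And>n d. d < n \<Longrightarrow> fps_nth (f n) d = 0" and "d \<le> N"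
  shows "fps_nth (suminf f) d = (\<Sum>n\<le>N. fps_nth (f n) d)"
proof -
  define F where "F = Abs_fps (\<lambda>d. \<Sum>n\<le>d. fps_nth (f n) d)"
  have eq: "(\<Sum>n<K. fps_nth (f n) d) = (\<Sum>n\<le>d. fps_nth (f n) d)" if "K > d" for K d
    by (rule sum.mono_neutral_right) (use that assms(1) in auto)
  have "(\<lambda>K. \<Sum>n<K. f n) \<longlonglongrightarrow> F"
  proof (rule tendsto_fpsI)
    fix d
    show "\<forall>\<^sub>F K in sequentially. fps_nth (\<Sum>n<K. f n) d = fps_nth F d"
      using eventually_gt_at_top[of d] by eventually_elim (simp add: fps_sum_nth eq F_def)
  qed
  then have "suminf f = F" using sums_unique[of f F] by (simp add: sums_def)
  then show ?thesis
    using eq[of d "Suc N"] assms(2) by (simp add: F_def lessThan_Suc_atMost)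
qed

lemma suminf_Suc_fps_nth:
  fixes f :: "nat \<Rightarrow> complex fps"
  assumes "\<And>n d. d < n \<Longrightarrow> fps_nth (f n) d = 0" and "d \<le> N"
  shows "fps_nth (suminf (\<lambda>n. f (Suc n))) d = (\<Sum>n=1..N. fps_nth (f n) d)"
proof -
  have "fps_nth (suminf (\<lambda>n. f (Suc n))) d = (\<Sum>n\<le>N. fps_nth (f (Suc n)) d)"
    by (rule suminf_fps_nth) (use assms in auto)
  also have "\<dots> = (\<Sum>n=1..Suc N. fps_nth (f n) d)"
    by (rule sum.reindex_bij_witness[of _ "\<lambda>n. n - 1" Suc]) auto
  also have "\<dots> = (\<Sum>n=1..N. fps_nth (f n) d)" using assms by simp
  finally show ?thesis .
qed

type_synonym fmat = "nat \<Rightarrow> nat \<Rightarrow> complex fps"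

definition fin_mult :: "nat \<Rightarrow> fmat \<Rightarrow> fmat \<Rightarrow> fmat" where
  "fin_mult R A B k l = (\<Sum>m=1..R. A k m * B m l)"

text \<open>Shifted by one: the value at n is the power n + 1, which avoids the identity
  matrix.\<close>

fun fin_pow :: "nat \<Rightarrow> fmat \<Rightarrow> nat \<Rightarrow> fmat" where
  "fin_pow R P 0 = P"
| "fin_pow R P (Suc n) = fin_mult R P (fin_pow R P n)"

definition fin_trace :: "nat \<Rightarrow> fmat \<Rightarrow> complex fps" where
  "fin_trace R A = (\<Sum>k=1..R. A k k)"

text \<open>Left multiplication by the diagonal matrix N = diag(1, 2, ...).\<close>

definition row_weight :: "fmat \<Rightarrow> fmat" where "row_weight A k l = of_nat k * A k l"

lemma fin_mult_assoc: "fin_mult R (fin_mult R A B) C = fin_mult R A (fin_mult R B C)"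
proof (intro ext)
  fix k l
  show "fin_mult R (fin_mult R A B) C k l = fin_mult R A (fin_mult R B C) k l"
    unfolding fin_mult_def sum_distrib_left sum_distrib_right by (subst sum.swap) (simp only: mult.assoc)
qed

lemma fin_trace_comm: "fin_trace R (fin_mult R A B) = fin_trace R (fin_mult R B A)"
  unfolding fin_trace_def fin_mult_def by (subst sum.swap) (simp only: mult.commute)

lemma fin_pow_commute: "fin_mult R (fin_pow R P n) P = fin_mult R P (fin_pow R P n)"
  by (induction n) (simp_all add: fin_mult_assoc)

lemma fin_pow_mult: "fin_mult R (fin_pow R P m) (fin_pow R P n) = fin_pow R P (Suc (m + n))"
  by (induction m) (simp_all add: fin_mult_assoc)

section \<open>Derivatives of traces of powers\<close>

text \<open>\<open>grad X = 0\<close> says that \<open>X k l\<close> is a multiple of \<open>s\<^bsup>k+l\<^esup>\<close>, where \<open>s = \<epsilon>\<^bsup>1/2\<^esup>\<close> is the series variable.\<close>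

definition grad :: "fmat \<Rightarrow> fmat" where
  "grad X k l = theta (X k l) - (of_nat k + of_nat l) * X k l"

lemma theta_sum: "theta (sum f I) = (\<Sum>i\<in>I. theta (f i))"
  by (rule fps_ext) (simp add: theta_nth fps_sum_nth sum_distrib_left)

text \<open>The inner index is subtracted in both grad X and grad Y but not for the product; the
  last term restores it.\<close>

lemma grad_mult:
  "grad (fin_mult R X Y) k l = fin_mult R (grad X) Y k l + fin_mult R X (grad Y) k l
     + 2 * fin_mult R X (row_weight Y) k l"
  unfolding grad_def fin_mult_def theta_sum theta_mult row_weight_def sum_distrib_left sum_subtractf[symmetric] sum.distrib[symmetric]
  by (intro sum.cong refl) (simp add: algebra_simps)

lemma fin_trace_add: "fin_trace R (\<lambda>k l. A k l + B k l) = fin_trace R A + fin_trace R B"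
  by (simp add: fin_trace_def sum.distrib)
lemma fin_trace_cmult: "fin_trace R (\<lambda>k l. c * A k l) = c * fin_trace R A"
  by (simp add: fin_trace_def sum_distrib_left)
lemma fin_mult_add_right: "fin_mult R Z (\<lambda>k l. A k l + B k l) = (\<lambda>k l. fin_mult R Z A k l + fin_mult R Z B k l)"
  by (simp add: fun_eq_iff fin_mult_def distrib_left sum.distrib)
lemma fin_mult_cmult_right: "fin_mult R Z (\<lambda>k l. c * A k l) = (\<lambda>k l. c * fin_mult R Z A k l)"
  by (simp add: fun_eq_iff fin_mult_def sum_distrib_left mult.left_commute)
lemma fin_mult_cmult_left: "fin_mult R (\<lambda>k l. c * A k l) Z = (\<lambda>k l. c * fin_mult R A Z k l)"
  by (simp add: fun_eq_iff fin_mult_def sum_distrib_left mult.assoc)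

locale two_matrices =
  fixes R :: nat and A1 A2 :: fmat
  assumes sym1: "A1 k l = A1 l k" and sym2: "A2 k l = A2 l k"
    and grad1: "grad A1 = (\<lambda>k l. 0)" and grad2: "grad A2 = (\<lambda>k l. 0)"
begin

abbreviation mm (infixl "\<star>" 70) where "A \<star> B \<equiv> fin_mult R A B"

definition P where "P = A1 \<star> A2"
definition Q where "Q = A1 \<star> row_weight A2"

abbreviation PP where "PP \<equiv> fin_pow R P"
abbreviation T where "T \<equiv> fin_trace R"

lemma grad_P: "grad P = (\<lambda>k l. 2 * Q k l)"
proof (intro ext)
  fix k l
  show "grad P k l = 2 * Q k l" unfolding P_def grad_mult grad1 grad2 Q_def by (simp add: fin_mult_def)
qed

text \<open>Each of the n + 1 factors P of the second power contributes grad P = 2Q, and each of the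
  n joints between them a factor 2N; cyclicity brings all terms to the same shape. The induction
  moves factors into the first power, hence the general m.\<close>

lemma trace_grad_pow:
  "T (PP m \<star> grad (PP n)) = of_nat (2 * (n + 1)) * T (Q \<star> PP (m + n)) + of_nat (2 * n) * T (row_weight (PP (Suc (m + n))))"
proof (induction n arbitrary: m)
  case 0
  have "T (PP m \<star> grad P) = 2 * T (PP m \<star> Q)"
    unfolding grad_P fin_mult_cmult_right fin_trace_cmult ..
  then show ?case by (simp add: fin_trace_comm[of R "PP m" Q])
next
  case (Suc n)
  have g: "grad (PP (Suc n)) = (\<lambda>k l. (2 * (Q \<star> PP n) k l + (P \<star> grad (PP n)) k l) + 2 * (P \<star> row_weight (PP n)) k l)"
    by (intro ext) (simp add: grad_mult grad_P fin_mult_cmult_left)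
  have "T (PP m \<star> (Q \<star> PP n)) = T (Q \<star> PP (Suc (m + n)))"
  proof -
    have "T (PP m \<star> (Q \<star> PP n)) = T ((Q \<star> PP n) \<star> PP m)" by (rule fin_trace_comm)
    also have "(Q \<star> PP n) \<star> PP m = Q \<star> PP (Suc (n + m))" unfolding fin_mult_assoc fin_pow_mult ..
    finally show ?thesis by (simp add: add.commute)
  qed
  moreover have "PP m \<star> (P \<star> grad (PP n)) = PP (Suc m) \<star> grad (PP n)"
    by (simp add: fin_mult_assoc[symmetric] fin_pow_commute)
  moreover have "T (PP m \<star> (P \<star> row_weight (PP n))) = T (row_weight (PP (Suc (Suc (m + n)))))"
  proof -
    have "T (PP m \<star> (P \<star> row_weight (PP n))) = T ((PP m \<star> P) \<star> row_weight (PP n))"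
      by (simp only: fin_mult_assoc)
    also have "\<dots> = T (row_weight (PP n) \<star> (PP m \<star> P))" by (rule fin_trace_comm)
    also have "row_weight (PP n) \<star> (PP m \<star> P) = row_weight (PP n \<star> (PP m \<star> P))"
      by (simp add: fun_eq_iff fin_mult_def row_weight_def sum_distrib_left mult.assoc)
    also have "PP n \<star> (PP m \<star> P) = PP (Suc (Suc (m + n)))"
    proof -
      have "PP m \<star> P = PP (Suc m)" by (simp add: fin_pow_commute)
      then have "PP n \<star> (PP m \<star> P) = PP (Suc (n + Suc m))" by (simp only: fin_pow_mult)
      then show ?thesis by (simp only: add_Suc_right add.commute)
    qed
    finally show ?thesis .
  qed
  ultimately have "T (PP m \<star> grad (PP (Suc n))) = 2 * T (Q \<star> PP (Suc (m + n))) + T (PP (Suc m) \<star> grad (PP n)) + 2 * T (row_weight (PP (Suc (Suc (m + n)))))"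
    unfolding g fin_mult_add_right fin_mult_cmult_right fin_trace_add fin_trace_cmult by simp
  also have "T (PP (Suc m) \<star> grad (PP n)) = of_nat (2 * (n + 1)) * T (Q \<star> PP (Suc m + n)) + of_nat (2 * n) * T (row_weight (PP (Suc (Suc m + n))))"
    by (rule Suc)
  finally show ?case by (simp add: algebra_simps)
qed

text \<open>By symmetry of A1 and A2 the transpose of P is the product of A2 and A1.\<close>

lemma transpose_pow: "(A2 \<star> (PP n \<star> A1)) k l = PP (Suc n) l k"
proof (induction n arbitrary: k l)
  case 0
  have "(A2 \<star> (P \<star> A1)) k l = ((A2 \<star> A1) \<star> (A2 \<star> A1)) k l" by (simp add: P_def fin_mult_assoc)
  also have "\<dots> = (P \<star> P) l k"
  proof -
    have "(A2 \<star> A1) k l = P l k" for k l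
      unfolding P_def fin_mult_def by (intro sum.cong refl) (metis mult.commute sym1 sym2)
    then show ?thesis unfolding fin_mult_def[of R "A2 \<star> A1"] fin_mult_def[of R P]
      by (simp add: mult.commute)
  qed
  finally show ?case by simp
next
  case (Suc n)
  have "(A2 \<star> (PP (Suc n) \<star> A1)) k l = ((A2 \<star> A1) \<star> (A2 \<star> (PP n \<star> A1))) k l"
    by (simp add: P_def fin_mult_assoc)
  also have "\<dots> = (PP (Suc n) \<star> P) l k"
  proof -
    have "(A2 \<star> A1) k l = P l k" for k l
      unfolding P_def fin_mult_def by (intro sum.cong refl) (metis mult.commute sym1 sym2)
    then show ?thesis unfolding fin_mult_def[of R "A2 \<star> A1"] Suc fin_mult_def[of R "PP (Suc n)"]
      by (simp add: mult.commute)
  qed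
  finally show ?case by (simp add: fin_pow_commute del: fin_pow.simps) (simp add: fin_pow_commute)
qed

text \<open>Q is A1 N A2 with N = diag(1, 2, ...). Cyclicity brings N to the front, and the diagonal
  is unaffected by the transposition in \<open>transpose_pow\<close>.\<close>

lemma trace_Q_pow: "T (Q \<star> PP n) = T (row_weight (PP (Suc n)))"
proof -
  have "T (Q \<star> PP n) = T (row_weight A2 \<star> (PP n \<star> A1))"
    unfolding Q_def fin_mult_assoc by (subst fin_trace_comm) (simp only: fin_mult_assoc)
  also have "row_weight A2 \<star> (PP n \<star> A1) = row_weight (A2 \<star> (PP n \<star> A1))"
    by (simp add: fun_eq_iff fin_mult_def row_weight_def sum_distrib_left mult.assoc)
  also have "T \<dots> = T (row_weight (PP (Suc n)))"
    unfolding fin_trace_def row_weight_def transpose_pow ..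
  finally show ?thesis .
qed

lemma trace_Q: "T Q = T (row_weight P)"
proof -
  have "T Q = T (row_weight A2 \<star> A1)" unfolding Q_def by (rule fin_trace_comm)
  also have "\<dots> = T (row_weight P)"
    unfolding fin_trace_def row_weight_def P_def fin_mult_def sum_distrib_left
    by (intro sum.cong refl) (metis mult.assoc mult.commute sym1 sym2)
  finally show ?thesis .
qed

text \<open>The trace of the power n + 1 of P is a cyclic product of 2(n+1) symmetric factors whose
  entries are multiples of s^(k+l). The operator s d/ds counts each of the 2(n+1) indices twice, and
  all indices contribute equally.\<close>

lemma theta_trace_pow: "theta (T (PP n)) = of_nat (4 * (n + 1)) * T (row_weight (PP n))"
proof -
  have g: "theta (T X) = T (grad X) + 2 * T (row_weight X)" for X
    unfolding fin_trace_def theta_sum grad_def row_weight_def sum_distrib_left sum.distrib[symmetric]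
    by (intro sum.cong refl) (simp add: algebra_simps)
  show ?thesis
  proof (cases n)
    case 0
    then show ?thesis unfolding g
      by (simp add: grad_P fin_trace_cmult trace_Q)
  next
    case (Suc n')
    have "grad (PP (Suc n')) = (\<lambda>k l. (2 * (Q \<star> PP n') k l + (P \<star> grad (PP n')) k l) + 2 * (P \<star> row_weight (PP n')) k l)"
      by (intro ext) (simp add: grad_mult grad_P fin_mult_cmult_left)
    then have "T (grad (PP (Suc n'))) = 2 * T (Q \<star> PP n') + T (PP 0 \<star> grad (PP n')) + 2 * T (P \<star> row_weight (PP n'))"
      by (simp add: fin_trace_add fin_trace_cmult)
    also have "T (P \<star> row_weight (PP n')) = T (row_weight (PP n') \<star> P)" by (rule fin_trace_comm)
    also have "row_weight (PP n') \<star> P = row_weight (PP n' \<star> P)"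
      by (simp add: fun_eq_iff fin_mult_def row_weight_def sum_distrib_left mult.assoc)
    also have "PP n' \<star> P = PP (Suc n')" by (simp add: fin_pow_commute)
    also have "T (PP 0 \<star> grad (PP n')) = of_nat (2 * (n' + 1)) * T (Q \<star> PP (0 + n')) + of_nat (2 * n') * T (row_weight (PP (Suc (0 + n'))))"
      by (rule trace_grad_pow)
    finally show ?thesis unfolding g Suc trace_Q_pow by (simp add: algebra_simps)
  qed
qed

end

text \<open>Since \<open>A(k,l)\<close> is a multiple of \<open>s\<^bsup>k+l\<^esup>\<close>, only indices up to \<open>R\<close> matter modulo \<open>s\<^bsup>R+1\<^esup>\<close>, and the infinite matrices may be cut down to size \<open>R\<close>.\<close>

definition fps_agree :: "nat \<Rightarrow> complex fps \<Rightarrow> complex fps \<Rightarrow> bool" where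
  "fps_agree R f g \<longleftrightarrow> (\<forall>d\<le>R. fps_nth f d = fps_nth g d)"

lemma fps_agree_refl [simp]: "fps_agree R f f" by (simp add: fps_agree_def)
lemma fps_agree_trans: "fps_agree R f g \<Longrightarrow> fps_agree R g h \<Longrightarrow> fps_agree R f h" by (simp add: fps_agree_def)
lemma fps_agree_add: "fps_agree R f g \<Longrightarrow> fps_agree R f' g' \<Longrightarrow> fps_agree R (f + f') (g + g')"
  by (simp add: fps_agree_def)
lemma fps_agree_mult: "fps_agree R f g \<Longrightarrow> fps_agree R f' g' \<Longrightarrow> fps_agree R (f * f') (g * g')"
  by (auto simp: fps_agree_def fps_mult_nth intro!: sum.cong)
lemma fps_agree_sum: "(\<And>i. i \<in> I \<Longrightarrow> fps_agree R (f i) (g i)) \<Longrightarrow> fps_agree R (sum f I) (sum g I)"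
  by (auto simp: fps_agree_def fps_sum_nth intro!: sum.cong)

lemma fps_mult_low:
  assumes "\<And>d. d < p \<Longrightarrow> fps_nth f d = 0" "\<And>d. d < q \<Longrightarrow> fps_nth g d = 0" "d < p + q"
  shows "fps_nth (f * g) d = (0 :: complex)"
  unfolding fps_mult_nth
proof (rule sum.neutral, rule ballI)
  fix i assume "i \<in> {0..d}"
  then have "i < p \<or> d - i < q" using assms(3) by auto
  then show "fps_nth f i * fps_nth g (d - i) = 0" using assms(1,2) by auto
qed

lemma fps_mult_low_left:
  assumes "\<And>d. d < p \<Longrightarrow> fps_nth f d = 0" "d < p"
  shows "fps_nth (f * g) d = (0 :: complex)"
  using fps_mult_low[of p f 0 g d] assms by auto

lemma inf_mat_mult_agree:
  assumes "\<And>k l. l \<ge> 1 \<Longrightarrow> fps_agree R (A k l) (A' k l)" "\<And>k. k \<ge> 1 \<Longrightarrow> fps_agree R (B k l) (B' k l)"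
    and "\<And>m d. d < m \<Longrightarrow> fps_nth (A k m) d = 0"
  shows "fps_agree R (inf_mat_mult A B k l) (fin_mult R A' B' k l)"
  unfolding fps_agree_def
proof (intro allI impI)
  fix d assume d: "d \<le> R"
  have "fps_nth (inf_mat_mult A B k l) d = (\<Sum>m=1..R. fps_nth (A k m * B m l) d)"
    unfolding inf_mat_mult_def
    by (rule suminf_Suc_fps_nth[OF _ d]) (rule fps_mult_low_left[OF assms(3)])
  also have "\<dots> = fps_nth (fin_mult R A' B' k l) d"
    unfolding fin_mult_def fps_sum_nth
  proof (intro sum.cong refl)
    fix m assume "m \<in> {1..R}"
    then have "fps_agree R (A k m * B m l) (A' k m * B' m l)"
      using assms by (intro fps_agree_mult) auto
    then show "fps_nth (A k m * B m l) d = fps_nth (A' k m * B' m l) d"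
      using d by (simp add: fps_agree_def)
  qed
  finally show "fps_nth (inf_mat_mult A B k l) d = fps_nth (fin_mult R A' B' k l) d" .
qed

lemma inf_mat_mult_low:
  assumes "\<And>m d. d < m \<Longrightarrow> fps_nth (A k m) d = 0" "\<And>m d. d < l \<Longrightarrow> fps_nth (B m l) d = 0" "d < l"
  shows "fps_nth (inf_mat_mult A B k l) d = 0"
proof -
  have "fps_nth (inf_mat_mult A B k l) d = (\<Sum>m=1..d. fps_nth (A k m * B m l) d)"
    unfolding inf_mat_mult_def
    by (rule suminf_Suc_fps_nth) (auto intro: fps_mult_low_left[OF assms(1)])
  also have "\<dots> = 0"
    by (rule sum.neutral) (use fps_mult_low[of 0 _ l _ d] assms in auto)
  finally show ?thesis .
qed

lemma inf_mat_power_agree: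
  assumes "\<And>k l. l \<ge> 1 \<Longrightarrow> fps_agree R (P k l) (P' k l)" "\<And>k m d. d < m \<Longrightarrow> fps_nth (P k m) d = 0" "l \<ge> 1"
  shows "fps_agree R (inf_mat_power P (Suc n) k l) (fin_pow R P' n k l)"
proof (induction n arbitrary: k)
  case 0
  have "inf_mat_power P (Suc 0) k l = P k l"
  proof (rule fps_ext)
    fix d
    define N where "N = max d l"
    have "fps_nth (inf_mat_power P (Suc 0) k l) d = (\<Sum>m=1..N. fps_nth (P k m * (if m = l then 1 else 0)) d)"
      unfolding inf_mat_power.simps inf_mat_mult_def
      by (rule suminf_Suc_fps_nth[where f = "\<lambda>m. P k m * (if m = l then 1 else 0)"]) (use assms(2) in \<open>auto simp: N_def\<close>)
    also have "\<dots> = (\<Sum>m=1..N. if m = l then fps_nth (P k l) d else 0)" by (intro sum.cong) auto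
    also have "\<dots> = fps_nth (P k l) d" using assms(3) by (simp add: N_def)
    finally show "fps_nth (inf_mat_power P (Suc 0) k l) d = fps_nth (P k l) d" .
  qed
  then show ?case using assms by simp
next
  case (Suc n)
  have "fps_agree R (inf_mat_mult P (inf_mat_power P (Suc n)) k l) (fin_mult R P' (fin_pow R P' n) k l)"
    by (rule inf_mat_mult_agree) (use assms Suc in auto)
  then show ?case by (simp only: inf_mat_power.simps fin_pow.simps)
qed

text \<open>Every factor is divisible by s, and there are n + 1 of them.\<close>

lemma fin_pow_low:
  assumes "\<And>k l. fps_nth (P k l) 0 = 0" "d \<le> n"
  shows "fps_nth (fin_pow R P n k l) d = 0"
  using assms(2)
proof (induction n arbitrary: k l d)
  case 0
  then show ?case by (simp add: assms)
next
  case (Suc n)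
  have "fps_nth (P k m * fin_pow R P n m l) d = 0" for m
    by (rule fps_mult_low[of 1 _ "Suc n"]) (use assms(1) Suc in auto)
  then show ?case by (simp add: fin_mult_def fps_sum_nth)
qed

section \<open>The matrices A and first-order equations in s\<close>

lemma A_matrix_low: "d < k + l \<Longrightarrow> fps_nth (A_matrix \<tau> k l) d = 0"
  unfolding A_matrix_def by (simp add: fps_X_power_mult_nth)

lemma A_matrix_nth: "fps_nth (A_matrix \<tau> k l * f) d
   = (if k + l \<le> d then C_coeff k l \<tau> / of_real (sqrt (real k * real l)) * fps_nth f (d - (k + l)) else 0)"
  unfolding A_matrix_def by (simp add: mult.assoc fps_X_power_mult_nth not_less)

lemma A_matrix_nth_0: "fps_nth (A_matrix \<tau> k l) 0 = 0"
  using A_matrix_low[of 0 k l \<tau>] by (cases "k + l = 0") (auto simp: A_matrix_def)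

lemma C_coeff_sym: "C_coeff k l \<tau> = C_coeff l k \<tau>"
proof (cases "even (k + l)")
  case True
  then have "(-1 :: complex) ^ (k + 1) = (-1) ^ (l + 1)" by auto
  then show ?thesis unfolding C_coeff_def by (simp only: add.commute[of k l] mult.commute[of "fact (k - 1)"])
qed (simp add: C_coeff_def eisenstein_E_def add.commute)

lemma A_matrix_sym: "A_matrix \<tau> k l = A_matrix \<tau> l k"
  unfolding A_matrix_def by (simp only: C_coeff_sym[of k l] add.commute[of k l] mult.commute[of "real k"])

lemma grad_A_matrix: "grad (A_matrix \<tau>) = (\<lambda>k l. 0)"
proof (intro ext fps_ext)
  fix k l d
  have "(of_nat k + of_nat l :: complex fps) = fps_const (of_nat (k + l))"
    unfolding fps_of_nat by simp
  then have "fps_nth (grad (A_matrix \<tau>) k l) d = (of_nat d - of_nat (k + l)) * fps_nth (A_matrix \<tau> k l) d"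
    unfolding grad_def by (simp add: theta_nth left_diff_distrib)
  also have "\<dots> = 0" by (cases "d = k + l") (auto simp: A_matrix_def fps_X_power_mult_nth)
  finally show "fps_nth (grad (A_matrix \<tau>) k l) d = fps_nth 0 d" by simp
qed

text \<open>As h has no constant term, the coefficient of degree n of f h involves only earlier
  coefficients of f.\<close>

lemma theta_equation_unique:
  assumes "theta f = f * h" "theta g = g * h" "fps_nth h 0 = 0" "fps_nth f 0 = fps_nth g 0"
  shows "f = g"
proof (rule fps_ext)
  fix n
  show "fps_nth f n = fps_nth g n"
  proof (induction n rule: less_induct)
    case (less n)
    show ?case
    proof (cases "n = 0")
      case False
      have "fps_nth (f * h) n = fps_nth (g * h) n"
        unfolding fps_mult_nth
      proof (intro sum.cong refl)
        fix i assume "i \<in> {0..n}"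
        then show "fps_nth f i * fps_nth h (n - i) = fps_nth g i * fps_nth h (n - i)"
          using less assms(3) by (cases "i = n") auto
      qed
      then have "of_nat n * fps_nth f n = of_nat n * fps_nth g n"
        unfolding theta_nth[symmetric] assms .
      then show ?thesis using False by simp
    qed (simp add: assms)
  qed
qed

lemma theta_compose_exp:
  assumes "fps_nth f 0 = 0"
  shows "theta (fps_compose (fps_exp 1) f) = fps_compose (fps_exp 1) f * theta f"
  unfolding theta_def using assms by (simp add: fps_compose_deriv mult_ac)

section \<open>The genus two partition function\<close>

context heisenberg_voa
begin

context
  fixes B :: "nat \<Rightarrow> 'v set" and \<tau>\<^sub>1 \<tau>\<^sub>2 :: complex
  assumes tau: "Im \<tau>\<^sub>1 > 0" "Im \<tau>\<^sub>2 > 0"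
    and B: "\<And>n. is_basis_of M (B n) (weight_space (square_bracket M) (int n))"
begin

section \<open>Representing the one-point function by duality\<close>

definition "phi1 v = genus1_point M v \<tau>\<^sub>1"
definition "phi2 v = genus1_point M v \<tau>\<^sub>2"

lemma phi_add: "phi1 (v + w) = phi1 v + phi1 w" "phi2 (v + w) = phi2 v + phi2 w"
  using tau by (simp_all add: phi1_def phi2_def genus1_point_linear)
lemma phi_scale: "phi1 (smult M c v) = c * phi1 v" "phi2 (smult M c v) = c * phi2 v"
  using tau by (simp_all add: phi1_def phi2_def genus1_point_linear)
lemma phi_zero [simp]: "phi1 0 = 0" "phi2 0 = 0" using phi_scale[of 0 0] by simp_all
lemma phi_sum: "phi1 (sum f I) = (\<Sum>i\<in>I. phi1 (f i))" "phi2 (sum f I) = (\<Sum>i\<in>I. phi2 (f i))"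
  by (induction I rule: infinite_finite_induct) (auto simp: phi_add)

lemma B': "B n \<subseteq> sq.E (int n)" "independent (B n)" "span (B n) = sq.E (int n)" "finite (B n)"
proof -
  show b: "B n \<subseteq> sq.E (int n)" "independent (B n)" using B[of n] by (auto simp: is_basis_of_def sq_E)
  show "span (B n) = sq.E (int n)" using is_basis_of_span[OF B[of n]] by (simp add: sq_E sq.gr.subspace_eig)
  obtain F where "finite F" "sq.E (int n) \<subseteq> span F" using sq.E_finite_dim[of "int n"] by blast
  then show "finite (B n)" using is_basis_of_finite[OF B[of n]] by (simp add: sq_E)
qed

definition dual_vec :: "nat \<Rightarrow> 'v \<Rightarrow> 'v" where "dual_vec n u = dual_elem sq.form (sq.E (int n)) (B n) u"

lemma dual_zero:
  assumes "z \<in> sq.E (int n)" "\<And>u. u \<in> B n \<Longrightarrow> sq.form u z = 0"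
  shows "z = 0"
proof (rule sq.form_nondegenerate[OF assms(1)])
  fix y assume "y \<in> sq.E (int n)"
  then have "y \<in> span (B n)" by (simp add: B')
  then have "sq.form y z = 0"
    by (induction rule: span_induct_alt) (simp_all add: sq.form_add_left sq.form_scale_left assms(2))
  then show "sq.form z y = 0" by (simp add: sq.form_sym)
qed

text \<open>Existence comes from representing the coordinate functional of u with respect to
  \<open>B n\<close>, uniqueness from non-degeneracy.\<close>

lemma dual_vec:
  assumes "u \<in> B n"
  shows "dual_vec n u \<in> sq.E (int n)" "\<And>u'. u' \<in> B n \<Longrightarrow> sq.form u' (dual_vec n u) = (if u' = u then 1 else 0)"
proof -
  have "\<exists>w\<in>sq.E (int n). \<forall>x\<in>sq.E (int n). sq.form x w = representation (B n) x u"
    using B'[of n] by (intro sq.form_represent) (simp_all add: representation_add representation_scale)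
  then obtain w where w: "w \<in> sq.E (int n)" "\<And>x. x \<in> sq.E (int n) \<Longrightarrow> sq.form x w = representation (B n) x u" by blast
  have w': "sq.form u' w = (if u' = u then 1 else 0)" if "u' \<in> B n" for u'
    using w(2)[of u'] that B'[of n] by (auto simp: representation_basis)
  have "dual_vec n u = w" unfolding dual_vec_def dual_elem_def
  proof (rule the_equality)
    show "w \<in> sq.E (int n) \<and> (\<forall>u'\<in>B n. sq.form u' w = (if u' = u then 1 else 0))" using w w' by blast
    fix w2 assume w2: "w2 \<in> sq.E (int n) \<and> (\<forall>u'\<in>B n. sq.form u' w2 = (if u' = u then 1 else 0))"
    have "w2 - w = 0"
      by (rule dual_zero) (use w w' w2 in \<open>auto simp: form_diff_right intro: subspace_diff[OF sq.gr.subspace_eig]\<close>)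
    then show "w2 = w" by simp
  qed
  then show "dual_vec n u \<in> sq.E (int n)" "\<And>u'. u' \<in> B n \<Longrightarrow> sq.form u' (dual_vec n u) = (if u' = u then 1 else 0)"
    using w w' by auto
qed

text \<open>The vector of weight \<open>n\<close> representing the one-point function at \<open>\<tau>\<^sub>2\<close>: the inner sum of the genus two partition function is the one-point function of \<open>gam n\<close> at \<open>\<tau>\<^sub>1\<close>.\<close>

definition gam :: "int \<Rightarrow> 'v" where
  "gam n = (if n < 0 then 0 else \<Sum>u\<in>B (nat n). smult M (phi2 (dual_vec (nat n) u)) u)"

lemma gam_E: "gam n \<in> sq.E n"
proof (cases "n < 0")
  case False
  then have "B (nat n) \<subseteq> sq.E n" using B'(1)[of "nat n"] by simp
  then show ?thesis using False unfolding gam_def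
    by (auto intro!: subspace_sum[OF sq.gr.subspace_eig] subspace_scale[OF sq.gr.subspace_eig])
qed (simp add: gam_def subspace_0[OF sq.gr.subspace_eig])

lemma gam_neg: "n < 0 \<Longrightarrow> gam n = 0" by (simp add: gam_def)

text \<open>The vector w is expanded in the dual basis; the difference pairs to zero with every
  element of \<open>B n\<close>.\<close>

lemma form_gam:
  assumes "w \<in> sq.E n"
  shows "sq.form (gam n) w = phi2 w"
proof (cases "n < 0")
  case True
  then show ?thesis using sq.E_neg[of n] assms by (simp add: gam_def)
next
  case False
  define m where "m = nat n"
  have n: "n = int m" using False by (simp add: m_def)
  define z where "z = w - (\<Sum>u\<in>B m. smult M (sq.form u w) (dual_vec m u))"
  have "z = 0"
  proof (rule dual_zero)
    show "z \<in> sq.E (int m)" unfolding z_def using assms dual_vec(1) n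
      by (intro subspace_diff[OF sq.gr.subspace_eig] subspace_sum[OF sq.gr.subspace_eig] subspace_scale[OF sq.gr.subspace_eig]) auto
    fix u assume u: "u \<in> B m"
    have "sq.form u (\<Sum>u'\<in>B m. smult M (sq.form u' w) (dual_vec m u')) = (\<Sum>u'\<in>B m. if u' = u then sq.form u w else 0)"
      unfolding sq.form_sum_right sq.form_scale_right using dual_vec(2) u by (intro sum.cong refl) auto
    also have "\<dots> = sq.form u w" using u B'(4) by simp
    finally show "sq.form u z = 0" by (simp add: z_def form_diff_right)
  qed
  then have "w = (\<Sum>u\<in>B m. smult M (sq.form u w) (dual_vec m u))" by (simp add: z_def)
  then have "phi2 w = (\<Sum>u\<in>B m. sq.form u w * phi2 (dual_vec m u))" by (metis (no_types, lifting) phi_scale(2) phi_sum(2) sum.cong)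
  also have "\<dots> = sq.form (gam n) w"
    using False by (simp add: gam_def m_def sq.form_sum_left sq.form_scale_left mult.commute)
  finally show ?thesis ..
qed

lemma phi1_al:
  assumes "x \<in> sq.E m" "k > 0" "m \<le> int R"
  shows "phi1 (al (- int k) x) = (\<Sum>j=1..R. C_coeff k j \<tau>\<^sub>1 / of_nat j * phi1 (al (int j) x))"
  unfolding phi1_def
proof (rule genus1_recursion[OF tau(1) assms(2)])
  show "al (int j) x = 0" if "j > R" for j by (rule sq.A_vanish[OF assms(1)]) (use assms that in auto)
qed

lemma phi2_al:
  assumes "x \<in> sq.E m" "k > 0" "m \<le> int R"
  shows "phi2 (al (- int k) x) = (\<Sum>j=1..R. C_coeff k j \<tau>\<^sub>2 / of_nat j * phi2 (al (int j) x))"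
  unfolding phi2_def
proof (rule genus1_recursion[OF tau(2) assms(2)])
  show "al (int j) x = 0" if "j > R" for j by (rule sq.A_vanish[OF assms(1)]) (use assms that in auto)
qed

text \<open>Both sides are compared by pairing with w. Adjunction is used twice, once in each
  direction, so the signs cancel.\<close>

lemma al_gam:
  assumes "k > 0" "n - int k \<le> int R"
  shows "al (int k) (gam n) = (\<Sum>l=1..R. smult M (C_coeff k l \<tau>\<^sub>2 / of_nat l) (al (- int l) (gam (n - int k - int l))))"
proof -
  define y where "y = (\<Sum>l=1..R. smult M (C_coeff k l \<tau>\<^sub>2 / of_nat l) (al (- int l) (gam (n - int k - int l))))"
  have y: "y \<in> sq.E (n - int k)" unfolding y_def
  proof (intro subspace_sum[OF sq.gr.subspace_eig] subspace_scale[OF sq.gr.subspace_eig])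
    fix l show "al (- int l) (gam (n - int k - int l)) \<in> sq.E (n - int k)"
      using sq.A_E_minus[OF gam_E, of "int l" "n - int k - int l"] by simp
  qed
  have "al (int k) (gam n) - y = 0"
  proof (rule sq.form_nondegenerate)
    show "al (int k) (gam n) - y \<in> sq.E (n - int k)"
      by (intro subspace_diff[OF sq.gr.subspace_eig] sq.A_E gam_E y)
    fix w assume w: "w \<in> sq.E (n - int k)"
    have kw: "al (- int k) w \<in> sq.E n" using sq.A_E_minus[OF w, of "int k"] by simp
    have "sq.form (al (int k) (gam n)) w = - phi2 (al (- int k) w)"
      by (simp add: sq.form_A form_gam[OF kw])
    also have "\<dots> = - (\<Sum>j=1..R. C_coeff k j \<tau>\<^sub>2 / of_nat j * phi2 (al (int j) w))"
      unfolding phi2_al[OF w assms] ..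
    also have "\<dots> = sq.form y w"
      unfolding y_def sq.form_sum_left sq.form_scale_left sum_negf[symmetric]
    proof (intro sum.cong refl)
      fix j
      have "al (int j) w \<in> sq.E (n - int k - int j)" by (rule sq.A_E[OF w])
      then have "sq.form (al (- int j) (gam (n - int k - int j))) w = - phi2 (al (int j) w)"
        by (simp add: sq.form_A form_gam)
      then show "- (C_coeff k j \<tau>\<^sub>2 / of_nat j * phi2 (al (int j) w))
        = C_coeff k j \<tau>\<^sub>2 / of_nat j * sq.form (al (- int j) (gam (n - int k - int j))) w" by simp
    qed
    finally show "sq.form (al (int k) (gam n) - y) w = 0" by (simp add: form_diff_left)
  qed
  then show ?thesis by (simp add: y_def)
qed

section \<open>The matrix equation for U\<close>

definition "Z2 = fps_compose (genus2_partition M B \<tau>\<^sub>1 \<tau>\<^sub>2) (fps_X ^ 2)"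

lemma Z2_nth: "fps_nth Z2 d = (if even d then phi1 (gam (int d div 2)) else 0)"
proof -
  have "fps_nth (genus2_partition M B \<tau>\<^sub>1 \<tau>\<^sub>2) n = phi1 (gam (int n))" for n
    unfolding genus2_partition_def fps_nth_Abs_fps liz_metric_sq sq_E dual_vec_def[symmetric] phi1_def[symmetric] phi2_def[symmetric] gam_def
    by (simp add: phi_sum phi_scale mult.commute)
  moreover have "int (d div 2) = int d div 2" by (simp add: zdiv_int)
  ultimately show ?thesis unfolding Z2_def fps_nth_compose_X_power by simp
qed

text \<open>Series in \<open>s = \<epsilon>\<^bsup>1/2\<^esup>\<close>: the coefficient of \<open>s\<^sup>d\<close> uses the weight that makes the power \<open>s\<^bsup>k+l\<^esup>\<close> in \<open>A(k,l)\<close> match; \<^term>\<open>gam\<close> vanishes at negative weights.\<close>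

definition Umat :: fmat where
  "Umat k l = Abs_fps (\<lambda>d. if even (d + k + l)
     then phi1 (al (- int k) (al (int l) (gam ((int d + int l - int k) div 2)))) / of_real (sqrt (real k * real l)) else 0)"

definition Wmat :: fmat where
  "Wmat k l = Abs_fps (\<lambda>d. if even (d + k + l)
     then phi1 (al (- int k) (al (- int l) (gam ((int d - int l - int k) div 2)))) / of_real (sqrt (real k * real l)) else 0)"

lemma Wmat_sym: "Wmat k l = Wmat l k"
proof (rule fps_ext)
  fix d
  have e: "int d - int l - int k = int d - int k - int l" by simp
  have p: "even (d + k + l) = even (d + l + k)" by presburger
  show "fps_nth (Wmat k l) d = fps_nth (Wmat l k) d"
    unfolding Wmat_def fps_nth_Abs_fps e p mult.commute[of "real k"] by (simp only: sq.A_commute_neg[of k l])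
qed

text \<open>This is why entries are divided by sqrt(kl): a matrix product then absorbs the factor
  1/m of the recursion.\<close>

lemma sqrt_fact:
  assumes "k > 0" "l > 0" "m > 0"
  shows "x / complex_of_real (sqrt (real k * real m)) * (y / complex_of_real (sqrt (real m * real l)))
    = x * (y / of_nat m) / complex_of_real (sqrt (real k * real l))"
proof -
  have s: "complex_of_real (sqrt (real m)) * complex_of_real (sqrt (real m)) = of_nat m"
    by (simp flip: of_real_mult)
  show ?thesis using assms s by (simp add: real_sqrt_mult field_simps)
qed

text \<open>Inserting \<open>al_gam\<close> for a[l] applied to \<open>gam\<close> gives U = W
  A_2.\<close>

lemma Umat_eq:
  assumes "k > 0" "l > 0"
  shows "fps_agree R (Umat k l) (fin_mult R Wmat (A_matrix \<tau>\<^sub>2) k l)"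
  unfolding fps_agree_def
proof (intro allI impI)
  fix d assume d: "d \<le> R"
  define n where "n = (int d + int l - int k) div 2"
  define sq where "sq = complex_of_real (sqrt (real k * real l))"
  have R: "fps_nth (fin_mult R Wmat (A_matrix \<tau>\<^sub>2) k l) d
    = (\<Sum>m=1..R. if m + l \<le> d then fps_nth (Wmat k m) (d - (m + l)) * (C_coeff m l \<tau>\<^sub>2 / of_real (sqrt (real m * real l))) else 0)"
    unfolding fin_mult_def fps_sum_nth mult.commute[of "Wmat _ _"] A_matrix_nth by (intro sum.cong refl) (simp add: mult.commute)
  show "fps_nth (Umat k l) d = fps_nth (fin_mult R Wmat (A_matrix \<tau>\<^sub>2) k l) d"
  proof (cases "even (d + k + l)")
    case False
    then have "fps_nth (Wmat k m) (d - (m + l)) = 0" if "m + l \<le> d" for m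
      using that by (auto simp: Wmat_def)
    then have "fps_nth (fin_mult R Wmat (A_matrix \<tau>\<^sub>2) k l) d = 0" unfolding R by (intro sum.neutral) auto
    then show ?thesis using False by (simp add: Umat_def)
  next
    case True
    then have "even (int d + int l - int k)" by presburger
    then have n: "2 * n = int d + int l - int k" by (simp add: n_def)
    have nl: "n - int l \<le> int R" using n d assms by linarith
    have "fps_nth (Umat k l) d = (\<Sum>m=1..R. C_coeff l m \<tau>\<^sub>2 / of_nat m * phi1 (al (- int k) (al (- int m) (gam (n - int l - int m))))) / sq"
      using True unfolding Umat_def n_def[symmetric] sq_def fps_nth_Abs_fps al_gam[OF assms(2) nl]
      by (simp add: sq_sum sq_scale phi_sum phi_scale)
    also have "\<dots> = fps_nth (fin_mult R Wmat (A_matrix \<tau>\<^sub>2) k l) d"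
      unfolding R sum_divide_distrib
    proof (intro sum.cong refl)
      fix m assume m: "m \<in> {1..R}"
      show "C_coeff l m \<tau>\<^sub>2 / of_nat m * phi1 (al (- int k) (al (- int m) (gam (n - int l - int m)))) / sq
        = (if m + l \<le> d then fps_nth (Wmat k m) (d - (m + l)) * (C_coeff m l \<tau>\<^sub>2 / of_real (sqrt (real m * real l))) else 0)"
      proof (cases "m + l \<le> d")
        case False
        \<comment> \<open>Terms beyond the reach of the power s^(m+l) carry a \<open>gam\<close> of
          negative weight.\<close>
        then have "n - int l - int m < 0" using n assms by linarith
        then show ?thesis using False by (simp add: gam_neg sq_zero)
      next
        case t: True
        have "int (d - (m + l)) - int m - int k = 2 * (n - int l - int m)" using n t by (simp add: of_nat_diff)
        then have e: "(int (d - (m + l)) - int m - int k) div 2 = n - int l - int m" by simp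
        have "even (d - (m + l) + k + m)" using True t by simp
        then have "fps_nth (Wmat k m) (d - (m + l)) = phi1 (al (- int k) (al (- int m) (gam (n - int l - int m)))) / of_real (sqrt (real k * real m))"
          unfolding Wmat_def fps_nth_Abs_fps e by simp
        then have "fps_nth (Wmat k m) (d - (m + l)) * (C_coeff m l \<tau>\<^sub>2 / of_real (sqrt (real m * real l)))
          = phi1 (al (- int k) (al (- int m) (gam (n - int l - int m)))) * (C_coeff m l \<tau>\<^sub>2 / of_nat m) / sq"
          unfolding sq_def using sqrt_fact[OF assms(1,2), of m] m by simp
        then show ?thesis using t by (simp only: if_True C_coeff_sym[of l m] mult.commute)
      qed
    qed
    finally show ?thesis .
  qed
qed

text \<open>Recursion at tau_1 for the state a[-l] applied to \<open>gam\<close>. Commuting a[j]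
  past a[-l] leaves a central term at j = l, whence the summand with \<open>Z2\<close>; the rest is
  A_1 times the transpose of U.\<close>

lemma Wmat_eq:
  assumes "k > 0" "l > 0"
  shows "fps_agree R (Wmat k l) (A_matrix \<tau>\<^sub>1 k l * Z2 + fin_mult R (A_matrix \<tau>\<^sub>1) (\<lambda>j m. Umat m j) k l)"
  unfolding fps_agree_def
proof (intro allI impI)
  fix d assume d: "d \<le> R"
  define n where "n = (int d - int l - int k) div 2"
  define sq where "sq = complex_of_real (sqrt (real k * real l))"
  have R: "fps_nth (A_matrix \<tau>\<^sub>1 k l * Z2 + fin_mult R (A_matrix \<tau>\<^sub>1) (\<lambda>j m. Umat m j) k l) d
    = (if k + l \<le> d then C_coeff k l \<tau>\<^sub>1 / sq * fps_nth Z2 (d - (k + l)) else 0)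
     + (\<Sum>j=1..R. if k + j \<le> d then C_coeff k j \<tau>\<^sub>1 / of_real (sqrt (real k * real j)) * fps_nth (Umat l j) (d - (k + j)) else 0)"
    unfolding fin_mult_def fps_add_nth fps_sum_nth A_matrix_nth sq_def ..
  show "fps_nth (Wmat k l) d = fps_nth (A_matrix \<tau>\<^sub>1 k l * Z2 + fin_mult R (A_matrix \<tau>\<^sub>1) (\<lambda>j m. Umat m j) k l) d"
  proof (cases "even (d + k + l)")
    case False
    then have "fps_nth (Umat l j) (d - (k + j)) = 0" if "k + j \<le> d" for j
      using that by (auto simp: Umat_def)
    moreover have "fps_nth Z2 (d - (k + l)) = 0" if "k + l \<le> d" using False that by (auto simp: Z2_nth)
    ultimately have "fps_nth (A_matrix \<tau>\<^sub>1 k l * Z2 + fin_mult R (A_matrix \<tau>\<^sub>1) (\<lambda>j m. Umat m j) k l) d = 0 + 0"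
      unfolding R by (intro arg_cong2[where f = "(+)"] sum.neutral) auto
    then show ?thesis using False by (simp add: Wmat_def)
  next
    case True
    then have "even (int d - int l - int k)" by presburger
    then have n: "2 * n = int d - int l - int k" by (simp add: n_def)
    have W: "fps_nth (Wmat k l) d = phi1 (al (- int k) (al (- int l) (gam n))) / sq"
      using True by (simp add: Wmat_def n_def sq_def)
    show ?thesis
    proof (cases "k + l \<le> d")
      case False
      then have "n < 0" using n by linarith
      moreover have "fps_nth (Umat l j) (d - (k + j)) = 0" if "k + j \<le> d" for j
      proof -
        have "int (d - (k + j)) + int j - int l = 2 * n" using n that by (simp add: of_nat_diff)
        then have "(int (d - (k + j)) + int j - int l) div 2 = n" by simp
        then show ?thesis using gam_neg[OF \<open>n < 0\<close>] by (simp add: Umat_def sq_zero)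
      qed
      ultimately have "fps_nth (A_matrix \<tau>\<^sub>1 k l * Z2 + fin_mult R (A_matrix \<tau>\<^sub>1) (\<lambda>j m. Umat m j) k l) d = 0 + 0"
        unfolding R using False by (intro arg_cong2[where f = "(+)"] sum.neutral) auto
      then show ?thesis unfolding W using gam_neg[OF \<open>n < 0\<close>] by (simp add: sq_zero)
    next
      case kl: True
      have x: "al (- int l) (gam n) \<in> sq.E (n + int l)" by (rule sq.A_E_minus[OF gam_E])
      have nR: "n + int l \<le> int R" using n kl d by linarith
      have "phi1 (al (- int k) (al (- int l) (gam n))) = (\<Sum>j=1..R. C_coeff k j \<tau>\<^sub>1 / of_nat j * phi1 (al (int j) (al (- int l) (gam n))))"
        by (rule phi1_al[OF x assms(1) nR])
      also have "\<dots> = (\<Sum>j=1..R. (if j = l then C_coeff k l \<tau>\<^sub>1 * phi1 (gam n) else 0) + C_coeff k j \<tau>\<^sub>1 / of_nat j * phi1 (al (- int l) (al (int j) (gam n))))"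
      proof (intro sum.cong refl)
        fix j assume j: "j \<in> {1..R}"
        have "al (int j) (al (- int l) (gam n)) = al (- int l) (al (int j) (gam n)) + (if j = l then smult M (of_nat j) (gam n) else 0)"
          using al_CCR[of "int j" "- int l" "gam n"] by (auto simp: algebra_simps)
        then show "C_coeff k j \<tau>\<^sub>1 / of_nat j * phi1 (al (int j) (al (- int l) (gam n)))
          = (if j = l then C_coeff k l \<tau>\<^sub>1 * phi1 (gam n) else 0) + C_coeff k j \<tau>\<^sub>1 / of_nat j * phi1 (al (- int l) (al (int j) (gam n)))"
          using j by (auto simp: phi_add phi_scale field_simps)
      qed
      also have "\<dots> = C_coeff k l \<tau>\<^sub>1 * phi1 (gam n) + (\<Sum>j=1..R. C_coeff k j \<tau>\<^sub>1 / of_nat j * phi1 (al (- int l) (al (int j) (gam n))))"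
        using kl d assms by (simp add: sum.distrib)
      finally have "fps_nth (Wmat k l) d = C_coeff k l \<tau>\<^sub>1 / sq * phi1 (gam n) + (\<Sum>j=1..R. C_coeff k j \<tau>\<^sub>1 / of_nat j * phi1 (al (- int l) (al (int j) (gam n))) / sq)"
        unfolding W by (simp add: add_divide_distrib sum_divide_distrib)
      moreover have "fps_nth Z2 (d - (k + l)) = phi1 (gam n)"
      proof -
        have "int (d - (k + l)) = 2 * n" using n kl by (simp add: of_nat_diff)
        then have "int (d - (k + l)) div 2 = n" by simp
        moreover have "even (d - (k + l))" using True kl by presburger
        ultimately show ?thesis by (simp only: Z2_nth if_True)
      qed
      moreover have "(\<Sum>j=1..R. C_coeff k j \<tau>\<^sub>1 / of_nat j * phi1 (al (- int l) (al (int j) (gam n))) / sq)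
        = (\<Sum>j=1..R. if k + j \<le> d then C_coeff k j \<tau>\<^sub>1 / of_real (sqrt (real k * real j)) * fps_nth (Umat l j) (d - (k + j)) else 0)"
      proof (intro sum.cong refl)
        fix j assume j: "j \<in> {1..R}"
        show "C_coeff k j \<tau>\<^sub>1 / of_nat j * phi1 (al (- int l) (al (int j) (gam n))) / sq
          = (if k + j \<le> d then C_coeff k j \<tau>\<^sub>1 / of_real (sqrt (real k * real j)) * fps_nth (Umat l j) (d - (k + j)) else 0)"
        proof (cases "k + j \<le> d")
          case False
          then have "n < int j" using n assms by linarith
          then have "al (int j) (gam n) = 0" by (rule sq.A_vanish[OF gam_E])
          then show ?thesis using False by (simp add: sq_zero)
        next
          case kj: True
          have "int (d - (k + j)) + int j - int l = 2 * n" using n kj by (simp add: of_nat_diff)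
          then have e: "(int (d - (k + j)) + int j - int l) div 2 = n" by simp
          have "even (d - (k + j) + l + j)" using True kj by presburger
          then have "fps_nth (Umat l j) (d - (k + j)) = phi1 (al (- int l) (al (int j) (gam n))) / of_real (sqrt (real j * real l))"
            unfolding Umat_def fps_nth_Abs_fps e by (simp add: mult.commute)
          moreover have "C_coeff k j \<tau>\<^sub>1 / of_real (sqrt (real k * real j)) * (X / of_real (sqrt (real j * real l)))
            = C_coeff k j \<tau>\<^sub>1 * (X / of_nat j) / sq" for X
            unfolding sq_def by (rule sqrt_fact) (use assms j in auto)
          ultimately show ?thesis using kj by (simp only: if_True times_divide_eq_left times_divide_eq_right)
        qed
      qed
      ultimately show ?thesis unfolding R using kl by simp
    qed
  qed
qed

definition "A12 R = fin_mult R (A_matrix \<tau>\<^sub>1) (A_matrix \<tau>\<^sub>2)"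

text \<open>W is symmetric, so its equation can be transposed; this turns the transpose of U into U
  itself, with A_1 on the right.\<close>

lemma Umat_step:
  assumes "k > 0" "l > 0"
  shows "fps_agree R (Umat k l) (Z2 * A12 R k l + fin_mult R Umat (A12 R) k l)"
proof -
  have W: "fps_agree R (Wmat k m) (Z2 * A_matrix \<tau>\<^sub>1 k m + fin_mult R Umat (A_matrix \<tau>\<^sub>1) k m)" if "m > 0" for m
  proof -
    have "fps_agree R (Wmat m k) (A_matrix \<tau>\<^sub>1 m k * Z2 + fin_mult R (A_matrix \<tau>\<^sub>1) (\<lambda>j m. Umat m j) m k)"
      by (rule Wmat_eq[OF that assms(1)])
    also have "A_matrix \<tau>\<^sub>1 m k * Z2 + fin_mult R (A_matrix \<tau>\<^sub>1) (\<lambda>j m. Umat m j) m k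
      = Z2 * A_matrix \<tau>\<^sub>1 k m + fin_mult R Umat (A_matrix \<tau>\<^sub>1) k m"
      unfolding fin_mult_def A_matrix_sym[of _ m] by (simp only: mult.commute)
    finally show ?thesis by (simp only: Wmat_sym[of k m])
  qed
  have "fps_agree R (fin_mult R Wmat (A_matrix \<tau>\<^sub>2) k l)
    (fin_mult R (\<lambda>k m. Z2 * A_matrix \<tau>\<^sub>1 k m + fin_mult R Umat (A_matrix \<tau>\<^sub>1) k m) (A_matrix \<tau>\<^sub>2) k l)"
    unfolding fin_mult_def[of R Wmat] fin_mult_def[of R "\<lambda>k m. Z2 * _ k m + _ k m"]
    by (intro fps_agree_sum fps_agree_mult W) auto
  also have "fin_mult R (\<lambda>k m. Z2 * A_matrix \<tau>\<^sub>1 k m + fin_mult R Umat (A_matrix \<tau>\<^sub>1) k m) (A_matrix \<tau>\<^sub>2) k l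
    = Z2 * A12 R k l + fin_mult R (fin_mult R Umat (A_matrix \<tau>\<^sub>1)) (A_matrix \<tau>\<^sub>2) k l"
    unfolding A12_def fin_mult_def[of R "\<lambda>k m. Z2 * _ k m + _ k m"] fin_mult_def[of R "A_matrix _"]
      fin_mult_def[of R "fin_mult R Umat _"]
    by (simp add: distrib_right sum.distrib sum_distrib_left mult.assoc)
  finally show ?thesis using Umat_eq[OF assms, of R] unfolding fin_mult_assoc A12_def by (rule fps_agree_trans[rotated])
qed

lemma A12_nth_0: "fps_nth (A12 R k l) 0 = 0"
  by (simp add: A12_def fin_mult_def fps_sum_nth A_matrix_nth_0)

lemma Umat_iterate:
  assumes "k > 0" "l > 0"
  shows "fps_agree R (Umat k l) ((\<Sum>j\<le>n. Z2 * fin_pow R (A12 R) j k l) + fin_mult R Umat (fin_pow R (A12 R) n) k l)"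
proof (induction n)
  case 0
  then show ?case using Umat_step[OF assms] by simp
next
  case (Suc n)
  have "fps_agree R (fin_mult R Umat (fin_pow R (A12 R) n) k l)
     (fin_mult R (\<lambda>k m. Z2 * A12 R k m + fin_mult R Umat (A12 R) k m) (fin_pow R (A12 R) n) k l)"
    unfolding fin_mult_def[of R Umat "fin_pow R (A12 R) n"] fin_mult_def[of R "\<lambda>k m. Z2 * _ k m + _ k m"]
    by (intro fps_agree_sum fps_agree_mult Umat_step assms) auto
  also have "fin_mult R (\<lambda>k m. Z2 * A12 R k m + fin_mult R Umat (A12 R) k m) (fin_pow R (A12 R) n) k l
    = Z2 * fin_pow R (A12 R) (Suc n) k l + fin_mult R (fin_mult R Umat (A12 R)) (fin_pow R (A12 R) n) k l"
    unfolding fin_pow.simps fin_mult_def[of R "\<lambda>k m. Z2 * _ k m + _ k m"] fin_mult_def[of R "A12 R"]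
      fin_mult_def[of R "fin_mult R Umat _"]
    by (simp add: distrib_right sum.distrib sum_distrib_left mult.assoc)
  also have "fin_mult R (fin_mult R Umat (A12 R)) (fin_pow R (A12 R) n) = fin_mult R Umat (fin_pow R (A12 R) (Suc n))"
    by (simp add: fin_mult_assoc)
  finally have "fps_agree R ((\<Sum>j\<le>n. Z2 * fin_pow R (A12 R) j k l) + fin_mult R Umat (fin_pow R (A12 R) n) k l)
     ((\<Sum>j\<le>n. Z2 * fin_pow R (A12 R) j k l) + (Z2 * fin_pow R (A12 R) (Suc n) k l + fin_mult R Umat (fin_pow R (A12 R) (Suc n)) k l))"
    by (intro fps_agree_add fps_agree_refl)
  with Suc show ?case unfolding sum.atMost_Suc add.assoc by (rule fps_agree_trans)
qed

text \<open>The remainder contains the power R + 1 of the matrix \<open>A12 R\<close> and is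
  divisible by s^(R+1).\<close>

lemma Umat_series:
  assumes "k > 0" "l > 0"
  shows "fps_agree R (Umat k l) (Z2 * (\<Sum>j\<le>R. fin_pow R (A12 R) j k l))"
proof -
  have "fps_agree R (fin_mult R Umat (fin_pow R (A12 R) R) k l) 0"
    unfolding fps_agree_def
  proof (intro allI impI)
    fix d assume "d \<le> R"
    then have "fps_nth (Umat k m * fin_pow R (A12 R) R m l) d = 0" for m
      by (intro fps_mult_low[of 0 _ "Suc R"]) (auto intro: fin_pow_low[OF A12_nth_0])
    then show "fps_nth (fin_mult R Umat (fin_pow R (A12 R) R) k l) d = fps_nth 0 d"
      by (simp add: fin_mult_def fps_sum_nth)
  qed
  then have "fps_agree R ((\<Sum>j\<le>R. Z2 * fin_pow R (A12 R) j k l) + fin_mult R Umat (fin_pow R (A12 R) R) k l) ((\<Sum>j\<le>R. Z2 * fin_pow R (A12 R) j k l) + 0)"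
    by (intro fps_agree_add fps_agree_refl)
  then show ?thesis using fps_agree_trans[OF Umat_iterate[OF assms]] by (simp add: sum_distrib_left)
qed

text \<open>The operator s d/ds multiplies s^(2n) by 2n, and n comes from \<open>sugawara\<close>;
  the factor k undoes the normalisation 1/sqrt(k k) of U.\<close>

lemma theta_Z2: "fps_nth (theta Z2) d = (\<Sum>k=1..d. 2 * of_nat k * fps_nth (Umat k k) d)"
proof (cases "even d")
  case False
  then show ?thesis by (simp add: theta_nth Z2_nth Umat_def)
next
  case True
  define n where "n = d div 2"
  have d: "d = 2 * n" using True by (simp add: n_def)
  have Umat: "2 * of_nat k * fps_nth (Umat k k) d = 2 * phi1 (al (- int k) (al (int k) (gam (int n))))" if "k > 0" for k
    using that by (simp add: Umat_def d)
  have "(\<Sum>k=1..d. 2 * of_nat k * fps_nth (Umat k k) d) = (\<Sum>k=1..d. 2 * phi1 (al (- int k) (al (int k) (gam (int n)))))"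
    by (intro sum.cong refl Umat) auto
  also have "\<dots> = (\<Sum>k=1..n. 2 * phi1 (al (- int k) (al (int k) (gam (int n)))))"
  proof (rule sum.mono_neutral_right)
    show "\<forall>k\<in>{1..d} - {1..n}. 2 * phi1 (al (- int k) (al (int k) (gam (int n)))) = 0"
      using sq.A_vanish[OF gam_E] by (auto simp: sq_zero)
  qed (auto simp: d)
  also have "\<dots> = 2 * phi1 (\<Sum>k=1..n. al (- int k) (al (int k) (gam (int n))))"
    by (simp add: phi_sum sum_distrib_left)
  also have "\<dots> = 2 * (of_nat n * phi1 (gam (int n)))"
    unfolding sq.sugawara[OF gam_E] phi_scale ..
  finally show ?thesis by (simp add: theta_nth Z2_nth d)
qed

section \<open>Comparison with the logarithm of the determinant\<close>

definition "log_factor = fps_const (- 1 / 2) * log_det_one_minus (inf_mat_mult (A_matrix \<tau>\<^sub>1) (A_matrix \<tau>\<^sub>2))"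

text \<open>In every power the entries of column m are divisible by s^m, so the diagonal beyond R
  does not reach degree d.\<close>

lemma trace_nth:
  assumes "d \<le> R"
  shows "fps_nth (inf_mat_trace (inf_mat_power (inf_mat_mult (A_matrix \<tau>\<^sub>1) (A_matrix \<tau>\<^sub>2)) (Suc n))) d
    = fps_nth (fin_trace R (fin_pow R (A12 R) n)) d"
proof -
  define P where "P = inf_mat_mult (A_matrix \<tau>\<^sub>1) (A_matrix \<tau>\<^sub>2)"
  have low: "fps_nth (P k m) e = 0" if "e < m" for k m e
    unfolding P_def using that by (intro inf_mat_mult_low) (auto intro: A_matrix_low)
  have P: "fps_agree R (P k l) (A12 R k l)" for k l R
    unfolding P_def A12_def by (rule inf_mat_mult_agree) (auto intro: A_matrix_low)
  have powlow: "fps_nth (fin_pow S (A12 S) n j m) x = 0" if "x < m" for S n j m x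
    using that
  proof (induction n arbitrary: j x)
    case 0
    have "fps_nth (A_matrix \<tau>\<^sub>1 j i * A_matrix \<tau>\<^sub>2 i m) x = 0" for i
      by (rule fps_mult_low[of 0 _ m]) (use 0 in \<open>auto intro: A_matrix_low\<close>)
    then show ?case by (simp add: A12_def fin_mult_def fps_sum_nth)
  next
    case (Suc n)
    have "fps_nth (A12 S j i * fin_pow S (A12 S) n i m) x = 0" for i
      by (rule fps_mult_low[of 0 _ m]) (use Suc in auto)
    then show ?case by (simp add: fin_mult_def fps_sum_nth)
  qed
  have pl: "fps_nth (inf_mat_power P (Suc n) k m) e = 0" if "e < m" for k m e n
  proof -
    have "fps_agree e (inf_mat_power P (Suc n) k m) (fin_pow e (A12 e) n k m)"
      by (rule inf_mat_power_agree) (use P low that in auto)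
    then show ?thesis using powlow[OF that] by (simp add: fps_agree_def del: inf_mat_power.simps)
  qed
  have "fps_nth (inf_mat_trace (inf_mat_power P (Suc n))) d = (\<Sum>k=1..R. fps_nth (inf_mat_power P (Suc n) k k) d)"
    unfolding inf_mat_trace_def by (rule suminf_Suc_fps_nth[where f = "\<lambda>k. inf_mat_power P (Suc n) k k"]) (use pl assms in auto)
  also have "\<dots> = (\<Sum>k=1..R. fps_nth (fin_pow R (A12 R) n k k) d)"
  proof (intro sum.cong refl)
    fix k assume "k \<in> {1..R}"
    then have "fps_agree R (inf_mat_power P (Suc n) k k) (fin_pow R (A12 R) n k k)"
      by (intro inf_mat_power_agree P low) auto
    then show "fps_nth (inf_mat_power P (Suc n) k k) d = fps_nth (fin_pow R (A12 R) n k k) d"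
      using assms by (simp add: fps_agree_def)
  qed
  finally show ?thesis by (simp add: P_def fin_trace_def fps_sum_nth)
qed

lemma trace_pow_low: "d \<le> n \<Longrightarrow> fps_nth (fin_trace R (fin_pow R (A12 R) n)) d = 0"
  by (simp add: fin_trace_def fps_sum_nth fin_pow_low[OF A12_nth_0])

text \<open>The minus sign of the logarithm and the factor -1/2 combine to 1/2;
  \<open>fin_pow\<close> at n is the power n + 1, whence n + 1 in the denominator.\<close>

lemma log_factor_nth:
  assumes "d \<le> R"
  shows "fps_nth log_factor d = (\<Sum>n\<le>R. 1 / (2 * of_nat (n + 1)) * fps_nth (fin_trace R (fin_pow R (A12 R) n)) d)"
proof -
  have "fps_nth (suminf (\<lambda>n. fps_const (1 / of_nat (Suc n)) * inf_mat_trace (inf_mat_power (inf_mat_mult (A_matrix \<tau>\<^sub>1) (A_matrix \<tau>\<^sub>2)) (Suc n)))) d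
    = (\<Sum>n\<le>R. fps_nth (fps_const (1 / of_nat (Suc n)) * inf_mat_trace (inf_mat_power (inf_mat_mult (A_matrix \<tau>\<^sub>1) (A_matrix \<tau>\<^sub>2)) (Suc n))) d)"
  proof (rule suminf_fps_nth[OF _ assms])
    fix n e :: nat assume "e < n"
    then show "fps_nth (fps_const (1 / of_nat (Suc n)) * inf_mat_trace (inf_mat_power (inf_mat_mult (A_matrix \<tau>\<^sub>1) (A_matrix \<tau>\<^sub>2)) (Suc n))) e = 0"
      using trace_nth[of e e n] by (simp add: trace_pow_low del: inf_mat_power.simps)
  qed
  also have "\<dots> = (\<Sum>n\<le>R. 1 / of_nat (Suc n) * fps_nth (fin_trace R (fin_pow R (A12 R) n)) d)"
    by (simp add: trace_nth[OF assms] del: inf_mat_power.simps of_nat_Suc)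
  finally have "fps_nth log_factor d = 1 / 2 * (\<Sum>n\<le>R. 1 / of_nat (Suc n) * fps_nth (fin_trace R (fin_pow R (A12 R) n)) d)"
    unfolding log_factor_def log_det_one_minus_def by (simp del: inf_mat_power.simps of_nat_Suc)
  then show ?thesis by (simp add: sum_distrib_left mult.assoc[symmetric] del: of_nat_Suc)
qed

text \<open>The factor 4(n+1) of \<open>theta_trace_pow\<close> against 1/(2(n+1)) leaves twice the
  traces weighted by the row index, and \<open>Umat_series\<close> with \<open>theta_Z2\<close>
  identifies their sum times \<open>Z2\<close> with the derivative of \<open>Z2\<close>.\<close>

lemma theta_log_factor: "theta Z2 = Z2 * theta log_factor"
proof (rule fps_ext)
  fix d
  \<comment> \<open>For the coefficient of s^d, matrices of size d suffice.\<close>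
  interpret tm: two_matrices d "A_matrix \<tau>\<^sub>1" "A_matrix \<tau>\<^sub>2"
    by unfold_locales (rule A_matrix_sym grad_A_matrix)+
  have P: "tm.P = A12 d" by (simp add: tm.P_def A12_def)
  define H where "H = (\<Sum>n\<le>d. 2 * fin_trace d (row_weight (fin_pow d (A12 d) n)))"
  have "fps_nth (theta log_factor) e = fps_nth H e" if "e \<le> d" for e
  proof -
    have "fps_nth (theta log_factor) e = (\<Sum>n\<le>d. 1 / (2 * of_nat (n + 1)) * fps_nth (theta (fin_trace d (fin_pow d (A12 d) n))) e)"
      unfolding theta_nth log_factor_nth[OF that] by (simp add: sum_distrib_left mult_ac)
    also have "\<dots> = (\<Sum>n\<le>d. 2 * fps_nth (fin_trace d (row_weight (fin_pow d (A12 d) n))) e)"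
    proof (intro sum.cong refl)
      fix n
      have t: "theta (fin_trace d (fin_pow d (A12 d) n)) = of_nat (4 * (n + 1)) * fin_trace d (row_weight (fin_pow d (A12 d) n))"
        using tm.theta_trace_pow[of n] unfolding P .
      have "of_nat (n + 1) \<noteq> (0 :: complex)" by (metis Suc_eq_plus1 of_nat_eq_0_iff nat.distinct(1))
      then show "1 / (2 * of_nat (n + 1)) * fps_nth (theta (fin_trace d (fin_pow d (A12 d) n))) e = 2 * fps_nth (fin_trace d (row_weight (fin_pow d (A12 d) n))) e"
        unfolding t fps_mult_of_nat_nth of_nat_mult by (simp add: field_simps del: of_nat_add of_nat_Suc)
    qed
    finally show ?thesis by (simp add: H_def fps_sum_nth numeral_fps_const)
  qed
  then have "fps_nth (Z2 * theta log_factor) d = fps_nth (Z2 * H) d"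
    unfolding fps_mult_nth by (intro sum.cong refl) auto
  also have "H = (\<Sum>k=1..d. 2 * of_nat k * (\<Sum>n\<le>d. fin_pow d (A12 d) n k k))"
    unfolding H_def fin_trace_def row_weight_def sum_distrib_left by (subst sum.swap) (simp add: mult.assoc)
  also have "fps_nth (Z2 * (\<Sum>k=1..d. 2 * of_nat k * (\<Sum>n\<le>d. fin_pow d (A12 d) n k k))) d
    = (\<Sum>k=1..d. 2 * of_nat k * fps_nth (Z2 * (\<Sum>n\<le>d. fin_pow d (A12 d) n k k)) d)"
  proof -
    have c: "2 * of_nat k = (fps_const (2 * of_nat k) :: complex fps)" for k
      by (simp add: numeral_fps_const fps_of_nat[symmetric])
    have "Z2 * (\<Sum>k=1..d. 2 * of_nat k * (\<Sum>n\<le>d. fin_pow d (A12 d) n k k))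
      = (\<Sum>k=1..d. fps_const (2 * of_nat k) * (Z2 * (\<Sum>n\<le>d. fin_pow d (A12 d) n k k)))"
      unfolding c by (subst sum_distrib_left) (simp only: mult.left_commute[of Z2])
    then show ?thesis by (simp add: fps_sum_nth)
  qed
  also have "\<dots> = (\<Sum>k=1..d. 2 * of_nat k * fps_nth (Umat k k) d)"
  proof (intro sum.cong refl arg_cong[where f = "\<lambda>x. 2 * of_nat _ * x"])
    fix k assume "k \<in> {1..d}"
    then have "fps_agree d (Umat k k) (Z2 * (\<Sum>n\<le>d. fin_pow d (A12 d) n k k))" by (intro Umat_series) auto
    then show "fps_nth (Z2 * (\<Sum>n\<le>d. fin_pow d (A12 d) n k k)) d = fps_nth (Umat k k) d"
      by (simp add: fps_agree_def)
  qed
  also have "\<dots> = fps_nth (theta Z2) d" by (rule theta_Z2[symmetric])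
  finally show "fps_nth (theta Z2) d = fps_nth (Z2 * theta log_factor) d" ..
qed

text \<open>Weight zero is spanned by the vacuum, which has norm one; this fixes the constant term
  of \<open>Z2\<close>.\<close>

lemma gam_0: "gam 0 = smult M (phi2 (vac M)) (vac M)"
proof -
  have "gam 0 \<in> sq.E 0" by (rule gam_E)
  then obtain c where c: "gam 0 = smult M c (vac M)" unfolding sq.E_0 span_singleton by blast
  moreover have "sq.form (gam 0) (vac M) = phi2 (vac M)" by (rule form_gam[OF sq.vac_E])
  ultimately have "c = phi2 (vac M)" by (simp add: sq.form_scale_left sq.form_vac)
  then show ?thesis using c by simp
qed

lemma genus2_formula:
  "fps_compose (genus2_partition M B \<tau>\<^sub>1 \<tau>\<^sub>2) (fps_X ^ 2)
     = fps_const (genus1_partition M \<tau>\<^sub>1) * fps_const (genus1_partition M \<tau>\<^sub>2)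
       * det_one_minus_inv_sqrt (inf_mat_mult (A_matrix \<tau>\<^sub>1) (A_matrix \<tau>\<^sub>2))"
proof -
  define D where "D = fps_compose (fps_exp 1) log_factor"
  define c where "c = genus1_partition M \<tau>\<^sub>1 * genus1_partition M \<tau>\<^sub>2"
  have L0: "fps_nth log_factor 0 = 0" using log_factor_nth[of 0 0] trace_pow_low[of 0 0 0] by simp
  have phi: "phi1 (vac M) = genus1_partition M \<tau>\<^sub>1" "phi2 (vac M) = genus1_partition M \<tau>\<^sub>2"
    by (simp_all add: phi1_def phi2_def genus1_partition_def genus1_point_def zero_mode_vac)
  have "Z2 = fps_const c * D"
  proof (rule theta_equation_unique[OF theta_log_factor])
    have "theta (fps_const c * D) = fps_const c * theta D"
      by (rule fps_ext) (simp add: theta_nth)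
    then show "theta (fps_const c * D) = fps_const c * D * theta log_factor"
      unfolding D_def theta_compose_exp[OF L0] by (simp add: mult.assoc)
    show "fps_nth (theta log_factor) 0 = 0" by (simp add: theta_nth)
    show "fps_nth Z2 0 = fps_nth (fps_const c * D) 0"
      by (simp add: Z2_nth gam_0 phi_scale phi c_def D_def)
  qed
  then show ?thesis
    by (simp add: Z2_def c_def D_def log_factor_def det_one_minus_inv_sqrt_def)
qed

end

end

theorem theorem6p1:
  fixes M :: "('v::ab_group_add) vertex_alg" and a :: 'v
    and B :: "nat \<Rightarrow> 'v set" and \<tau>\<^sub>1 \<tau>\<^sub>2 :: complex
  assumes "heisenberg_voa M a"
    and "Im \<tau>\<^sub>1 > 0" and "Im \<tau>\<^sub>2 > 0"
    and "\<And>n. is_basis_of M (B n) (weight_space (square_bracket M) (int n))"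
  shows "fps_compose (genus2_partition M B \<tau>\<^sub>1 \<tau>\<^sub>2) (fps_X ^ 2)
           = fps_const (genus1_partition M \<tau>\<^sub>1) * fps_const (genus1_partition M \<tau>\<^sub>2)
             * det_one_minus_inv_sqrt (inf_mat_mult (A_matrix \<tau>\<^sub>1) (A_matrix \<tau>\<^sub>2))
         \<and> (\<forall>\<tau>. Im \<tau> > 0 \<longrightarrow> genus1_partition M \<tau> = nome_root24 \<tau> / dedekind_eta \<tau>)"
proof -
  interpret heisenberg_voa M a by (rule assms(1))
  show ?thesis using genus2_formula[OF assms(2,3,4)] genus1_partition_eta by blast
qed

end
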